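(* Let $(\rho,\mathbf{u})$ be a global smooth solution on $[0,\infty)\times\mathbb{T}^n$ of the topological alignment model $$\rho_t+\nabla\cdot(\rho\mathbf{u})=0,\qquad \mathbf{u}_t+\mathbf{u}\cdot\nabla\mathbf{u}=\int_{\mathbb{T}^n}\phi(\mathbf{x},\mathbf{y})(\mathbf{u}(\mathbf{y})-\mathbf{u}(\mathbf{x}))\rho(\mathbf{y})\,d\mathbf{y},\qquad \phi(\mathbf{x},\mathbf{y})=\frac{h(|\mathbf{x}-\mathbf{y}|)}{|\mathbf{x}-\mathbf{y}|^{\alpha}}\cdot\frac{1}{d_\rho^n(\mathbf{x},\mathbf{y})},$$ with $\rho>0$. Assume that there is $c>0$ with $\rho(t,\mathbf{x})\ge \frac{c}{1+t}$ for all $t\ge0$, $\mathbf{x}\in\mathbb{T}^n$. Then there exists $C>0$ such that $$\sup_{\mathbf{x}\in\mathbb{T}^n}|\mathbf{u}(t,\mathbf{x})-\mathbf{u}_\infty|\le \frac{C}{\sqrt{\ln t}}\qquad\text{for all } t\ge 3.$$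
   Context: Fix $0<\alpha<2$, $R_0>0$ and a smooth cutoff $h\ge0$ with $\mathbf{1}_{r<R_0}\lesssim h(r)\lesssim \mathbf{1}_{r<2R_0}$. Region of communication: for $\mathbf{x}\ne\mathbf{y}$ let $\mathbf{m}=\frac{\mathbf{x}+\mathbf{y}}2$, $r=\frac{|\mathbf{x}-\mathbf{y}|}{2}$, $\mathbf{e}=\frac{\mathbf{y}-\mathbf{x}}{|\mathbf{y}-\mathbf{x}|}$ and $\Omega(\mathbf{x},\mathbf{y})=\{\mathbf{m}+rs\mathbf{e}+r\mathbf{w}: -1\le s\le 1,\ \mathbf{w}\perp\mathbf{e},\ |\mathbf{w}|<1-s^2\}$ (the image of $\Omega_0=\{(s,\mathbf{w}):|\mathbf{w}|<1-s^2,\ -1\le s\le1\}$ under the similarity sending $(\mp1,0,\dots,0)$ to $\mathbf{x},\mathbf{y}$); in dimension 1, $\Omega(x,y)$ is the closed interval between $x$ and $y$. Topological distance: $d_\rho(\mathbf{x},\mathbf{y})=\big[\int_{\Omega(\mathbf{x},\mathbf{y})}\rho(t,\mathbf{z})\,d\mathbf{z}\big]^{1/n}$. $M_0=\int\rho_0$, $P_0=\int\rho_0\mathbf{u}_0$, $\mathbf{u}_\infty=P_0/M_0$. The alignment term is understood in the principal value/weak sense. *)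

theory Defs
  imports "HOL-Analysis.Analysis"
begin

coinductive Cinf :: "('a::real_normed_vector \<Rightarrow> 'b::real_normed_vector) \<Rightarrow> bool" where
  "\<lbrakk> \<forall>x. f differentiable (at x); \<forall>v. Cinf (\<lambda>x. frechet_derivative f (at x) v) \<rbrakk> \<Longrightarrow> Cinf f"

definition smooth_halfspace :: "(real \<Rightarrow> real^'n \<Rightarrow> 'b::real_normed_vector) \<Rightarrow> bool" where
  "smooth_halfspace f \<longleftrightarrow> (\<exists>F :: real \<times> (real^'n) \<Rightarrow> 'b. Cinf F \<and> (\<forall>t\<ge>0. \<forall>x. F (t, x) = f t x))"

text \<open>Periodicity w.r.t. the lattice Z^n: functions on the torus T^n = R^n / Z^n.\<close>
definition periodic :: "(real^'n \<Rightarrow> 'b) \<Rightarrow> bool" where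
  "periodic f \<longleftrightarrow> (\<forall>x z. (\<forall>i. z $ i \<in> \<int>) \<longrightarrow> f (x + z) = f x)"

text \<open>Unit cube: fundamental domain of the torus.\<close>
definition unit_cube :: "(real^'n) set" where
  "unit_cube = cbox 0 1"

definition comm_region :: "real^'n \<Rightarrow> real^'n \<Rightarrow> (real^'n) set" where
  "comm_region x y =
    (if CARD('n) = 1 then closed_segment x y
     else (let m = (1/2) *\<^sub>R (x + y); r = norm (x - y) / 2; e = (1 / norm (y - x)) *\<^sub>R (y - x)
           in {m + (r * s) *\<^sub>R e + r *\<^sub>R w | s w. -1 \<le> s \<and> s \<le> 1 \<and> w \<bullet> e = 0 \<and> norm w < 1 - s^2}))"

text \<open>d_rho(x,y)^n = mass of rho(t,.) in Omega(x,y) (rho is the periodic lift).\<close>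
definition topo_dist_pow :: "(real \<Rightarrow> real^'n \<Rightarrow> real) \<Rightarrow> real \<Rightarrow> real^'n \<Rightarrow> real^'n \<Rightarrow> real" where
  "topo_dist_pow \<rho> t x y = integral (comm_region x y) (\<rho> t)"

definition topo_dist :: "(real \<Rightarrow> real^'n \<Rightarrow> real) \<Rightarrow> real \<Rightarrow> real^'n \<Rightarrow> real^'n \<Rightarrow> real" where
  "topo_dist \<rho> t x y = topo_dist_pow \<rho> t x y powr (1 / real CARD('n))"

definition comm_weight :: "(real \<Rightarrow> real) \<Rightarrow> real \<Rightarrow> (real \<Rightarrow> real^'n \<Rightarrow> real) \<Rightarrow> real \<Rightarrow> real^'n \<Rightarrow> real^'n \<Rightarrow> real" where
  "comm_weight h \<alpha> \<rho> t x y =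
     h (norm (x - y)) / (norm (x - y) powr \<alpha>) * (1 / (topo_dist \<rho> t x y) ^ CARD('n))"

text \<open>Truncated alignment integrand region |y - x| > eps in R^n (periodic lift).\<close>
definition align_trunc ::
  "(real \<Rightarrow> real) \<Rightarrow> real \<Rightarrow> (real \<Rightarrow> real^'n \<Rightarrow> real) \<Rightarrow> (real \<Rightarrow> real^'n \<Rightarrow> real^'n)
    \<Rightarrow> real \<Rightarrow> real^'n \<Rightarrow> real \<Rightarrow> real^'n \<Rightarrow> real^'n" where
  "align_trunc h \<alpha> \<rho> u t x \<epsilon> y =
     (if \<epsilon> < norm (y - x) then (comm_weight h \<alpha> \<rho> t x y * \<rho> t y) *\<^sub>R (u t y - u t x) else 0)"

end

theory Submission
  imports Defs
begin

text \<open>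
  Fix a component \<open>v\<close> of the velocity. Since the tips of the communication region are cones of
  half-angle below \<open>\<pi>/2\<close>, the region of \<open>x \<in> cball p a\<close> and \<open>y \<in> cball p (a/5)\<close> stays inside
  \<open>cball p a\<close>, so the kernel is at least a constant divided by the mass of that ball. With the
  density bound \<open>c / (1 + t)\<close> the energy dissipation therefore controls, up to the factor \<open>1 + t\<close>, the
  Lebesgue integral of \<open>(v - v\<^sub>p)\<^sup>2\<close> over \<open>cball p (a/5)\<close>, where \<open>v\<^sub>p\<close> is the mass average of \<open>v\<close> over
  \<open>cball p a\<close>. Overlapping small balls make all the averages comparable, and at a maximum or minimum
  point of \<open>v\<close> the distance of \<open>v\<close> to the average is controlled by the decay rate of that extremum.
  Hence the squared amplitude is at most \<open>K (1 + t)\<close> times the decay rate of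
  \<open>max v - min v + energy\<close>; as the amplitude is nonincreasing, integration in time gives the
  factor \<open>1 / ln (1 + t)\<close>.
\<close>

section \<open>Preliminaries on smooth and periodic functions\<close>

lemma nonincreasing_by_lower_tangents:
  fixes W :: "real \<Rightarrow> real"
  assumes "a \<le> b" and cont: "continuous_on {a..b} W"
    and tangent: "\<And>t. a < t \<Longrightarrow> t \<le> b \<Longrightarrow>
      \<exists>\<psi> D. (\<psi> has_real_derivative D) (at t) \<and> D \<le> 0 \<and> \<psi> t = W t \<and> (\<forall>s\<in>{a..t}. \<psi> s \<le> W s)"
  shows "W b \<le> W a"
proof (rule ccontr)
  assume "\<not> W b \<le> W a"
  then have gt: "W a < W b" by simp
  with \<open>a \<le> b\<close> have ab: "a < b" by (cases "a = b") auto
  define d where "d = (W b - W a) / (2 * (b - a))"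
  have d: "d > 0" using gt ab by (simp add: d_def)
  have dd: "d * (b - a) = (W b - W a) / 2" using ab by (simp add: d_def divide_simps)
  have "continuous_on {a..b} (\<lambda>t. W t - d * t)" by (intro continuous_intros cont)
  then obtain t where t: "t \<in> {a..b}" "\<And>s. s \<in> {a..b} \<Longrightarrow> W s - d * s \<le> W t - d * t"
    using continuous_attains_sup[of "{a..b}" "\<lambda>t. W t - d * t"] ab by auto
  have "t \<noteq> a"
  proof
    assume "t = a"
    then have "W b - d * b \<le> W a - d * a" using t(2)[of b] ab by auto
    then have "W b - W a \<le> d * (b - a)" by (simp add: algebra_simps)
    then show False using dd gt by simp
  qed
  then have "a < t" "t \<le> b" using t(1) by auto
  then obtain \<psi> D where \<psi>: "(\<psi> has_real_derivative D) (at t)" "D \<le> 0" "\<psi> t = W t"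
    "\<forall>s\<in>{a..t}. \<psi> s \<le> W s" using tangent by blast
  have der: "((\<lambda>s. \<psi> s - d * s) has_real_derivative D - d) (at t)"
    by (auto intro!: derivative_eq_intros \<psi>(1))
  have "D - d < 0" using \<psi>(2) d by simp
  from DERIV_neg_dec_left[OF der this] obtain e where e: "e > 0"
    "\<And>h. h > 0 \<Longrightarrow> h < e \<Longrightarrow> \<psi> t - d * t < \<psi> (t - h) - d * (t - h)" by auto
  define h where "h = min (e / 2) (t - a)"
  have h: "h > 0" "h < e" "t - h \<ge> a" "h \<le> t - a" using e(1) \<open>a < t\<close> by (auto simp: h_def)
  have "\<psi> (t - h) \<le> W (t - h)" using \<psi>(4) h by auto
  moreover have "W (t - h) - d * (t - h) \<le> W t - d * t" using h \<open>t \<le> b\<close> by (intro t(2)) auto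
  ultimately show False using e(2)[OF h(1,2)] \<psi>(3) by linarith
qed

lemma Cinf_has_derivative:
  "Cinf f \<Longrightarrow> (f has_derivative frechet_derivative f (at x)) (at x)"
  by (auto elim: Cinf.cases simp: frechet_derivative_works)

lemma Cinf_frechet_derivative: "Cinf f \<Longrightarrow> Cinf (\<lambda>x. frechet_derivative f (at x) v)"
  by (auto elim: Cinf.cases)

lemma Cinf_continuous_on: "Cinf f \<Longrightarrow> continuous_on S f"
  by (meson Cinf_has_derivative continuous_at_imp_continuous_on has_derivative_continuous)

lemma Cinf_frechet_derivative_bounded:
  fixes f :: "'a::euclidean_space \<Rightarrow> 'b::real_normed_vector"
  assumes "Cinf f" "bounded K"
  shows "\<exists>B\<ge>0. \<forall>x\<in>K. \<forall>v. norm (frechet_derivative f (at x) v) \<le> B * norm v"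
proof -
  have "\<exists>B\<ge>0. \<forall>x\<in>K. norm (frechet_derivative f (at x) b) \<le> B" for b
  proof -
    have "compact ((\<lambda>x. frechet_derivative f (at x) b) ` closure K)"
      using assms by (intro compact_continuous_image Cinf_continuous_on Cinf_frechet_derivative)
        (auto simp: compact_closure)
    then have "bounded ((\<lambda>x. frechet_derivative f (at x) b) ` closure K)" by (rule compact_imp_bounded)
    then obtain B where "\<forall>x\<in>closure K. norm (frechet_derivative f (at x) b) \<le> B"
      unfolding bounded_iff by auto
    then show ?thesis using closure_subset[of K]
      by (intro exI[of _ "max B 0"]) (auto simp: le_max_iff_disj)
  qed
  then obtain B where B: "\<And>b. B b \<ge> 0" "\<And>b x. x \<in> K \<Longrightarrow> norm (frechet_derivative f (at x) b) \<le> B b"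
    by metis
  show ?thesis
  proof (intro exI[of _ "\<Sum>b\<in>Basis. B b"] conjI ballI allI)
    show "0 \<le> (\<Sum>b\<in>Basis. B b)" by (simp add: B sum_nonneg)
    fix x v assume x: "x \<in> K"
    interpret L: bounded_linear "frechet_derivative f (at x)"
      using Cinf_has_derivative[OF assms(1)] has_derivative_bounded_linear by blast
    have "frechet_derivative f (at x) v = (\<Sum>b\<in>Basis. (v \<bullet> b) *\<^sub>R frechet_derivative f (at x) b)"
      by (subst euclidean_representation[of v, symmetric]) (simp only: L.sum L.scaleR)
    also have "norm \<dots> \<le> (\<Sum>b\<in>Basis. norm v * B b)"
      by (rule sum_norm_le) (auto intro!: mult_mono B x Basis_le_norm)
    finally show "norm (frechet_derivative f (at x) v) \<le> (\<Sum>b\<in>Basis. B b) * norm v"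
      by (simp add: sum_distrib_left mult.commute)
  qed
qed

lemma Cinf_lipschitz_on_bounded:
  fixes f :: "'a::euclidean_space \<Rightarrow> 'b::real_normed_vector"
  assumes "Cinf f" "bounded K" "convex K"
  shows "\<exists>B\<ge>0. \<forall>x\<in>K. \<forall>y\<in>K. norm (f x - f y) \<le> B * norm (x - y)"
proof -
  obtain B where B: "B \<ge> 0" "\<forall>x\<in>K. \<forall>v. norm (frechet_derivative f (at x) v) \<le> B * norm v"
    using Cinf_frechet_derivative_bounded[OF assms(1,2)] by auto
  have "norm (f x - f y) \<le> B * norm (x - y)" if "x \<in> K" "y \<in> K" for x y
    using that B by (intro differentiable_bound[OF assms(3), where f' = "\<lambda>x. frechet_derivative f (at x)"])
      (auto intro!: has_derivative_at_withinI Cinf_has_derivative assms onorm_le)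
  then show ?thesis using B(1) by auto
qed

lemma Cinf_second_difference:
  fixes f :: "'a::euclidean_space \<Rightarrow> 'b::real_normed_vector"
  assumes f: "Cinf f" and "bounded K" "convex K"
  shows "\<exists>B\<ge>0. \<forall>x z. x + z \<in> K \<longrightarrow> x - z \<in> K \<longrightarrow>
    norm (f (x + z) + f (x - z) - 2 *\<^sub>R f x) \<le> B * (norm z)\<^sup>2"
proof -
  have "\<forall>b. \<exists>B\<ge>0. \<forall>x\<in>K. \<forall>y\<in>K.
      norm (frechet_derivative f (at x) b - frechet_derivative f (at y) b) \<le> B * norm (x - y)"
    using Cinf_lipschitz_on_bounded[OF Cinf_frechet_derivative[OF f] assms(2,3)] by blast
  then obtain B where B: "\<And>b. B b \<ge> 0" "\<And>b x y. x \<in> K \<Longrightarrow> y \<in> K \<Longrightarrow>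
      norm (frechet_derivative f (at x) b - frechet_derivative f (at y) b) \<le> B b * norm (x - y)"
    by metis
  define L where "L = (\<Sum>b\<in>Basis. B b)"
  have L0: "L \<ge> 0" by (simp add: L_def B sum_nonneg)
  have L: "norm (frechet_derivative f (at x) v - frechet_derivative f (at y) v) \<le> L * norm (x - y) * norm v"
    if "x \<in> K" "y \<in> K" for x y v
  proof -
    interpret D: bounded_linear "\<lambda>v. frechet_derivative f (at x) v - frechet_derivative f (at y) v"
      using Cinf_has_derivative[OF f] has_derivative_bounded_linear
      by (intro bounded_linear_sub) blast+
    let ?D = "\<lambda>v. frechet_derivative f (at x) v - frechet_derivative f (at y) v"
    have "?D v = (\<Sum>b\<in>Basis. (v \<bullet> b) *\<^sub>R ?D b)"
    proof -
      have "?D v = ?D (\<Sum>b\<in>Basis. (v \<bullet> b) *\<^sub>R b)" by (simp only: euclidean_representation)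
      also have "\<dots> = (\<Sum>b\<in>Basis. (v \<bullet> b) *\<^sub>R ?D b)" by (simp only: D.sum D.scaleR)
      finally show ?thesis .
    qed
    also have "norm \<dots> \<le> (\<Sum>b\<in>Basis. norm v * (B b * norm (x - y)))"
      using that by (intro sum_norm_le) (auto intro!: mult_mono B Basis_le_norm)
    finally show ?thesis
      by (simp add: L_def sum_distrib_left sum_distrib_right mult_ac)
  qed
  show ?thesis
  proof (intro exI[of _ "2 * L"] conjI allI impI)
    show "0 \<le> 2 * L" using L0 by simp
    fix x z assume xz: "x + z \<in> K" "x - z \<in> K"
    have seg: "x + s *\<^sub>R z \<in> K" if "s \<in> {-1..1}" for s
    proof -
      have "x + s *\<^sub>R z = ((1 + s) / 2) *\<^sub>R (x + z) + ((1 - s) / 2) *\<^sub>R (x - z)"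
      proof -
        have "((1 + s) / 2) *\<^sub>R (x + z) + ((1 - s) / 2) *\<^sub>R (x - z)
          = ((1 + s) / 2 + (1 - s) / 2) *\<^sub>R x + ((1 + s) / 2 - (1 - s) / 2) *\<^sub>R z"
          by (simp only: scaleR_left_distrib scaleR_right_distrib scaleR_left_diff_distrib scaleR_right_diff_distrib)
             simp
        also have "\<dots> = x + s *\<^sub>R z" by (simp add: field_simps)
        finally show ?thesis by simp
      qed
      also have "\<dots> \<in> K" using that by (intro convexD[OF assms(3) xz]) (auto simp: field_simps)
      finally show ?thesis .
    qed
    define g where "g = (\<lambda>s::real. f (x + s *\<^sub>R z) + f (x - s *\<^sub>R z))"
    define g' where "g' = (\<lambda>s t::real. t *\<^sub>R (frechet_derivative f (at (x + s *\<^sub>R z)) z - frechet_derivative f (at (x - s *\<^sub>R z)) z))"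
    have gd: "(g has_derivative g' s) (at s within {0..1})" for s
    proof -
      have lin: "linear (frechet_derivative f (at y))" for y
        using Cinf_has_derivative[OF f] has_derivative_linear by blast
      have "((\<lambda>s. f (x + s *\<^sub>R z)) has_derivative (\<lambda>t. frechet_derivative f (at (x + s *\<^sub>R z)) (t *\<^sub>R z))) (at s within {0..1})"
        by (rule has_derivative_compose[of "\<lambda>s. x + s *\<^sub>R z" _ _ _ f, OF _ Cinf_has_derivative[OF f]])
          (auto intro!: derivative_eq_intros)
      moreover have "((\<lambda>s. f (x - s *\<^sub>R z)) has_derivative (\<lambda>t. frechet_derivative f (at (x - s *\<^sub>R z)) (- (t *\<^sub>R z)))) (at s within {0..1})"
        by (rule has_derivative_compose[of "\<lambda>s. x - s *\<^sub>R z" _ _ _ f, OF _ Cinf_has_derivative[OF f]])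
          (auto intro!: derivative_eq_intros)
      ultimately have "(g has_derivative (\<lambda>t. frechet_derivative f (at (x + s *\<^sub>R z)) (t *\<^sub>R z) + frechet_derivative f (at (x - s *\<^sub>R z)) (- (t *\<^sub>R z)))) (at s within {0..1})"
        unfolding g_def by (rule has_derivative_add)
      then show ?thesis unfolding g'_def
        by (simp add: linear_scale[OF lin] linear_neg[OF lin] scaleR_right_diff_distrib)
    qed
    have "norm (g 1 - g 0) \<le> 2 * L * (norm z)\<^sup>2 * norm (1 - 0 :: real)"
    proof (rule differentiable_bound[of "{0..1}" g g'])
      show "onorm (g' s) \<le> 2 * L * (norm z)\<^sup>2" if s: "s \<in> {0..1}" for s
      proof (rule onorm_le)
        fix t :: real
        have "norm (frechet_derivative f (at (x + s *\<^sub>R z)) z - frechet_derivative f (at (x - s *\<^sub>R z)) z)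
            \<le> L * norm ((x + s *\<^sub>R z) - (x - s *\<^sub>R z)) * norm z"
          using s seg[of s] seg[of "- s"] by (intro L) auto
        also have "(x + s *\<^sub>R z) - (x - s *\<^sub>R z) = (2 * s) *\<^sub>R z" by (simp add: algebra_simps scaleR_2 flip: scaleR_add_left mult_2)
        also have "L * norm ((2 * s) *\<^sub>R z) * norm z = 2 * L * (norm z)\<^sup>2 * s" using s by (simp add: power2_eq_square)
        also have "\<dots> \<le> 2 * L * (norm z)\<^sup>2" using s L0 by (intro mult_right_le_one_le) auto
        finally show "norm (g' s t) \<le> 2 * L * (norm z)\<^sup>2 * norm t"
          unfolding g'_def by (simp add: mult.commute mult_left_mono)
      qed
    qed (use gd in auto)
    then show "norm (f (x + z) + f (x - z) - 2 *\<^sub>R f x) \<le> 2 * L * (norm z)\<^sup>2"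
      by (simp add: g_def scaleR_2)
  qed
qed

lemma continuous_on_Sup_slice:
  fixes f :: "'a::metric_space \<Rightarrow> 'b::metric_space \<Rightarrow> real"
  assumes cont: "continuous_on (S \<times> K) (\<lambda>(t, x). f t x)" and "compact S" "compact K" "K \<noteq> {}"
  shows "continuous_on S (\<lambda>t. SUP x\<in>K. f t x)"
proof -
  have uc: "uniformly_continuous_on (S \<times> K) (\<lambda>(t, x). f t x)"
    using assms by (intro compact_uniformly_continuous compact_Times)
  have bdd: "bdd_above (f t ` K)" if "t \<in> S" for t
  proof -
    have "continuous_on K (\<lambda>x. (\<lambda>(t, x). f t x) (t, x))"
      using that by (intro continuous_on_compose2[OF cont]) (auto intro!: continuous_intros)
    then show ?thesis using \<open>compact K\<close>
      by (auto intro!: bounded_imp_bdd_above compact_imp_bounded compact_continuous_image)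
  qed
  show ?thesis
  proof (rule continuous_onI)
    fix t e assume t: "t \<in> S" and e: "(e::real) > 0"
    obtain d where d: "d > 0" "\<And>p q. p \<in> S \<times> K \<Longrightarrow> q \<in> S \<times> K \<Longrightarrow> dist q p < d \<Longrightarrow>
        dist ((\<lambda>(t, x). f t x) q) ((\<lambda>(t, x). f t x) p) < e"
      using uc e unfolding uniformly_continuous_on_def by metis
    have le: "(SUP x\<in>K. f t x) \<le> (SUP x\<in>K. f t' x) + e" if "t \<in> S" "t' \<in> S" "dist t' t < d" for t t'
    proof (rule cSUP_least[OF \<open>K \<noteq> {}\<close>])
      fix x assume x: "x \<in> K"
      have "dist (f t' x) (f t x) < e" using d(2)[of "(t, x)" "(t', x)"] that x by (simp add: dist_Pair_Pair)
      moreover have "f t' x \<le> (SUP x\<in>K. f t' x)" by (rule cSUP_upper[OF x bdd[OF that(2)]])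
      ultimately show "f t x \<le> (SUP x\<in>K. f t' x) + e" by (auto simp: dist_real_def)
    qed
    show "\<exists>d>0. \<forall>t'\<in>S. dist t' t < d \<longrightarrow> dist (SUP x\<in>K. f t' x) (SUP x\<in>K. f t x) \<le> e"
      using d(1) le t by (intro exI[of _ d]) (auto simp: dist_real_def abs_le_iff dist_commute algebra_simps)
  qed
qed


definition lattice_point :: "('n \<Rightarrow> int) \<Rightarrow> real^'n" where
  "lattice_point k = (\<chi> i. of_int (k i))"

definition half_open_cube :: "(real^'n) set" where
  "half_open_cube = {x. \<forall>i. 0 \<le> x $ i \<and> x $ i < 1}"

lemma half_open_cube_borel [measurable]: "half_open_cube \<in> sets borel"
proof -
  have "half_open_cube = (\<Inter>i. {x::real^'n. 0 \<le> x $ i} \<inter> {x. x $ i < 1})"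
    by (auto simp: half_open_cube_def)
  also have "\<dots> \<in> sets borel"
    by (intro sets.countable_INT' sets.Int borel_closed borel_open)
       (auto simp: closed_halfspace_component_ge_cart open_halfspace_component_lt_cart)
  finally show ?thesis .
qed

lemma half_open_cube_tiles:
  "(\<integral>\<^sup>+k. indicator half_open_cube (w + lattice_point k) \<partial>count_space UNIV) = (1::ennreal)"
proof -
  define k0 where "k0 = (\<lambda>i. - \<lfloor>w $ i\<rfloor>)"
  have "w + lattice_point k \<in> half_open_cube \<longleftrightarrow> k = k0" for k
  proof -
    have "0 \<le> w $ i + of_int (k i) \<and> w $ i + of_int (k i) < 1 \<longleftrightarrow> k i = k0 i" for i
      unfolding k0_def by linarith
    then show ?thesis by (auto simp: half_open_cube_def lattice_point_def fun_eq_iff)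
  qed
  then have "(indicator half_open_cube (w + lattice_point k) :: ennreal) = indicator {k0} k" for k
    by (auto split: split_indicator)
  then show ?thesis by (simp add: nn_integral_count_space_indicator one_ennreal_def)
qed

lemma periodic_lattice_point: "periodic f \<Longrightarrow> f (x + lattice_point k) = f x"
  by (auto simp: periodic_def lattice_point_def)

lemma lattice_translate_in_unit_cube: "x + lattice_point (\<lambda>i. - \<lfloor>x $ i\<rfloor>) \<in> unit_cube"
  by (auto simp: unit_cube_def mem_box_cart lattice_point_def) linarith+

lemma unit_cube_bounded: "\<exists>R. \<forall>x\<in>(unit_cube :: (real^'n) set). norm x \<le> R"
  using bounded_cbox[of 0 "1 :: real^'n"] by (simp add: unit_cube_def bounded_iff)

lemma nn_integral_translate:
  fixes f :: "'a::euclidean_space \<Rightarrow> ennreal"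
  assumes [measurable]: "f \<in> borel_measurable borel"
  shows "(\<integral>\<^sup>+x. f (x + b) \<partial>lborel) = (\<integral>\<^sup>+x. f x \<partial>lborel)"
proof -
  have "(\<integral>\<^sup>+x. f x \<partial>lborel) = (\<integral>\<^sup>+x. f x \<partial>distr lborel borel ((+) b))"
    using lborel_distr_plus[of b] by simp
  also have "\<dots> = (\<integral>\<^sup>+x. f (b + x) \<partial>lborel)" by (subst nn_integral_distr) auto
  finally show ?thesis by (simp add: add.commute)
qed

text \<open>Split the translated cube along the lattice and move each piece back into the cube.\<close>

lemma nn_integral_half_open_cube_shift:
  fixes f :: "real^'n \<Rightarrow> ennreal"
  assumes [measurable]: "f \<in> borel_measurable borel" and per: "periodic f"
  shows "(\<integral>\<^sup>+x. f (x + b) * indicator half_open_cube x \<partial>lborel)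
       = (\<integral>\<^sup>+x. f x * indicator half_open_cube x \<partial>lborel)"
proof -
  let ?C = "half_open_cube :: (real^'n) set" and ?z = "lattice_point :: ('n \<Rightarrow> int) \<Rightarrow> _"
  let ?N = "count_space (UNIV :: ('n \<Rightarrow> int) set)"
  have C [measurable]: "(\<lambda>x. indicator ?C (x + c) :: ennreal) \<in> borel_measurable borel" for c
    by measurable
  have C' [measurable]: "(\<lambda>x. indicator ?C (x - c) :: ennreal) \<in> borel_measurable borel" for c
    by measurable
  have "(\<integral>\<^sup>+x. f (x + b) * indicator ?C x \<partial>lborel) = (\<integral>\<^sup>+x. f x * indicator ?C (x - b) \<partial>lborel)"
    using nn_integral_translate[of "\<lambda>x. f x * indicator ?C (x - b)" b] by simp
  also have "\<dots> = (\<integral>\<^sup>+x. (\<integral>\<^sup>+k. f x * indicator ?C (x - b) * indicator ?C (x + ?z k) \<partial>?N) \<partial>lborel)"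
    by (simp add: nn_integral_cmult half_open_cube_tiles)
  also have "\<dots> = (\<integral>\<^sup>+k. (\<integral>\<^sup>+x. f x * indicator ?C (x - b) * indicator ?C (x + ?z k) \<partial>lborel) \<partial>?N)"
    by (rule nn_integral_count_space_nn_integral) auto
  also have "\<dots> = (\<integral>\<^sup>+k. (\<integral>\<^sup>+x. f x * indicator ?C (x - b - ?z k) * indicator ?C x \<partial>lborel) \<partial>?N)"
  proof (rule nn_integral_cong)
    fix k
    have "(\<integral>\<^sup>+x. f x * indicator ?C (x - b) * indicator ?C (x + ?z k) \<partial>lborel)
      = (\<integral>\<^sup>+x. f (x + ?z k) * indicator ?C (x + ?z k - b - ?z k) * indicator ?C (x + ?z k) \<partial>lborel)"
      by (simp add: periodic_lattice_point[OF per])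
    also have "\<dots> = (\<integral>\<^sup>+x. f x * indicator ?C (x - b - ?z k) * indicator ?C x \<partial>lborel)"
      by (rule nn_integral_translate[of "\<lambda>x. f x * indicator ?C (x - b - ?z k) * indicator ?C x" "?z k"])
         measurable
    finally show "(\<integral>\<^sup>+x. f x * indicator ?C (x - b) * indicator ?C (x + ?z k) \<partial>lborel) = \<dots>" .
  qed
  also have "\<dots> = (\<integral>\<^sup>+x. (\<integral>\<^sup>+k. f x * indicator ?C (x - b - ?z k) * indicator ?C x \<partial>?N) \<partial>lborel)"
    by (rule nn_integral_count_space_nn_integral[symmetric]) auto
  also have "\<dots> = (\<integral>\<^sup>+x. f x * indicator ?C x * (\<integral>\<^sup>+k. indicator ?C (x - b - ?z k) \<partial>?N) \<partial>lborel)"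
    by (subst nn_integral_cmult[symmetric]) (auto simp: mult_ac)
  also have "\<dots> = (\<integral>\<^sup>+x. f x * indicator ?C x \<partial>lborel)"
  proof -
    have "(\<integral>\<^sup>+k. indicator ?C (x - b - ?z k) \<partial>?N) = (1::ennreal)" for x
    proof -
      have "bij_betw (\<lambda>k::'n\<Rightarrow>int. - k) UNIV UNIV" by (rule involuntory_imp_bij) (simp add: fun_eq_iff)
      then have "(\<integral>\<^sup>+k. indicator ?C (x - b + ?z (- k)) \<partial>?N) = (\<integral>\<^sup>+k. indicator ?C (x - b + ?z k) \<partial>?N)"
        by (rule nn_integral_bij_count_space)
      moreover have "?z (- k) = - ?z k" for k by (simp add: lattice_point_def vec_eq_iff)
      ultimately show ?thesis by (simp add: half_open_cube_tiles)
    qed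
    then show ?thesis by simp
  qed
  finally show ?thesis .
qed

lemma unit_cube_borel [measurable]: "unit_cube \<in> sets borel"
  by (simp add: unit_cube_def)

lemma AE_unit_cube_half_open: "AE x in lborel. x \<in> unit_cube \<longleftrightarrow> (x::real^'n) \<in> half_open_cube"
proof -
  have "negligible (cbox 0 1 - box 0 (1::real^'n))" by (rule negligible_frontier_interval)
  then have "cbox 0 1 - box 0 (1::real^'n) \<in> null_sets lborel"
    by (auto simp: negligible_iff_null_sets null_sets_def)
  then have "AE x in lborel. x \<notin> cbox 0 1 - box 0 (1::real^'n)" by (rule AE_not_in)
  then show ?thesis
  proof eventually_elim
    fix x :: "real^'n" assume "x \<notin> cbox 0 1 - box 0 1"
    then have "x \<in> unit_cube \<Longrightarrow> x \<in> box 0 1" by (auto simp: unit_cube_def)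
    then show "x \<in> unit_cube \<longleftrightarrow> x \<in> half_open_cube"
      by (fastforce simp: unit_cube_def half_open_cube_def mem_box_cart less_imp_le)
  qed
qed

lemma nn_integral_unit_cube_shift:
  fixes f :: "real^'n \<Rightarrow> ennreal"
  assumes "f \<in> borel_measurable borel" "periodic f"
  shows "(\<integral>\<^sup>+x. f (x + b) * indicator unit_cube x \<partial>lborel) = (\<integral>\<^sup>+x. f x * indicator unit_cube x \<partial>lborel)"
proof -
  have "(\<integral>\<^sup>+x. g x * indicator unit_cube x \<partial>lborel) = (\<integral>\<^sup>+x. g x * indicator half_open_cube x \<partial>lborel)"
    for g :: "real^'n \<Rightarrow> ennreal"
    by (rule nn_integral_cong_AE) (use AE_unit_cube_half_open in \<open>eventually_elim; auto split: split_indicator\<close>)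
  then show ?thesis using nn_integral_half_open_cube_shift[OF assms] by simp
qed

lemma emeasure_unit_cube: "emeasure lborel (unit_cube :: (real^'n) set) < \<infinity>"
  by (simp add: unit_cube_def emeasure_lborel_cbox_eq)

lemma set_integrable_unit_cube_bounded:
  fixes f :: "real^'n \<Rightarrow> real"
  assumes "f \<in> borel_measurable borel" "\<And>x. x \<in> unit_cube \<Longrightarrow> \<bar>f x\<bar> \<le> B"
  shows "set_integrable lborel unit_cube f"
  unfolding set_integrable_def
  by (rule integrableI_bounded_set_indicator[where B = B])
     (use assms emeasure_unit_cube in auto)

lemma unit_cube_integral_shift:
  fixes f :: "real^'n \<Rightarrow> real"
  assumes [measurable]: "f \<in> borel_measurable borel" and per: "periodic f" and B: "\<And>x. \<bar>f x\<bar> \<le> B"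
  shows "(LINT x:unit_cube|lborel. f (x + b)) = (LINT x:unit_cube|lborel. f x)"
proof -
  have nn: "(LINT x:unit_cube|lborel. g (x + b)) = (LINT x:unit_cube|lborel. g x)"
    if [measurable]: "g \<in> borel_measurable borel" and "periodic g" "\<And>x. 0 \<le> g x" for g :: "real^'n \<Rightarrow> real"
  proof -
    have e: "(LINT x:unit_cube|lborel. g (x + c)) = enn2real (\<integral>\<^sup>+x. ennreal (g (x + c)) * indicator unit_cube x \<partial>lborel)" for c
      unfolding set_lebesgue_integral_def
      by (subst integral_eq_nn_integral)
         (auto intro!: arg_cong[where f = enn2real] nn_integral_cong simp: that split: split_indicator)
    have "(\<integral>\<^sup>+x. ennreal (g (x + b)) * indicator unit_cube x \<partial>lborel) = (\<integral>\<^sup>+x. ennreal (g x) * indicator unit_cube x \<partial>lborel)"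
      using that(2) by (intro nn_integral_unit_cube_shift[of "\<lambda>x. ennreal (g x)"]) (auto simp: periodic_def)
    with e[of b] e[of 0] show ?thesis by simp
  qed
  have "(LINT x:unit_cube|lborel. f (x + b) + B) = (LINT x:unit_cube|lborel. f x + B)"
  proof (rule nn[of "\<lambda>x. f x + B"])
    show "0 \<le> f x + B" for x using B[of x] by linarith
  qed (use per in \<open>auto simp: periodic_def\<close>)
  moreover have "(LINT x:unit_cube|lborel. g x + B) = (LINT x:unit_cube|lborel. g x) + (LINT x:(unit_cube::(real^'n) set)|lborel. B)"
    if "g \<in> borel_measurable borel" "\<And>x. \<bar>g x\<bar> \<le> B" for g :: "real^'n \<Rightarrow> real"
  proof (rule set_integral_add(2))
    show "set_integrable lborel unit_cube g" by (rule set_integrable_unit_cube_bounded[OF that])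
    show "set_integrable lborel unit_cube (\<lambda>_::real^'n. B)"
      by (rule set_integrable_unit_cube_bounded[where B = "\<bar>B\<bar>"]) auto
  qed
  ultimately show ?thesis using B by simp
qed

lemma continuous_periodic_bounded:
  fixes f :: "real^'n \<Rightarrow> 'b::real_normed_vector"
  assumes "continuous_on UNIV f" "periodic f"
  shows "\<exists>B. \<forall>x. norm (f x) \<le> B"
proof -
  have "compact (f ` unit_cube)"
    by (intro compact_continuous_image continuous_on_subset[OF assms(1)]) (auto simp: unit_cube_def)
  then have "bounded (f ` unit_cube)" by (rule compact_imp_bounded)
  then obtain B where B: "\<And>x. x \<in> unit_cube \<Longrightarrow> norm (f x) \<le> B"
    unfolding bounded_iff by auto
  have "norm (f x) \<le> B" for x
  proof -
    from B[OF lattice_translate_in_unit_cube] show ?thesis by (simp add: periodic_lattice_point[OF assms(2)])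
  qed
  then show ?thesis by blast
qed

lemma unit_cube_lebesgue_integral_eq:
  fixes f :: "real^'n \<Rightarrow> real"
  assumes "continuous_on UNIV f"
  shows "(LINT x:unit_cube|lborel. f x) = integral unit_cube f"
  unfolding unit_cube_def
  unfolding set_integrable_def[symmetric]
  by (intro set_borel_integral_eq_integral(2) borel_integrable_compact[folded set_integrable_def]
      continuous_on_subset[OF assms]) auto

lemma integral_partial_derivative_periodic:
  fixes f :: "real^'n \<Rightarrow> real"
  assumes der: "\<And>x. (f has_derivative f' x) (at x)" and per: "periodic f"
    and cont: "continuous_on UNIV (\<lambda>x. f' x v)"
  shows "integral unit_cube (\<lambda>x. f' x v) = 0"
proof -
  have fc: "continuous_on UNIV f"
    using der has_derivative_continuous continuous_at_imp_continuous_on by blast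
  obtain B where B: "\<And>x. \<bar>f x\<bar> \<le> B" using continuous_periodic_bounded[OF fc per] by auto
  have const: "integral unit_cube (\<lambda>x. f (x + s *\<^sub>R v)) = integral unit_cube f" for s
    using unit_cube_integral_shift[OF _ per B, of "s *\<^sub>R v"] fc
    by (auto simp: unit_cube_lebesgue_integral_eq continuous_on_compose2[OF fc] continuous_intros borel_measurable_continuous_onI)
  have lin: "linear (f' x)" for x using der has_derivative_linear by blast
  have "((\<lambda>s. integral (cbox 0 1) (\<lambda>x. f (x + s *\<^sub>R v))) has_vector_derivative
      integral (cbox 0 1) (\<lambda>x. f' (x + 0 *\<^sub>R v) v)) (at 0 within UNIV)"
  proof (rule leibniz_rule_vector_derivative)
    fix s :: real and x
    have "((\<lambda>s. f (x + s *\<^sub>R v)) has_derivative (\<lambda>t. f' (x + s *\<^sub>R v) (t *\<^sub>R v))) (at s)"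
      by (rule has_derivative_compose[of "\<lambda>s. x + s *\<^sub>R v" _ _ _ f, OF _ der]) (auto intro!: derivative_eq_intros)
    then show "((\<lambda>s. f (x + s *\<^sub>R v)) has_vector_derivative f' (x + s *\<^sub>R v) v) (at s)"
      by (simp add: has_vector_derivative_def linear_scale[OF lin])
  next
    show "(\<lambda>x. f (x + s *\<^sub>R v)) integrable_on cbox 0 1" for s
      by (intro integrable_continuous continuous_on_compose2[OF fc] continuous_intros) auto
    show "continuous_on (UNIV \<times> cbox 0 1) (\<lambda>(s, x). f' (x + s *\<^sub>R v) v)"
      unfolding split_def by (intro continuous_on_compose2[OF cont] continuous_intros) auto
  qed auto
  then have "((\<lambda>s::real. integral unit_cube f) has_vector_derivative integral unit_cube (\<lambda>x. f' x v)) (at 0)"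
    using const by (simp add: unit_cube_def)
  moreover have "((\<lambda>s::real. integral unit_cube f) has_vector_derivative 0) (at 0)" by simp
  ultimately show ?thesis by (metis vector_derivative_unique_at)
qed

lemma integrable_norm_powr_cball:
  fixes R \<beta> :: real
  assumes \<beta>: "\<beta> < real DIM('a)"
  shows "integrable lborel (\<lambda>z::'a::euclidean_space. indicator (cball 0 R) z * norm z powr (- \<beta>))"
proof (cases "R > 0")
  case False
  have "(\<lambda>z::'a. indicator (cball 0 R) z * norm z powr (- \<beta>)) = (\<lambda>_. 0)"
  proof
    show "indicator (cball 0 R) z * norm z powr (- \<beta>) = 0" for z :: 'a
      using False by (cases "z = 0") (auto split: split_indicator dest: less_le_trans[OF zero_less_norm_iff[THEN iffD2]])
  qed
  then show ?thesis by simp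
next
  case R: True
  let ?n = "real DIM('a)"
  let ?f = "\<lambda>z::'a. indicator (cball 0 R) z * norm z powr (- \<beta>)"
  define m where "m = max 1 (2 powr \<beta>)"
  define g where "g = (\<lambda>(k::nat) (z::'a). indicator (cball 0 (R / 2 ^ k)) z * (m * (R / 2 ^ k) powr (- \<beta>)))"
  define q where "q = 2 powr (\<beta> - ?n)"
  have q: "0 < q" "q < 1" using \<beta> by (auto simp: q_def powr_less_one)
  have m: "m \<ge> 1" by (simp add: m_def)
  have g0: "g k z \<ge> 0" for k z using m by (auto simp: g_def)
  have le: "ennreal (?f z) \<le> (\<Sum>k. ennreal (g k z))" for z
  proof (cases "z \<in> cball 0 R \<and> z \<noteq> 0")
    case True
    then have z: "0 < norm z" "norm z \<le> R" by auto
    have "\<exists>k. R / 2 ^ Suc k < norm z"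
    proof -
      obtain k where "(1/2::real) ^ k < norm z / R" using real_arch_pow_inv[of "norm z / R" "1/2"] z R by auto
      then have "R / 2 ^ k < norm z" using R by (simp add: field_simps power_one_over)
      moreover have "R / 2 ^ Suc k \<le> R / 2 ^ k" using R by (simp add: field_simps)
      ultimately show ?thesis by (intro exI[of _ k]) linarith
    qed
    define k where "k = (LEAST k. R / 2 ^ Suc k < norm z)"
    have k1: "R / 2 ^ Suc k < norm z" unfolding k_def using \<open>\<exists>k. R / 2 ^ Suc k < norm z\<close> by (rule LeastI_ex)
    have k2: "norm z \<le> R / 2 ^ k"
    proof (cases k)
      case 0 then show ?thesis using z by simp
    next
      case (Suc j)
      then have "\<not> R / 2 ^ Suc j < norm z" using not_less_Least[of j "\<lambda>k. R / 2 ^ Suc k < norm z"] by (simp add: k_def)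
      then show ?thesis using Suc by simp
    qed
    define w where "w = R / 2 ^ k"
    have w: "w > 0" "w / 2 < norm z" "norm z \<le> w" using R k1 k2 by (auto simp: w_def)
    have "norm z powr (- \<beta>) \<le> m * w powr (- \<beta>)"
    proof (cases "\<beta> \<le> 0")
      case True
      have "norm z powr (- \<beta>) \<le> w powr (- \<beta>)" using True w by (intro powr_mono2) auto
      also have "\<dots> \<le> m * w powr (- \<beta>)" using m by (simp add: mult_le_cancel_right1)
      finally show ?thesis .
    next
      case False
      have "norm z powr (- \<beta>) \<le> (w / 2) powr (- \<beta>)" using False w by (intro powr_mono2') auto
      also have "\<dots> = 2 powr \<beta> * w powr (- \<beta>)" using w by (simp add: powr_divide powr_minus field_simps)
      also have "\<dots> \<le> m * w powr (- \<beta>)" by (intro mult_right_mono) (auto simp: m_def)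
      finally show ?thesis .
    qed
    then have "?f z \<le> g k z" using True k2 by (simp add: g_def w_def)
    then have "ennreal (?f z) \<le> (\<Sum>i\<in>{k}. ennreal (g i z))" by (simp add: ennreal_leI)
    also have "\<dots> \<le> (\<Sum>k. ennreal (g k z))" by (rule sum_le_suminf) auto
    finally show ?thesis .
  qed (auto split: split_indicator)
  have "(\<integral>\<^sup>+z. ennreal (?f z) \<partial>lborel) \<le> (\<integral>\<^sup>+z. (\<Sum>k. ennreal (g k z)) \<partial>lborel)"
    by (intro nn_integral_mono le)
  also have "\<dots> = (\<Sum>k. \<integral>\<^sup>+z. ennreal (g k z) \<partial>lborel)"
  proof (rule nn_integral_suminf)
    have [measurable]: "cball (0::'a) r \<in> sets borel" for r by simp
    show "(\<lambda>z. ennreal (g k z)) \<in> borel_measurable lborel" for k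
      unfolding g_def by measurable
  qed
  also have "\<dots> = (\<Sum>k. ennreal (unit_ball_vol ?n * m * R powr (?n - \<beta>) * q ^ k))"
  proof (intro suminf_cong)
    fix k
    have "(\<integral>\<^sup>+z. ennreal (g k z) \<partial>lborel)
        = (\<integral>\<^sup>+z. ennreal (m * (R / 2 ^ k) powr (- \<beta>)) * indicator (cball (0::'a) (R / 2 ^ k)) z \<partial>lborel)"
      by (intro nn_integral_cong) (auto simp: g_def split: split_indicator)
    also have "\<dots> = ennreal (m * (R / 2 ^ k) powr (- \<beta>)) * ennreal (unit_ball_vol ?n * (R / 2 ^ k) ^ DIM('a))"
      using R by (subst nn_integral_cmult_indicator) (auto simp: emeasure_cball)
    also have "\<dots> = ennreal (m * (R / 2 ^ k) powr (- \<beta>) * (unit_ball_vol ?n * (R / 2 ^ k) ^ DIM('a)))"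
      using m R by (intro ennreal_mult[symmetric]) auto
    also have "m * (R / 2 ^ k) powr (- \<beta>) * (unit_ball_vol ?n * (R / 2 ^ k) ^ DIM('a))
       = unit_ball_vol ?n * m * ((R / 2 ^ k) powr (?n - \<beta>))"
      using R by (simp add: powr_diff powr_realpow powr_minus field_simps)
    also have "(R / 2 ^ k) powr (?n - \<beta>) = R powr (?n - \<beta>) * q ^ k"
    proof -
      have "(2 ^ k) powr (?n - \<beta>) = (2::real) powr (real k * (?n - \<beta>))" by (simp add: powr_powr flip: powr_realpow)
      moreover have "q ^ k = (2::real) powr (- (real k * (?n - \<beta>)))"
        by (simp add: q_def powr_powr algebra_simps flip: powr_realpow)
      ultimately show ?thesis using R by (simp add: powr_divide powr_minus divide_simps)
    qed
    finally show "(\<integral>\<^sup>+z. ennreal (g k z) \<partial>lborel) = ennreal (unit_ball_vol ?n * m * R powr (?n - \<beta>) * q ^ k)"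
      by (simp add: mult.assoc)
  qed
  also have "\<dots> < \<infinity>"
  proof -
    have "summable (\<lambda>k. unit_ball_vol ?n * m * R powr (?n - \<beta>) * q ^ k)"
      using q by (intro summable_mult summable_geometric) auto
    then have "(\<Sum>k. ennreal (unit_ball_vol ?n * m * R powr (?n - \<beta>) * q ^ k))
        = ennreal (\<Sum>k. unit_ball_vol ?n * m * R powr (?n - \<beta>) * q ^ k)"
      using m q by (intro suminf_ennreal2) auto
    then show ?thesis by simp
  qed
  finally have "(\<integral>\<^sup>+z. ennreal (?f z) \<partial>lborel) < \<infinity>" .
  moreover have "cball (0::'a) R \<in> sets borel" by simp
  then have "?f \<in> borel_measurable lborel" by measurable
  ultimately show ?thesis by (intro integrableI_nonneg) auto
qed

section \<open>Geometry of the communication region\<close>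

lemma comm_region_same [simp]: "comm_region x x = {x :: real^'n}"
proof -
  have "\<exists>s\<ge>-1. s \<le> 1 \<and> (\<exists>w::real^'n. norm w < 1 - s\<^sup>2)"
    by (intro exI[of _ "0::real"] conjI exI[of _ 0]) auto
  then show ?thesis by (auto simp: comm_region_def Let_def scaleR_2[symmetric])
qed

text \<open>The witnesses \<open>s\<close> and \<open>w\<close> in the definition are determined by the point.\<close>

lemma mem_comm_region:
  fixes x y z :: "real^'n"
  assumes "CARD('n) \<noteq> 1" "x \<noteq> y"
  defines "q \<equiv> z - (1/2) *\<^sub>R (x + y)"
  defines "s \<equiv> 2 * (q \<bullet> (y - x)) / (norm (y - x))\<^sup>2"
  shows "z \<in> comm_region x y \<longleftrightarrow>
    norm ((2 / norm (y - x)) *\<^sub>R q - (s / norm (y - x)) *\<^sub>R (y - x)) < 1 - s\<^sup>2"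
proof -
  define N where "N = norm (y - x)"
  have N: "N > 0" using assms by (simp add: N_def)
  have N': "norm (x - y) = N" by (simp add: N_def norm_minus_commute)
  define e where "e = (1 / N) *\<^sub>R (y - x)"
  have yx: "y - x = N *\<^sub>R e" using N by (simp add: e_def)
  have ee: "e \<bullet> e = 1" using N by (simp add: e_def N_def dot_square_norm power2_eq_square)
  have s: "s = 2 * (q \<bullet> e) / N"
  proof -
    have "(norm (y - x))\<^sup>2 = N * N" by (simp add: N_def power2_eq_square)
    then show ?thesis unfolding s_def using N by (simp add: e_def)
  qed
  let ?w = "(2 / N) *\<^sub>R q - s *\<^sub>R e"
  have eq: "(2 / norm (y - x)) *\<^sub>R q - (s / norm (y - x)) *\<^sub>R (y - x) = ?w"
    unfolding N_def[symmetric] using N by (simp add: e_def)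
  have "z \<in> comm_region x y \<longleftrightarrow> (\<exists>s w. q = (N / 2 * s) *\<^sub>R e + (N / 2) *\<^sub>R w \<and> -1 \<le> s \<and> s \<le> 1 \<and> w \<bullet> e = 0 \<and> norm w < 1 - s\<^sup>2)"
    unfolding comm_region_def Let_def N' N_def[symmetric] e_def[symmetric] q_def
    using assms(1) by (auto simp: algebra_simps)
  also have "\<dots> \<longleftrightarrow> norm ?w < 1 - s\<^sup>2"
  proof
    assume "\<exists>s w. q = (N / 2 * s) *\<^sub>R e + (N / 2) *\<^sub>R w \<and> -1 \<le> s \<and> s \<le> 1 \<and> w \<bullet> e = 0 \<and> norm w < 1 - s\<^sup>2"
    then obtain s' w where w: "q = (N / 2 * s') *\<^sub>R e + (N / 2) *\<^sub>R w" "w \<bullet> e = 0" "norm w < 1 - s'\<^sup>2" by blast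
    have "s' = s" unfolding s w(1) using N ee w(2) by (simp add: inner_add_left)
    moreover have "?w = w" unfolding w(1) \<open>s' = s\<close>[symmetric] using N by (simp add: scaleR_add_right)
    ultimately show "norm ?w < 1 - s\<^sup>2" using w(3) by simp
  next
    assume a: "norm ?w < 1 - s\<^sup>2"
    have "s\<^sup>2 \<le> 1" using a norm_ge_zero[of ?w] by linarith
    then have "-1 \<le> s" "s \<le> 1" by (auto simp: abs_square_le_1 abs_le_iff)
    moreover have "?w \<bullet> e = 0" using N by (simp add: inner_diff_left ee s)
    moreover have "q = (N / 2 * s) *\<^sub>R e + (N / 2) *\<^sub>R ?w"
      using N by (simp add: scaleR_diff_right)
    ultimately show "\<exists>s w. q = (N / 2 * s) *\<^sub>R e + (N / 2) *\<^sub>R w \<and> -1 \<le> s \<and> s \<le> 1 \<and> w \<bullet> e = 0 \<and> norm w < 1 - s\<^sup>2"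
      using a by blast
  qed
  finally show ?thesis unfolding eq .
qed

lemma comm_region_commute: "comm_region x y = comm_region y (x :: real^'n)"
proof (cases "x = y \<or> CARD('n) = 1")
  case True
  then show ?thesis by (auto simp: comm_region_def closed_segment_commute)
next
  case False
  have "z \<in> comm_region x y \<longleftrightarrow> z \<in> comm_region y x" for z
  proof -
    define q where "q = z - (1/2) *\<^sub>R (x + y)"
    have 1: "2 * (q \<bullet> (x - y)) / (norm (x - y))\<^sup>2 = - (2 * (q \<bullet> (y - x)) / (norm (y - x))\<^sup>2)"
      unfolding minus_divide_left by (simp add: inner_diff_right norm_minus_commute[of x y])
    have 2: "(- b / c) *\<^sub>R (x - y) = (b / c) *\<^sub>R (y - x)" for b c
      by (simp add: algebra_simps)
    show ?thesis
      using False mem_comm_region[of x y z] mem_comm_region[of y x z]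
      unfolding add.commute[of y x] q_def[symmetric] 1 2
      by (auto simp only: norm_minus_commute[of x y] power2_minus)
  qed
  then show ?thesis by blast
qed

lemma comm_region_translate:
  fixes x y z a :: "real^'n"
  shows "z + a \<in> comm_region (x + a) (y + a) \<longleftrightarrow> z \<in> comm_region x y"
proof (cases "x = y \<or> CARD('n) = 1")
  case True
  have "closed_segment (x + a) (y + a) = (+) a ` closed_segment x y"
    by (simp add: closed_segment_translation add.commute[of _ a])
  moreover have "z + a \<in> (+) a ` closed_segment x y \<longleftrightarrow> z \<in> closed_segment x y"
    by (auto simp: add.commute[of _ a])
  ultimately show ?thesis using True by (cases "x = y") (auto simp: comm_region_def[of "x + a" "y + a"] comm_region_def[of x y])
next
  case False
  have "z + a - (1/2) *\<^sub>R (x + a + (y + a)) = z - (1/2) *\<^sub>R (x + y)"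
    by (simp add: scaleR_add_right flip: scaleR_add_left)
  then show ?thesis
    using False mem_comm_region[of x y z] mem_comm_region[of "x + a" "y + a" "z + a"]
    by (simp only: add_diff_cancel_right add_right_cancel de_Morgan_disj simp_thms)
qed

lemma comm_region_uminus:
  fixes x y z :: "real^'n"
  shows "- z \<in> comm_region (- x) (- y) \<longleftrightarrow> z \<in> comm_region x y"
proof (cases "x = y \<or> CARD('n) = 1")
  case True
  have "closed_segment (- x) (- y) = uminus ` closed_segment x y"
    by (rule closed_segment_linear_image) (simp add: linear_uminus)
  then show ?thesis using True by (cases "x = y") (auto simp: comm_region_def[of "- x" "- y"] comm_region_def[of x y])
next
  case False
  have 1: "- z - (1/2) *\<^sub>R (- x + - y) = - (z - (1/2) *\<^sub>R (x + y))" by (simp add: algebra_simps)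
  have 2: "- y - - x = - (y - x)" by simp
  have 3: "norm (a *\<^sub>R (- q) - b *\<^sub>R (- d)) = norm (a *\<^sub>R q - b *\<^sub>R d)" for a b and q d :: "real^'n"
    by (metis (no_types) minus_diff_commute norm_minus_cancel scaleR_minus_right minus_diff_minus)
  show ?thesis using False
    by (subst (1 2) mem_comm_region) (auto simp only: 1 2 3 norm_minus_cancel inner_minus_left inner_minus_right minus_minus neg_equal_iff_equal)
qed

lemma comm_region_reflect:
  fixes x z w :: "real^'n"
  shows "2 *\<^sub>R x - w \<in> comm_region x (x - z) \<longleftrightarrow> w \<in> comm_region x (x + z)"
proof -
  have "w \<in> comm_region x (x + z) \<longleftrightarrow> - w \<in> comm_region (- x) (- x - z)"
    using comm_region_uminus[of w x "x + z"] by simp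
  also have "\<dots> \<longleftrightarrow> - w + 2 *\<^sub>R x \<in> comm_region (- x + 2 *\<^sub>R x) (- x - z + 2 *\<^sub>R x)"
    by (rule comm_region_translate[symmetric])
  finally show ?thesis by (simp add: scaleR_2)
qed

text \<open>The tips of the region are cones of half-angle less than a right angle; hence the ball
  swallows the whole region although \<open>y\<close> need not be its centre.\<close>

lemma comm_region_subset_cball:
  fixes x y p :: "real^'n"
  assumes x: "norm (x - p) \<le> a" and y: "norm (y - p) \<le> a / 5"
  shows "comm_region x y \<subseteq> cball p a"
proof (cases "CARD('n) = 1 \<or> x = y")
  case True
  have "a \<ge> 0" using x norm_ge_zero[of "x - p"] by linarith
  then have "x \<in> cball p a" "y \<in> cball p a" using x y by (auto simp: dist_norm norm_minus_commute)
  then show ?thesis using True closed_segment_subset[of x "cball p a" y]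
    by (auto simp: comm_region_def)
next
  case False
  show ?thesis
  proof
    fix z assume "z \<in> comm_region x y"
    then obtain s w where sw: "z = (1/2) *\<^sub>R (x + y) + (norm (x - y) / 2 * s) *\<^sub>R ((1 / norm (y - x)) *\<^sub>R (y - x)) + (norm (x - y) / 2) *\<^sub>R w"
      "-1 \<le> s" "s \<le> 1" "w \<bullet> ((1 / norm (y - x)) *\<^sub>R (y - x)) = 0" "norm w < 1 - s\<^sup>2"
      using False unfolding comm_region_def Let_def by auto
    define r where "r = norm (x - y) / 2"
    define t where "t = (1 + s) / 2"
    define X where "X = x - p"
    define Y where "Y = y - p"
    have t: "0 \<le> t" "t \<le> 1" using sw by (auto simp: t_def)
    have s: "s = 2 * t - 1" by (simp add: t_def field_simps)
    have r: "r > 0" using False by (simp add: r_def)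
    have a: "a \<ge> 0" using x norm_ge_zero[of "x - p"] by linarith
    have wXY: "w \<bullet> X = w \<bullet> Y" using sw(4) False by (auto simp: X_def Y_def inner_diff_right)
    have "(norm (x - y) / 2 * s) *\<^sub>R ((1 / norm (y - x)) *\<^sub>R (y - x)) = (s / 2) *\<^sub>R (y - x)"
      using False by (simp add: norm_minus_commute)
    then have z: "z - p = (1 - t) *\<^sub>R X + t *\<^sub>R Y + r *\<^sub>R w"
      unfolding sw(1) by (simp add: X_def Y_def s r_def vec_eq_iff field_simps)
    define k where "k = t * (1 - t)"
    have k0: "0 \<le> k" using t by (simp add: k_def)
    have k4: "4 * k \<le> 1"
    proof -
      have "0 \<le> (2 * t - 1)\<^sup>2" by simp
      then show ?thesis by (simp add: k_def power2_eq_square algebra_simps)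
    qed
    have w: "norm w \<le> 4 * k" using sw(5) by (simp add: s k_def power2_eq_square algebra_simps)
    have rr: "2 * r \<le> norm X + norm Y"
      using norm_triangle_ineq4[of X Y] by (simp add: r_def X_def Y_def)
    have rr2: "(X - Y) \<bullet> (X - Y) = 4 * r\<^sup>2"
      by (simp add: r_def X_def Y_def dot_square_norm power_divide)
    have "(norm (z - p))\<^sup>2 = (1 - t) * (X \<bullet> X) + t * (Y \<bullet> Y) - k * ((X - Y) \<bullet> (X - Y)) + 2 * r * (w \<bullet> Y) + r\<^sup>2 * (w \<bullet> w)"
      unfolding z power2_norm_eq_inner k_def
      using wXY by (simp add: inner_add_left inner_add_right inner_diff_left inner_diff_right inner_commute power2_eq_square algebra_simps)
    also have "w \<bullet> Y \<le> (4 * k) * (a / 5)"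
      by (rule order_trans[OF norm_cauchy_schwarz mult_mono]) (use w y k0 in \<open>auto simp: Y_def\<close>)
    also have "w \<bullet> w \<le> 4 * k"
    proof -
      have "w \<bullet> w = norm w * norm w" by (simp add: dot_square_norm power2_eq_square)
      also have "\<dots> \<le> (4 * k) * 1" using w k0 k4 by (intro mult_mono) auto
      finally show ?thesis by simp
    qed
    also have "X \<bullet> X \<le> a\<^sup>2" using x by (simp add: X_def dot_square_norm power_mono)
    also have "Y \<bullet> Y \<le> (a / 5)\<^sup>2" using y by (simp only: Y_def dot_square_norm) (intro power_mono; simp)
    finally have "(norm (z - p))\<^sup>2 \<le> (1 - t) * a\<^sup>2 + t * (a / 5)\<^sup>2 + 2 * r * (4 * k * (a / 5))"
      using t r rr2 by (simp add: mult_left_mono)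
    also have "2 * r * (4 * k * (a / 5)) \<le> (a + a / 5) * (4 * t * (a / 5))"
    proof -
      have "k \<le> t" using t by (simp add: k_def mult_left_le)
      moreover have "2 * r \<le> a + a / 5" using rr x y by (simp add: X_def Y_def)
      ultimately show ?thesis using r a k0 by (intro mult_mono) auto
    qed
    also have "(1 - t) * a\<^sup>2 + t * (a / 5)\<^sup>2 + (a + a / 5) * (4 * t * (a / 5)) = a\<^sup>2"
      by (simp add: power2_eq_square field_simps)
    finally have "norm (z - p) \<le> a" using a by (simp add: power2_le_iff_abs_le abs_le_square_iff[symmetric])
    then show "z \<in> cball p a" by (simp add: dist_norm norm_minus_commute)
  qed
qed

lemma comm_region_subset_cball_left: "comm_region x y \<subseteq> cball (x :: real^'n) (norm (x - y))"
  using comm_region_subset_cball[of y x "norm (x - y)" x]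
  by (simp add: norm_minus_commute comm_region_commute[of x y])

lemma ball_subset_comm_region:
  fixes x y :: "real^'n"
  assumes "x \<noteq> y"
  shows "ball ((1/2) *\<^sub>R (x + y)) (norm (x - y) / 4) \<subseteq> comm_region x y"
proof
  fix z assume "z \<in> ball ((1/2) *\<^sub>R (x + y)) (norm (x - y) / 4)"
  then have z: "norm (z - (1/2) *\<^sub>R (x + y)) < norm (x - y) / 4" by (simp add: dist_norm norm_minus_commute)
  define N where "N = norm (y - x)"
  have N: "N > 0" using assms by (simp add: N_def)
  have zN: "norm (z - (1/2) *\<^sub>R (x + y)) < N / 4" using z by (simp add: N_def norm_minus_commute)
  show "z \<in> comm_region x y"
  proof (cases "CARD('n) = 1")
    case True
    then obtain i where i: "(UNIV :: 'n set) = {i}" by (metis card_1_singletonE)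
    have nrm: "norm v = \<bar>v $ i\<bar>" for v :: "real^'n" by (simp add: norm_vec_def L2_set_def i)
    have ext: "v = w \<longleftrightarrow> v $ i = w $ i" for v w :: "real^'n"
      unfolding vec_eq_iff by (metis UNIV_I i singletonD)
    define t where "t = (z $ i - x $ i) / (y $ i - x $ i)"
    have d: "y $ i - x $ i \<noteq> 0" using assms ext by auto
    have zz: "z = (1 - t) *\<^sub>R x + t *\<^sub>R y"
    proof -
      have "t * (y $ i - x $ i) = z $ i - x $ i" using d by (simp add: t_def)
      then show ?thesis unfolding ext by (simp add: algebra_simps)
    qed
    have "\<bar>t - 1/2\<bar> * \<bar>y $ i - x $ i\<bar> = \<bar>(t - 1/2) * (y $ i - x $ i)\<bar>" by (simp add: abs_mult)
    also have "(t - 1/2) * (y $ i - x $ i) = (z - (1/2) *\<^sub>R (x + y)) $ i" using d by (simp add: t_def field_simps)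
    also have "\<bar>\<dots>\<bar> < \<bar>y $ i - x $ i\<bar> / 4" using zN by (simp add: nrm N_def)
    finally have "\<bar>t - 1/2\<bar> < 1/4" using d by (simp add: field_simps)
    then have "0 \<le> t" "t \<le> 1" by linarith+
    then show ?thesis using True zz by (auto simp: comm_region_def in_segment)
  next
    case False
    define q where "q = z - (1/2) *\<^sub>R (x + y)"
    define s where "s = 2 * (q \<bullet> (y - x)) / (norm (y - x))\<^sup>2"
    define e where "e = (1 / N) *\<^sub>R (y - x)"
    have ee: "e \<bullet> e = 1" using N by (simp add: e_def N_def dot_square_norm power2_eq_square)
    have s: "s = 2 * (q \<bullet> e) / N" unfolding s_def N_def[symmetric] e_def using N
      by (simp add: power2_eq_square)
    define w where "w = (2 / N) *\<^sub>R q - s *\<^sub>R e"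
    have nq: "norm ((2 / N) *\<^sub>R q) < 1/2" using zN N unfolding q_def[symmetric] by (simp add: field_simps)
    have orth: "w \<bullet> e = 0" using N by (simp add: w_def inner_diff_left ee s)
    have "(norm ((2 / N) *\<^sub>R q))\<^sup>2 = (norm (w + s *\<^sub>R e))\<^sup>2" by (simp add: w_def)
    also have "\<dots> = (norm w)\<^sup>2 + s\<^sup>2"
      unfolding power2_norm_eq_inner using orth ee
      by (simp add: inner_add_left inner_add_right inner_commute power2_eq_square)
    finally have *: "(norm w)\<^sup>2 + s\<^sup>2 < (1/2)\<^sup>2" using nq by (metis norm_ge_zero power_strict_mono pos2)
    then have "(norm w)\<^sup>2 < (1/2)\<^sup>2" using zero_le_power2[of s] by linarith
    then have "norm w < 1/2" by (rule power2_less_imp_less) simp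
    moreover have "s\<^sup>2 < 1/4"
    proof -
      have "(1/2::real)\<^sup>2 = 1/4" by (simp add: power2_eq_square)
      then show ?thesis using * zero_le_power2[of "norm w"] by linarith
    qed
    ultimately have "norm w < 1 - s\<^sup>2" by linarith
    moreover have "w = (2 / norm (y - x)) *\<^sub>R q - (s / norm (y - x)) *\<^sub>R (y - x)"
      using N by (simp add: w_def e_def N_def)
    ultimately show ?thesis using mem_comm_region[OF False assms, of z] by (simp add: q_def s_def)
  qed
qed

lemma comm_region_measurable:
  "Measurable.pred borel (\<lambda>(x, y, z::real^'n). z \<in> comm_region x y)"
proof (cases "CARD('n) = 1")
  case True
  have "(\<lambda>(x, y, z::real^'n). z \<in> comm_region x y) = (\<lambda>p. dist (fst p) (fst (snd p)) = dist (fst p) (snd (snd p)) + dist (snd (snd p)) (fst (snd p)))"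
    using True by (auto simp: comm_region_def fun_eq_iff between_mem_segment[symmetric] between)
  also have "Measurable.pred borel \<dots>"
    unfolding pred_def
    by (intro borel_measurable_eq borel_measurable_continuous_onI continuous_intros)
  finally show ?thesis .
next
  case False
  define q where "q = (\<lambda>(x, y, z::real^'n). z - (1/2) *\<^sub>R (x + y))"
  define s where "s = (\<lambda>p. 2 * (q p \<bullet> (fst (snd p) - fst p)) / (norm (fst (snd p) - fst p))\<^sup>2)"
  have [measurable]: "fst \<in> borel_measurable borel" "(\<lambda>p. fst (snd p)) \<in> borel_measurable borel"
    "(\<lambda>p. snd (snd p)) \<in> borel_measurable borel"
    for a :: "(real^'n) \<times> (real^'n) \<times> (real^'n)"
    by (auto intro!: borel_measurable_continuous_onI continuous_intros)
  have [measurable]: "q \<in> borel_measurable borel" unfolding q_def split_def by measurable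
  have [measurable]: "s \<in> borel_measurable borel" unfolding s_def by measurable
  have "(\<lambda>(x, y, z::real^'n). z \<in> comm_region x y) = (\<lambda>p. if fst p = fst (snd p) then snd (snd p) = fst p else
      norm ((2 / norm (fst (snd p) - fst p)) *\<^sub>R q p - (s p / norm (fst (snd p) - fst p)) *\<^sub>R (fst (snd p) - fst p)) < 1 - (s p)\<^sup>2)"
    using False by (auto simp: fun_eq_iff mem_comm_region s_def q_def)
  also have "Measurable.pred borel \<dots>" by measurable
  finally show ?thesis .
qed

lemma comm_region_borel [measurable]: "comm_region x y \<in> sets borel"
proof -
  have "Measurable.pred borel (\<lambda>z. (\<lambda>(x, y, z). z \<in> comm_region x y) (x, y, z))"
    by (rule measurable_compose[OF _ comm_region_measurable])
       (intro borel_measurable_continuous_onI continuous_intros)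
  then show ?thesis by (simp add: pred_def)
qed

section \<open>The communication kernel at a fixed time\<close>

lemma integrable_bounded_support:
  fixes f :: "'a::euclidean_space \<Rightarrow> real"
  assumes f: "f \<in> borel_measurable borel" and B: "\<And>x. \<bar>f x\<bar> \<le> B" and S: "\<And>x. x \<notin> cball c R \<Longrightarrow> f x = 0"
  shows "integrable lborel f"
proof -
  have "integrable lborel (\<lambda>x. indicator (cball c R) x *\<^sub>R f x)"
    by (rule integrableI_bounded_set_indicator[where B = B]) (use f B emeasure_bounded_finite[of "cball c R"] in auto)
  also have "(\<lambda>x. indicator (cball c R) x *\<^sub>R f x) = f"
    using S by (auto simp: fun_eq_iff split: split_indicator)
  finally show ?thesis .
qed

lemma set_integrable_continuous_cball:
  fixes f :: "'a::euclidean_space \<Rightarrow> real"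
  assumes "continuous_on UNIV f"
  shows "set_integrable lborel (cball p a) f"
  unfolding set_integrable_def
  by (rule borel_integrable_compact) (auto intro: continuous_on_subset[OF assms])

lemma lborel_integral_translate:
  fixes f :: "'a::euclidean_space \<Rightarrow> real"
  assumes [measurable]: "f \<in> borel_measurable borel"
  shows "(\<integral>x. f (t + x) \<partial>lborel) = (\<integral>x. f x \<partial>lborel)"
proof -
  have "(\<integral>x. f x \<partial>lborel) = (\<integral>x. f x \<partial>distr lborel borel ((+) t))" by (simp add: lborel_distr_plus)
  also have "\<dots> = (\<integral>x. f (t + x) \<partial>lborel)" by (subst integral_distr) auto
  finally show ?thesis by simp
qed

lemma lborel_integral_reflect:
  fixes f :: "'a::euclidean_space \<Rightarrow> real"
  assumes [measurable]: "f \<in> borel_measurable borel"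
  shows "(\<integral>x. f (t - x) \<partial>lborel) = (\<integral>x. f x \<partial>lborel)"
proof -
  have "(lborel :: 'a measure) = distr lborel borel (\<lambda>x. t - x)"
    using lborel_affine[of "-1" t] by (simp add: density_1)
  then have "(\<integral>x. f x \<partial>lborel) = (\<integral>x. f x \<partial>distr lborel borel (\<lambda>x. t - x))" by simp
  also have "\<dots> = (\<integral>x. f (t - x) \<partial>lborel)" by (subst integral_distr) auto
  finally show ?thesis by simp
qed

lemma sets_borel_lborel_pair:
  "sets (borel \<Otimes>\<^sub>M lborel) = sets (borel :: ('a::second_countable_topology \<times> 'b::euclidean_space) measure)"
  by (simp add: borel_prod[symmetric] cong: sets_pair_measure_cong)

locale topo_kernel =
  fixes h :: "real \<Rightarrow> real" and \<alpha> R\<^sub>0 c\<^sub>1 c\<^sub>2 :: real and r :: "real^'n \<Rightarrow> real" and rmin :: real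
  assumes alpha: "0 < \<alpha>" "\<alpha> < 2" and R0: "R\<^sub>0 > 0"
    and h_cont: "continuous_on UNIV h" and h_nonneg: "\<And>s. 0 \<le> h s"
    and h_le: "\<And>s. 0 \<le> s \<Longrightarrow> h s \<le> c\<^sub>2" and h_zero: "\<And>s. 2 * R\<^sub>0 \<le> s \<Longrightarrow> h s = 0"
    and c1: "c\<^sub>1 > 0" and h_ge: "\<And>s. 0 \<le> s \<Longrightarrow> s < R\<^sub>0 \<Longrightarrow> c\<^sub>1 \<le> h s"
    and r_cont: "continuous_on UNIV r" and r_per: "periodic r"
    and rmin: "rmin > 0" and r_ge: "\<And>x. rmin \<le> r x"
begin

definition region_mass :: "real^'n \<Rightarrow> real^'n \<Rightarrow> real" where
  "region_mass x y = (LINT z:comm_region x y|lborel. r z)"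

definition wt :: "real^'n \<Rightarrow> real^'n \<Rightarrow> real" where
  "wt x y = h (norm (x - y)) / norm (x - y) powr \<alpha> / region_mass x y"

lemma r_borel [measurable]: "r \<in> borel_measurable borel"
  by (rule borel_measurable_continuous_onI[OF r_cont])

lemma h_borel [measurable]: "h \<in> borel_measurable borel"
  by (rule borel_measurable_continuous_onI[OF h_cont])

lemma r_pos: "r x > 0" using r_ge[of x] rmin by linarith

lemma c2_nonneg: "c\<^sub>2 \<ge> 0" using h_le[of 0] h_nonneg[of 0] by linarith

lemma r_bounded: "\<exists>B. \<forall>x. r x \<le> B"
  using continuous_periodic_bounded[OF r_cont r_per] by (auto simp: abs_le_iff)

lemma region_integrable: "set_integrable lborel (comm_region x y) r"
  by (rule set_integrable_subset[OF set_integrable_continuous_cball[OF r_cont] _ comm_region_subset_cball_left])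
     simp

lemma region_emeasure_finite: "emeasure lborel (comm_region x (y::real^'n)) < \<infinity>"
proof -
  have "emeasure lborel (comm_region x y) \<le> emeasure lborel (cball x (norm (x - y)))"
    by (intro emeasure_mono comm_region_subset_cball_left) simp
  also have "\<dots> < \<infinity>" by (rule emeasure_bounded_finite) simp
  finally show ?thesis .
qed

lemma topo_dist_pow_eq: "\<rho> t = r \<Longrightarrow> topo_dist_pow \<rho> t x y = region_mass x y"
  unfolding topo_dist_pow_def region_mass_def
  using set_borel_integral_eq_integral(2)[OF region_integrable] by simp

lemma region_mass_nonneg: "region_mass x y \<ge> 0"
  unfolding region_mass_def set_lebesgue_integral_def
  by (rule integral_nonneg_AE) (auto simp: less_imp_le[OF r_pos])

lemma comm_weight_eq: "\<rho> t = r \<Longrightarrow> comm_weight h \<alpha> \<rho> t x y = wt x y"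
proof -
  assume a: "\<rho> t = r"
  have "(region_mass x y powr (1 / real CARD('n))) ^ CARD('n) = region_mass x y"
  proof (cases "region_mass x y = 0")
    case False
    then have "region_mass x y > 0" using region_mass_nonneg[of x y] by linarith
    then show ?thesis by (simp add: powr_realpow[symmetric] powr_powr)
  qed simp
  then show ?thesis unfolding comm_weight_def topo_dist_def wt_def topo_dist_pow_eq[of \<rho> t, OF a] by simp
qed

lemma region_mass_commute: "region_mass x y = region_mass y x"
  by (simp add: region_mass_def comm_region_commute[of x y])

lemma wt_commute: "wt x y = wt y x"
  by (simp add: wt_def region_mass_commute[of x y] norm_minus_commute[of x y])

lemma wt_nonneg: "wt x y \<ge> 0"
  by (simp add: wt_def h_nonneg region_mass_nonneg)

lemma region_mass_lattice:
  assumes "\<forall>i. z $ i \<in> \<int>"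
  shows "region_mass (x + z) (y + z) = region_mass x y"
proof -
  have "region_mass (x + z) (y + z) = (\<integral>w. indicator (comm_region (x + z) (y + z)) (z + w) *\<^sub>R r (z + w) \<partial>lborel)"
    unfolding region_mass_def set_lebesgue_integral_def
    by (rule lborel_integral_translate[symmetric]) measurable
  also have "\<dots> = region_mass x y" unfolding region_mass_def set_lebesgue_integral_def
    using r_per assms comm_region_translate[of _ z x y]
    by (intro Bochner_Integration.integral_cong) (auto simp: indicator_def periodic_def add.commute[of z])
  finally show ?thesis .
qed

lemma wt_lattice: "\<forall>i. z $ i \<in> \<int> \<Longrightarrow> wt (x + z) (y + z) = wt x y"
  by (simp add: wt_def region_mass_lattice)

lemma region_mass_ge:
  assumes "x \<noteq> y"
  shows "region_mass x y \<ge> rmin * measure lborel (comm_region x y)"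
    and "measure lborel (comm_region x y) \<ge> unit_ball_vol CARD('n) * (norm (x - y) / 4) ^ CARD('n)"
    and "measure lborel (comm_region x y) > 0"
proof -
  have "rmin * measure lborel (comm_region x y) = (LINT z:comm_region x y|lborel. rmin)"
    using region_emeasure_finite[of x y] by (simp add: set_lebesgue_integral_def)
  also have "\<dots> \<le> region_mass x y" unfolding region_mass_def
    using region_emeasure_finite[of x y]
    by (intro set_integral_mono region_integrable) (auto simp: r_ge set_integrable_def)
  finally show "region_mass x y \<ge> rmin * measure lborel (comm_region x y)" .
  have "unit_ball_vol CARD('n) * (norm (x - y) / 4) ^ CARD('n) = measure lborel (ball ((1/2) *\<^sub>R (x + y)) (norm (x - y) / 4))"
    by (simp add: content_ball)
  also have "\<dots> \<le> measure lborel (comm_region x y)"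
    using region_emeasure_finite[of x y]
    by (intro measure_mono_fmeasurable ball_subset_comm_region assms) (auto simp: fmeasurable_def)
  finally show *: "measure lborel (comm_region x y) \<ge> unit_ball_vol CARD('n) * (norm (x - y) / 4) ^ CARD('n)" .
  have "unit_ball_vol CARD('n) * (norm (x - y) / 4) ^ CARD('n) > 0" using assms by simp
  with * show "measure lborel (comm_region x y) > 0" by linarith
qed

lemma region_mass_pos: "x \<noteq> y \<Longrightarrow> region_mass x y > 0"
  using region_mass_ge(1,3)[of x y] rmin by (meson less_le_trans mult_pos_pos)

lemma region_mass_borel [measurable]: "(\<lambda>p. region_mass (fst p) (snd p)) \<in> borel_measurable borel"
proof -
  have "(\<lambda>q. (fst (fst q), snd (fst q), snd q)) \<in> measurable borel (borel :: ((real^'n) \<times> (real^'n) \<times> (real^'n)) measure)"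
    by (intro borel_measurable_continuous_onI continuous_intros)
  from measurable_compose[OF this comm_region_measurable]
  have P: "Measurable.pred borel (\<lambda>q. snd q \<in> comm_region (fst (fst q)) (snd (fst q) :: real^'n))" by simp
  have "(\<lambda>q. indicat_real {q. snd q \<in> comm_region (fst (fst q)) (snd (fst q))} q * r (snd q)) \<in> borel_measurable borel"
    using P by (intro borel_measurable_times borel_measurable_indicator measurable_compose[OF _ r_borel])
       (auto simp: pred_def intro!: borel_measurable_continuous_onI continuous_intros)
  then have M: "(\<lambda>(p, z). indicat_real (comm_region (fst p) (snd p)) z *\<^sub>R r z) \<in> borel_measurable (borel \<Otimes>\<^sub>M lborel)"
    by (subst measurable_cong_sets[OF sets_borel_lborel_pair refl]) (simp add: split_def indicator_def)
  show ?thesis unfolding region_mass_def set_lebesgue_integral_def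
    by (rule lborel.borel_measurable_lebesgue_integral) (use M in simp)
qed

lemma wt_borel [measurable]: "(\<lambda>p. wt (fst p) (snd p)) \<in> borel_measurable borel"
proof -
  have [measurable]: "(\<lambda>p::(real^'n)\<times>(real^'n). norm (fst p - snd p)) \<in> borel_measurable borel"
    by (intro borel_measurable_continuous_onI continuous_intros)
  show ?thesis unfolding wt_def by measurable
qed

lemma wt_le:
  "\<exists>C\<ge>0. \<forall>x y. x \<noteq> y \<longrightarrow> wt x y \<le> C * norm (x - y) powr (- \<alpha> - real CARD('n))"
proof -
  define \<omega> where "\<omega> = unit_ball_vol (real CARD('n))"
  have w: "\<omega> > 0" by (simp add: \<omega>_def)
  show ?thesis
  proof (intro exI[of _ "c\<^sub>2 * 4 ^ CARD('n) / (rmin * \<omega>)"] conjI allI impI)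
    show "0 \<le> c\<^sub>2 * 4 ^ CARD('n) / (rmin * \<omega>)" using w rmin c2_nonneg by simp
    fix x y :: "real^'n" assume xy: "x \<noteq> y"
    define N where "N = norm (x - y)"
    have N: "N > 0" using xy by (simp add: N_def)
    have "rmin * (\<omega> * (N / 4) ^ CARD('n)) \<le> region_mass x y"
      using region_mass_ge(1,2)[OF xy] rmin unfolding \<omega>_def N_def by (meson mult_left_mono less_imp_le order_trans)
    then have "wt x y \<le> (c\<^sub>2 / N powr \<alpha>) / (rmin * (\<omega> * (N / 4) ^ CARD('n)))"
      unfolding wt_def N_def[symmetric] using N w rmin c2_nonneg
      by (intro frac_le divide_right_mono h_le divide_nonneg_nonneg) auto
    also have "\<dots> = c\<^sub>2 * 4 ^ CARD('n) / (rmin * \<omega>) * N powr (- \<alpha> - real CARD('n))"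
      using N by (simp add: powr_diff powr_minus powr_realpow field_simps power_divide)
    finally show "wt x y \<le> c\<^sub>2 * 4 ^ CARD('n) / (rmin * \<omega>) * norm (x - y) powr (- \<alpha> - real CARD('n))"
      by (simp add: N_def)
  qed
qed

lemma wt_zero: "2 * R\<^sub>0 \<le> norm (x - y) \<Longrightarrow> wt x y = 0"
  by (simp add: wt_def h_zero)

definition tk :: "real \<Rightarrow> real^'n \<Rightarrow> real^'n \<Rightarrow> real" where
  "tk \<delta> x y = (if \<delta> < norm (y - x) then wt x y * r y else 0)"

lemma tk_nonneg: "tk \<delta> x y \<ge> 0"
  by (simp add: tk_def wt_nonneg less_imp_le[OF r_pos])

lemma tk_zero: "2 * R\<^sub>0 \<le> norm (y - x) \<Longrightarrow> tk \<delta> x y = 0"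
  by (simp add: tk_def wt_zero norm_minus_commute)

lemma tk_lattice: "\<forall>i. z $ i \<in> \<int> \<Longrightarrow> tk \<delta> (x + z) (y + z) = tk \<delta> x y"
  using r_per by (auto simp: tk_def wt_lattice periodic_def)

lemma tk_symmetric: "r x * tk \<delta> x y = r y * tk \<delta> y x"
  by (simp add: tk_def wt_commute[of x y] norm_minus_commute[of x y])

lemma tk_bounded:
  assumes "\<delta> > 0" shows "\<exists>B. \<forall>x y. tk \<delta> x y \<le> B"
proof -
  obtain C where C: "C \<ge> 0" "\<And>x y. x \<noteq> y \<Longrightarrow> wt x y \<le> C * norm (x - y) powr (- \<alpha> - real CARD('n))"
    using wt_le by blast
  obtain M where M: "\<And>x. r x \<le> M" using r_bounded by blast
  have M0: "M \<ge> 0" using M[of 0] r_pos[of 0] by linarith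
  have "tk \<delta> x y \<le> C * \<delta> powr (- \<alpha> - real CARD('n)) * M" for x y
  proof (cases "\<delta> < norm (y - x)")
    case True
    have "wt x y \<le> C * norm (x - y) powr (- \<alpha> - real CARD('n))" using True assms by (intro C) auto
    also have "\<dots> \<le> C * \<delta> powr (- \<alpha> - real CARD('n))"
      using True assms alpha C(1) by (intro mult_left_mono powr_mono2') (auto simp: norm_minus_commute)
    finally show ?thesis using True M M0 C(1) r_pos
      by (simp add: tk_def) (intro mult_mono; simp add: less_imp_le)
  qed (use C M0 in \<open>simp add: tk_def\<close>)
  then show ?thesis by blast
qed

lemma tk_borel [measurable]: "(\<lambda>p. tk \<delta> (fst p) (snd p)) \<in> borel_measurable borel"
proof -
  have [measurable]: "(\<lambda>p::(real^'n)\<times>(real^'n). norm (snd p - fst p)) \<in> borel_measurable borel"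
    "snd \<in> measurable borel (borel :: (real^'n) measure)"
    by (auto intro!: borel_measurable_continuous_onI continuous_intros)
  show ?thesis unfolding tk_def by measurable
qed

lemma tk_borel_snd [measurable]: "(\<lambda>y. tk \<delta> x y) \<in> borel_measurable borel"
proof -
  have "(\<lambda>y. (\<lambda>p. tk \<delta> (fst p) (snd p)) (x, y)) \<in> borel_measurable borel"
    by (rule measurable_compose[OF _ tk_borel]) (intro borel_measurable_continuous_onI continuous_intros)
  then show ?thesis by simp
qed

lemma tk_shift_borel [measurable]: "(\<lambda>p. tk \<delta> (fst p) (fst p + snd p)) \<in> borel_measurable borel"
proof -
  have "(\<lambda>q. (\<lambda>p. tk \<delta> (fst p) (snd p)) (fst q, fst q + snd q)) \<in> borel_measurable borel"
    by (rule measurable_compose[OF _ tk_borel]) (intro borel_measurable_continuous_onI continuous_intros)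
  then show ?thesis by simp
qed

lemma region_mass_reflect:
  assumes L: "\<And>\<zeta>. norm \<zeta> \<le> 2 * R\<^sub>0 \<Longrightarrow> \<bar>r (x + \<zeta>) - r (x - \<zeta>)\<bar> \<le> L * norm \<zeta>"
    and \<zeta>: "norm \<zeta> \<le> 2 * R\<^sub>0" and "L \<ge> 0"
  shows "\<bar>region_mass x (x + \<zeta>) - region_mass x (x - \<zeta>)\<bar> \<le> L * norm \<zeta> * measure lborel (comm_region x (x + \<zeta>))"
proof -
  let ?O = "comm_region x (x + \<zeta>)"
  have "region_mass x (x - \<zeta>) = (\<integral>w. indicator (comm_region x (x - \<zeta>)) (2 *\<^sub>R x - w) *\<^sub>R r (2 *\<^sub>R x - w) \<partial>lborel)"
    unfolding region_mass_def set_lebesgue_integral_def by (rule lborel_integral_reflect[symmetric]) measurable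
  also have "\<dots> = (LINT w:?O|lborel. r (2 *\<^sub>R x - w))"
    unfolding set_lebesgue_integral_def
    by (intro Bochner_Integration.integral_cong) (auto simp: indicator_def comm_region_reflect)
  finally have m: "region_mass x (x - \<zeta>) = (LINT w:?O|lborel. r (2 *\<^sub>R x - w))" .
  have int2: "set_integrable lborel ?O (\<lambda>w. r (2 *\<^sub>R x - w))"
    by (rule set_integrable_subset[OF set_integrable_continuous_cball _ comm_region_subset_cball_left])
       (auto intro!: continuous_on_compose2[OF r_cont] continuous_intros)
  have "\<bar>region_mass x (x + \<zeta>) - region_mass x (x - \<zeta>)\<bar> = \<bar>LINT w:?O|lborel. r w - r (2 *\<^sub>R x - w)\<bar>"
    unfolding m using region_integrable int2 by (simp add: region_mass_def)
  also have "\<dots> \<le> (LINT w:?O|lborel. \<bar>r w - r (2 *\<^sub>R x - w)\<bar>)"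
    using set_integral_diff(1)[OF region_integrable int2]
    unfolding set_integrable_def set_lebesgue_integral_def
    by (intro order_trans[OF integral_abs_bound]) (auto simp: abs_mult)
  also have "\<dots> \<le> (LINT w:?O|lborel. L * norm \<zeta>)"
  proof (rule set_integral_mono)
    show "set_integrable lborel ?O (\<lambda>w. \<bar>r w - r (2 *\<^sub>R x - w)\<bar>)"
      by (intro set_integrable_abs set_integral_diff(1) region_integrable int2)
    show "set_integrable lborel ?O (\<lambda>w. L * norm \<zeta>)"
      using region_emeasure_finite[of x "x + \<zeta>"] by (auto simp: set_integrable_def)
    fix w assume "w \<in> ?O"
    then have w: "norm (w - x) \<le> norm \<zeta>"
      using comm_region_subset_cball_left[of x "x + \<zeta>"] by (auto simp: dist_norm norm_minus_commute)
    have "\<bar>r (x + (w - x)) - r (x - (w - x))\<bar> \<le> L * norm (w - x)" using w \<zeta> by (intro L) simp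
    also have "x - (w - x) = 2 *\<^sub>R x - w" by (simp add: scaleR_2)
    finally show "\<bar>r w - r (2 *\<^sub>R x - w)\<bar> \<le> L * norm \<zeta>"
      using mult_left_mono[OF w \<open>L \<ge> 0\<close>] by simp
  qed
  also have "\<dots> = L * norm \<zeta> * measure lborel ?O"
    using region_emeasure_finite[of x "x + \<zeta>"] by (simp add: set_lebesgue_integral_def)
  finally show ?thesis .
qed

end

locale topo_alignment = topo_kernel h \<alpha> R\<^sub>0 c\<^sub>1 c\<^sub>2 r rmin
  for h \<alpha> R\<^sub>0 c\<^sub>1 c\<^sub>2 and r :: "real^'n \<Rightarrow> real" and rmin +
  fixes v :: "real^'n \<Rightarrow> real" and L :: real
  assumes v_cont: "continuous_on UNIV v" and v_per: "periodic v" and L_nonneg: "L \<ge> 0"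
    and r_lip: "\<And>x \<zeta>. norm \<zeta> \<le> 2 * R\<^sub>0 \<Longrightarrow> \<bar>r (x + \<zeta>) - r (x - \<zeta>)\<bar> \<le> L * norm \<zeta>"
    and v_lip: "\<And>x \<zeta>. norm \<zeta> \<le> 2 * R\<^sub>0 \<Longrightarrow> \<bar>v (x + \<zeta>) - v x\<bar> \<le> L * norm \<zeta>"
    and v_second: "\<And>x \<zeta>. norm \<zeta> \<le> 2 * R\<^sub>0 \<Longrightarrow> \<bar>v (x + \<zeta>) + v (x - \<zeta>) - 2 * v x\<bar> \<le> L * (norm \<zeta>)\<^sup>2"
begin

definition T :: "real \<Rightarrow> real^'n \<Rightarrow> real" where
  "T \<delta> x = (\<integral>y. tk \<delta> x y * (v y - v x) \<partial>lborel)"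

lemma v_borel [measurable]: "v \<in> borel_measurable borel"
  by (rule borel_measurable_continuous_onI[OF v_cont])

lemma v_bounded: "\<exists>B\<ge>0. \<forall>x. \<bar>v x\<bar> \<le> B"
proof -
  obtain B where "\<forall>x. \<bar>v x\<bar> \<le> B" using continuous_periodic_bounded[OF v_cont v_per] by auto
  moreover have "0 \<le> B" using calculation abs_ge_zero order_trans by blast
  ultimately show ?thesis by blast
qed

lemma T_shift: "T \<delta> x = (\<integral>\<zeta>. tk \<delta> x (x + \<zeta>) * (v (x + \<zeta>) - v x) \<partial>lborel)"
  unfolding T_def by (rule lborel_integral_translate[symmetric]) measurable

lemma T_integrable:
  assumes "\<delta> > 0"
  shows "integrable lborel (\<lambda>y. tk \<delta> x y * (v y - v x))"
proof -
  obtain B where B: "B \<ge> 0" "\<And>x. \<bar>v x\<bar> \<le> B" using v_bounded by blast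
  obtain M where M: "\<And>x y. tk \<delta> x y \<le> M" using tk_bounded[OF assms] by blast
  show ?thesis
  proof (rule integrable_bounded_support)
    show "\<bar>tk \<delta> x y * (v y - v x)\<bar> \<le> M * (2 * B)" for y
    proof -
      have "\<bar>v y - v x\<bar> \<le> 2 * B" using B(2)[of x] B(2)[of y] by linarith
      moreover have "\<bar>tk \<delta> x y\<bar> \<le> M" using M tk_nonneg by simp
      ultimately show ?thesis unfolding abs_mult by (intro mult_mono) auto
    qed
    show "tk \<delta> x y * (v y - v x) = 0" if "y \<notin> cball x (2 * R\<^sub>0)" for y
      using that by (simp add: tk_zero dist_norm norm_minus_commute)
  qed measurable
qed

lemma tk_reflect:
  "\<exists>C\<ge>0. \<forall>\<delta> x \<zeta>. \<zeta> \<noteq> 0 \<longrightarrow> norm \<zeta> \<le> 2 * R\<^sub>0 \<longrightarrow>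
     tk \<delta> x (x + \<zeta>) \<le> C * norm \<zeta> powr (- \<alpha> - real CARD('n)) \<and>
     \<bar>tk \<delta> x (x + \<zeta>) - tk \<delta> x (x - \<zeta>)\<bar> \<le> C * norm \<zeta> powr (1 - \<alpha> - real CARD('n))"
proof -
  obtain C where C: "C \<ge> 0" "\<And>x y. x \<noteq> y \<Longrightarrow> wt x y \<le> C * norm (x - y) powr (- \<alpha> - real CARD('n))"
    using wt_le by blast
  obtain M where M: "\<And>x. r x \<le> M" using r_bounded by blast
  have M0: "M \<ge> 0" using M[of 0] r_pos[of 0] by linarith
  define K where "K = C * M + (C * L + C * (L / rmin) * M)"
  have K: "K \<ge> 0" "C * M \<le> K" "C * L + C * (L / rmin) * M \<le> K"
    using C(1) M0 L_nonneg rmin by (auto simp: K_def)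
  show ?thesis
  proof (intro exI[of _ K] conjI allI impI K(1))
    fix \<delta> and x \<zeta> :: "real^'n" assume z: "\<zeta> \<noteq> 0" "norm \<zeta> \<le> 2 * R\<^sub>0"
    define P where "P = norm \<zeta> powr (- \<alpha> - real CARD('n))"
    have P: "P \<ge> 0" by (simp add: P_def)
    have P1: "norm \<zeta> powr (1 - \<alpha> - real CARD('n)) = P * norm \<zeta>"
    proof -
      have "1 - \<alpha> - real CARD('n) = (- \<alpha> - real CARD('n)) + 1" by simp
      then show ?thesis unfolding P_def by (simp only: powr_add) (use z(1) in simp)
    qed
    have w1: "wt x (x + \<zeta>) \<le> C * P" using C(2)[of x "x + \<zeta>"] z by (simp add: P_def)
    have w2: "wt x (x - \<zeta>) \<le> C * P" using C(2)[of x "x - \<zeta>"] z by (simp add: P_def)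
    have CP: "0 \<le> C * P" using C(1) P by simp
    have "tk \<delta> x (x + \<zeta>) \<le> wt x (x + \<zeta>) * r (x + \<zeta>)"
      by (simp add: tk_def wt_nonneg less_imp_le[OF r_pos])
    also have "\<dots> \<le> (C * P) * M" using w1 M CP by (intro mult_mono) (auto simp: less_imp_le[OF r_pos])
    also have "\<dots> \<le> K * P" using mult_right_mono[OF K(2) P] by (simp add: mult_ac)
    finally show "tk \<delta> x (x + \<zeta>) \<le> K * norm \<zeta> powr (- \<alpha> - real CARD('n))" by (simp add: P_def)
    show "\<bar>tk \<delta> x (x + \<zeta>) - tk \<delta> x (x - \<zeta>)\<bar> \<le> K * norm \<zeta> powr (1 - \<alpha> - real CARD('n))"
    proof (cases "\<delta> < norm \<zeta>")
      case False
      then show ?thesis using K(1) by (simp add: tk_def)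
    next
      case True
      let ?m1 = "region_mass x (x + \<zeta>)" and ?m2 = "region_mass x (x - \<zeta>)"
      let ?V = "measure lborel (comm_region x (x + \<zeta>))"
      have ne: "x \<noteq> x + \<zeta>" "x \<noteq> x - \<zeta>" using z by auto
      have m: "?m1 > 0" "?m2 > 0" using ne by (auto intro: region_mass_pos)
      have V: "?V > 0" "rmin * ?V \<le> ?m1" using region_mass_ge[OF ne(1)] by auto
      have d: "\<bar>?m2 - ?m1\<bar> \<le> L * norm \<zeta> * ?V"
        using region_mass_reflect[OF r_lip z(2) L_nonneg] by (simp add: abs_minus_commute)
      have "\<bar>wt x (x + \<zeta>) - wt x (x - \<zeta>)\<bar> = wt x (x - \<zeta>) * (\<bar>?m2 - ?m1\<bar> / ?m1)"
      proof -
        have "wt x (x + \<zeta>) - wt x (x - \<zeta>) = wt x (x - \<zeta>) * ((?m2 - ?m1) / ?m1)"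
        proof -
          have "A / m1 - A / m2 = A / m2 * ((m2 - m1) / m1)" if "m1 > 0" "m2 > 0" for A m1 m2 :: real
            using that by (simp add: field_simps)
          from this[OF m, of "h (norm \<zeta>) / norm \<zeta> powr \<alpha>"] show ?thesis by (simp add: wt_def)
        qed
        then show ?thesis using m wt_nonneg[of x "x - \<zeta>"] by (simp add: abs_mult)
      qed
      also have "\<dots> \<le> (C * P) * (L * norm \<zeta> / rmin)"
      proof (intro mult_mono w2 CP)
        have "\<bar>?m2 - ?m1\<bar> / ?m1 \<le> (L * norm \<zeta> * ?V) / (rmin * ?V)"
          using V rmin m d L_nonneg by (intro frac_le) auto
        then show "\<bar>?m2 - ?m1\<bar> / ?m1 \<le> L * norm \<zeta> / rmin" using V by simp
      qed (use m in auto)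
      finally have wd: "\<bar>wt x (x + \<zeta>) - wt x (x - \<zeta>)\<bar> \<le> (C * P) * (L * norm \<zeta> / rmin)" .
      have eq: "tk \<delta> x (x + \<zeta>) - tk \<delta> x (x - \<zeta>)
          = wt x (x + \<zeta>) * (r (x + \<zeta>) - r (x - \<zeta>)) + (wt x (x + \<zeta>) - wt x (x - \<zeta>)) * r (x - \<zeta>)"
        using True by (simp add: tk_def algebra_simps)
      have "\<bar>tk \<delta> x (x + \<zeta>) - tk \<delta> x (x - \<zeta>)\<bar> \<le> wt x (x + \<zeta>) * \<bar>r (x + \<zeta>) - r (x - \<zeta>)\<bar> + \<bar>wt x (x + \<zeta>) - wt x (x - \<zeta>)\<bar> * r (x - \<zeta>)"
        unfolding eq using wt_nonneg[of x "x + \<zeta>"] r_pos[of "x - \<zeta>"] by (intro order_trans[OF abs_triangle_ineq]) (simp add: abs_mult)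
      also have "\<dots> \<le> (C * P) * (L * norm \<zeta>) + (C * P) * (L * norm \<zeta> / rmin) * M"
        using w1 wd r_lip[OF z(2)] M CP L_nonneg rmin
        by (intro add_mono mult_mono) (auto simp: less_imp_le[OF r_pos])
      also have "\<dots> = (C * L + C * (L / rmin) * M) * (P * norm \<zeta>)" by (simp add: algebra_simps)
      also have "\<dots> \<le> K * (P * norm \<zeta>)" using K(3) P by (intro mult_right_mono) auto
      finally show ?thesis by (simp add: P1)
    qed
  qed
qed

lemma T_bounded: "\<exists>C. \<forall>\<delta>>0. \<forall>x. \<bar>T \<delta> x\<bar> \<le> C"
proof -
  obtain C where C: "C \<ge> 0"
    "\<And>\<delta> x \<zeta>. \<zeta> \<noteq> 0 \<Longrightarrow> norm \<zeta> \<le> 2 * R\<^sub>0 \<Longrightarrow> tk \<delta> x (x + \<zeta>) \<le> C * norm \<zeta> powr (- \<alpha> - real CARD('n))"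
    "\<And>\<delta> x \<zeta>. \<zeta> \<noteq> 0 \<Longrightarrow> norm \<zeta> \<le> 2 * R\<^sub>0 \<Longrightarrow>
      \<bar>tk \<delta> x (x + \<zeta>) - tk \<delta> x (x - \<zeta>)\<bar> \<le> C * norm \<zeta> powr (1 - \<alpha> - real CARD('n))"
    using tk_reflect by (elim exE conjE) (metis (no_types))
  define \<beta> where "\<beta> = \<alpha> + real CARD('n) - 2"
  define g where "g = (\<lambda>\<zeta>::real^'n. 2 * C * L * (indicator (cball 0 (2 * R\<^sub>0)) \<zeta> * norm \<zeta> powr (- \<beta>)))"
  have gi: "integrable lborel g" unfolding g_def
    using alpha by (intro integrable_mult_right integrable_norm_powr_cball) (simp add: \<beta>_def)
  have "\<bar>T \<delta> x\<bar> \<le> (\<integral>\<zeta>. g \<zeta> \<partial>lborel)" if \<delta>: "\<delta> > 0" for \<delta> x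
  proof -
    define A where "A = (\<lambda>\<zeta>. tk \<delta> x (x + \<zeta>) * (v (x + \<zeta>) - v x))"
    have A_meas [measurable]: "A \<in> borel_measurable borel"
      unfolding A_def by (intro borel_measurable_times borel_measurable_diff borel_measurable_const
        measurable_compose[OF _ tk_borel_snd] measurable_compose[OF _ v_borel]) simp_all
    have A_int: "integrable lborel A"
    proof -
      have "integrable (distr lborel borel ((+) x)) (\<lambda>y. tk \<delta> x y * (v y - v x))"
        using T_integrable[OF \<delta>] by (simp add: lborel_distr_plus)
      from integrable_distr[OF _ this] show ?thesis unfolding A_def by simp
    qed
    have A_int': "integrable lborel (\<lambda>\<zeta>. A (- \<zeta>))"
    proof -
      have "distr lborel borel uminus = (lborel :: (real^'n) measure)"
        using lborel_affine[of "-1" "0 :: real^'n", symmetric] by (simp add: density_1)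
      then have "integrable (distr lborel borel uminus) A" using A_int by simp
      from integrable_distr[OF _ this] show ?thesis by simp
    qed
    have "T \<delta> x = (\<integral>\<zeta>. A \<zeta> \<partial>lborel)" unfolding T_shift A_def ..
    moreover have "(\<integral>\<zeta>. A (- \<zeta>) \<partial>lborel) = (\<integral>\<zeta>. A \<zeta> \<partial>lborel)"
      using lborel_integral_reflect[OF A_meas, of 0] by (simp only: diff_0)
    ultimately have "2 * T \<delta> x = (\<integral>\<zeta>. A \<zeta> \<partial>lborel) + (\<integral>\<zeta>. A (- \<zeta>) \<partial>lborel)" by (simp only: mult_2)
    also have "\<dots> = (\<integral>\<zeta>. A \<zeta> + A (- \<zeta>) \<partial>lborel)"
      by (rule Bochner_Integration.integral_add[symmetric, OF A_int A_int'])
    finally have "\<bar>2 * T \<delta> x\<bar> = \<bar>\<integral>\<zeta>. A \<zeta> + A (- \<zeta>) \<partial>lborel\<bar>" by (simp only:)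
    also have "\<dots> \<le> (\<integral>\<zeta>. \<bar>A \<zeta> + A (- \<zeta>)\<bar> \<partial>lborel)" by (rule integral_abs_bound)
    also have "\<dots> \<le> (\<integral>\<zeta>. g \<zeta> \<partial>lborel)"
    proof (rule integral_mono)
      show "integrable lborel (\<lambda>\<zeta>. \<bar>A \<zeta> + A (- \<zeta>)\<bar>)" using A_int A_int' by auto
      show "\<bar>A \<zeta> + A (- \<zeta>)\<bar> \<le> g \<zeta>" for \<zeta>
      proof (cases "\<zeta> = 0 \<or> norm \<zeta> > 2 * R\<^sub>0")
        case True
        then have "A \<zeta> + A (- \<zeta>) = 0" by (auto simp: A_def tk_zero)
        then show ?thesis using C(1) L_nonneg by (simp add: g_def)
      next
        case False
        then have z: "\<zeta> \<noteq> 0" "norm \<zeta> \<le> 2 * R\<^sub>0" by auto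
        have eq: "A \<zeta> + A (- \<zeta>) = tk \<delta> x (x + \<zeta>) * (v (x + \<zeta>) + v (x - \<zeta>) - 2 * v x)
            + (tk \<delta> x (x - \<zeta>) - tk \<delta> x (x + \<zeta>)) * (v (x - \<zeta>) - v x)"
          by (simp add: A_def algebra_simps)
        have "\<bar>A \<zeta> + A (- \<zeta>)\<bar> \<le> tk \<delta> x (x + \<zeta>) * \<bar>v (x + \<zeta>) + v (x - \<zeta>) - 2 * v x\<bar>
            + \<bar>tk \<delta> x (x + \<zeta>) - tk \<delta> x (x - \<zeta>)\<bar> * \<bar>v (x + (- \<zeta>)) - v x\<bar>"
          unfolding eq using tk_nonneg[of \<delta> x "x + \<zeta>"]
          by (intro order_trans[OF abs_triangle_ineq]) (simp add: abs_mult abs_minus_commute)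
        also have "\<dots> \<le> (C * norm \<zeta> powr (- \<alpha> - real CARD('n))) * (L * (norm \<zeta>)\<^sup>2)
            + (C * norm \<zeta> powr (1 - \<alpha> - real CARD('n))) * (L * norm \<zeta>)"
        proof -
          have "norm (- \<zeta>) \<le> 2 * R\<^sub>0" unfolding norm_minus_cancel by (rule z(2))
          from v_lip[OF this, of x] have "\<bar>v (x + - \<zeta>) - v x\<bar> \<le> L * norm \<zeta>" unfolding norm_minus_cancel .
          then have 1: "\<bar>tk \<delta> x (x + \<zeta>) - tk \<delta> x (x - \<zeta>)\<bar> * \<bar>v (x + - \<zeta>) - v x\<bar>
              \<le> (C * norm \<zeta> powr (1 - \<alpha> - real CARD('n))) * (L * norm \<zeta>)"
            by (rule mult_mono[OF C(3)[OF z]]) (simp_all add: C(1))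
          have "tk \<delta> x (x + \<zeta>) * \<bar>v (x + \<zeta>) + v (x - \<zeta>) - 2 * v x\<bar>
              \<le> (C * norm \<zeta> powr (- \<alpha> - real CARD('n))) * (L * (norm \<zeta>)\<^sup>2)"
            by (rule mult_mono[OF C(2)[OF z] v_second[OF z(2)]]) (simp_all add: C(1))
          from add_mono[OF this 1] show ?thesis .
        qed
        also have "\<dots> = 2 * C * L * norm \<zeta> powr (- \<beta>)"
        proof -
          have b: "- \<alpha> - real CARD('n) + 2 = - \<beta>" "1 - \<alpha> - real CARD('n) + 1 = - \<beta>"
            by (simp_all add: \<beta>_def)
          have e1: "norm \<zeta> powr (- \<alpha> - real CARD('n)) * (norm \<zeta>)\<^sup>2 = norm \<zeta> powr (- \<beta>)"
            unfolding b(1)[symmetric] powr_add using z by simp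
          have e2: "norm \<zeta> powr (1 - \<alpha> - real CARD('n)) * norm \<zeta> = norm \<zeta> powr (- \<beta>)"
            unfolding b(2)[symmetric] powr_add using z by simp
          have "(C * X) * (L * N2) + (C * Y) * (L * N) = C * L * (X * N2) + C * L * (Y * N)" for X N2 Y N
            by (simp add: algebra_simps)
          from this[of "norm \<zeta> powr (- \<alpha> - real CARD('n))" "(norm \<zeta>)\<^sup>2"
              "norm \<zeta> powr (1 - \<alpha> - real CARD('n))" "norm \<zeta>"]
          show ?thesis unfolding e1 e2 by simp
        qed
        finally show ?thesis using z by (simp add: g_def)
      qed
    qed (rule gi)
    finally show ?thesis using abs_ge_zero[of "T \<delta> x"] by linarith
  qed
  then show ?thesis by blast
qed

definition tkr :: "real \<Rightarrow> real^'n \<Rightarrow> real^'n \<Rightarrow> real" where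
  "tkr \<delta> x \<zeta> = r x * tk \<delta> x (x + \<zeta>)"

lemma tkr_borel [measurable]: "(\<lambda>p. tkr \<delta> (fst p) (snd p)) \<in> borel_measurable borel"
proof -
  have [measurable]: "fst \<in> measurable borel (borel :: (real^'n) measure)"
    by (intro borel_measurable_continuous_onI continuous_intros)
  show ?thesis unfolding tkr_def by measurable
qed

lemma tkr_nonneg: "tkr \<delta> x \<zeta> \<ge> 0"
  by (simp add: tkr_def tk_nonneg less_imp_le[OF r_pos])

lemma tkr_bounded: "\<delta> > 0 \<Longrightarrow> \<exists>B. \<forall>x \<zeta>. tkr \<delta> x \<zeta> \<le> B"
proof -
  assume "\<delta> > 0"
  then obtain B where B: "\<And>x y. tk \<delta> x y \<le> B" using tk_bounded by blast
  obtain M where M: "\<And>x. r x \<le> M" using r_bounded by blast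
  have "tkr \<delta> x \<zeta> \<le> M * B" for x \<zeta>
    unfolding tkr_def using r_pos[of x] tk_nonneg[of \<delta> x "x + \<zeta>"] B[of x "x + \<zeta>"] M[of x]
    by (intro mult_mono) auto
  then show ?thesis by blast
qed

lemma tkr_swap: "tkr \<delta> (x + \<zeta>) (- \<zeta>) = tkr \<delta> x \<zeta>"
  using tk_symmetric[of x \<delta> "x + \<zeta>"] by (simp add: tkr_def)

lemma tkr_lattice: "\<forall>i. z $ i \<in> \<int> \<Longrightarrow> tkr \<delta> (x + z) \<zeta> = tkr \<delta> x \<zeta>"
  using r_per tk_lattice[of z \<delta> x "x + \<zeta>"] by (simp add: tkr_def periodic_def add_ac)

definition pair_form :: "real \<Rightarrow> (real^'n \<Rightarrow> real^'n \<Rightarrow> real) \<Rightarrow> real" where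
  "pair_form \<delta> g = (\<integral>p. indicator unit_cube (fst p) * (tkr \<delta> (fst p) (snd p) * g (fst p) (snd p)) \<partial>(lborel \<Otimes>\<^sub>M lborel))"

lemma pair_form_integrable:
  assumes "\<delta> > 0" and g [measurable]: "(\<lambda>p. g (fst p) (snd p)) \<in> borel_measurable borel"
    and B: "\<And>x \<zeta>. \<bar>g x \<zeta>\<bar> \<le> B"
  shows "integrable (lborel \<Otimes>\<^sub>M lborel) (\<lambda>p. indicator unit_cube (fst p) * (tkr \<delta> (fst p) (snd p) * g (fst p) (snd p)))"
proof -
  obtain M where M: "\<And>x \<zeta>. tkr \<delta> x \<zeta> \<le> M" using tkr_bounded[OF assms(1)] by blast
  obtain R where R: "\<And>x::real^'n. x \<in> unit_cube \<Longrightarrow> norm x \<le> R" using unit_cube_bounded by blast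
  have fm [measurable]: "fst \<in> measurable borel (borel :: (real^'n) measure)"
    by (intro borel_measurable_continuous_onI continuous_intros)
  show ?thesis unfolding lborel_prod
  proof (rule integrable_bounded_support[where B = "M * B"])
    show "(\<lambda>p. indicator unit_cube (fst p) * (tkr \<delta> (fst p) (snd p) * g (fst p) (snd p))) \<in> borel_measurable borel"
      by measurable
    fix p :: "(real^'n) \<times> (real^'n)"
    have "\<bar>tkr \<delta> (fst p) (snd p) * g (fst p) (snd p)\<bar> \<le> M * B"
      unfolding abs_mult using M[of "fst p" "snd p"] tkr_nonneg[of \<delta> "fst p" "snd p"] B[of "fst p" "snd p"]
      by (intro mult_mono) auto
    then show "\<bar>indicator unit_cube (fst p) * (tkr \<delta> (fst p) (snd p) * g (fst p) (snd p))\<bar> \<le> M * B"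
      using abs_ge_zero[of "tkr \<delta> (fst p) (snd p) * g (fst p) (snd p)"]
      by (auto split: split_indicator)
    show "indicator unit_cube (fst p) * (tkr \<delta> (fst p) (snd p) * g (fst p) (snd p)) = 0"
      if "p \<notin> cball 0 (R + 2 * R\<^sub>0)"
    proof (cases "fst p \<in> unit_cube")
      case True
      have "norm p \<le> norm (fst p) + norm (snd p)" by (metis norm_Pair_le prod.collapse)
      then have "norm (snd p) \<ge> 2 * R\<^sub>0" using R[OF True] that by simp
      then show ?thesis by (simp add: tkr_def tk_zero)
    qed simp
  qed
qed

lemma pair_form_iterated:
  assumes "\<delta> > 0" "(\<lambda>p. g (fst p) (snd p)) \<in> borel_measurable borel" "\<And>x \<zeta>. \<bar>g x \<zeta>\<bar> \<le> B"
  shows "pair_form \<delta> g = (LINT x:unit_cube|lborel. \<integral>\<zeta>. tkr \<delta> x \<zeta> * g x \<zeta> \<partial>lborel)"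
    and "pair_form \<delta> g = (\<integral>\<zeta>. (LINT x:unit_cube|lborel. tkr \<delta> x \<zeta> * g x \<zeta>) \<partial>lborel)"
proof -
  let ?f = "\<lambda>p. indicator unit_cube (fst p) * (tkr \<delta> (fst p) (snd p) * g (fst p) (snd p))"
  have i: "integrable (lborel \<Otimes>\<^sub>M lborel) ?f" by (rule pair_form_integrable[OF assms])
  have i': "integrable (lborel \<Otimes>\<^sub>M lborel) (\<lambda>(x, y). ?f (x, y))" using i by (simp add: split_def)
  show "pair_form \<delta> g = (LINT x:unit_cube|lborel. \<integral>\<zeta>. tkr \<delta> x \<zeta> * g x \<zeta> \<partial>lborel)"
    using lborel_pair.integral_fst[OF i'] by (simp add: pair_form_def set_lebesgue_integral_def split_def)
  show "pair_form \<delta> g = (\<integral>\<zeta>. (LINT x:unit_cube|lborel. tkr \<delta> x \<zeta> * g x \<zeta>) \<partial>lborel)"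
    using lborel_pair.integral_snd[OF i'] by (simp add: pair_form_def set_lebesgue_integral_def split_def)
qed

lemma pair_form_add:
  assumes "\<delta> > 0" "(\<lambda>p. g (fst p) (snd p)) \<in> borel_measurable borel" "\<And>x \<zeta>. \<bar>g x \<zeta>\<bar> \<le> B"
    "(\<lambda>p. g' (fst p) (snd p)) \<in> borel_measurable borel" "\<And>x \<zeta>. \<bar>g' x \<zeta>\<bar> \<le> B"
  shows "pair_form \<delta> (\<lambda>x \<zeta>. g x \<zeta> + g' x \<zeta>) = pair_form \<delta> g + pair_form \<delta> g'"
  unfolding pair_form_def
  using Bochner_Integration.integral_add[OF pair_form_integrable[OF assms(1-3)] pair_form_integrable[OF assms(1,4,5)]]
  by (simp add: algebra_simps)

lemma pair_form_swap:
  assumes \<delta>: "\<delta> > 0" and g [measurable]: "(\<lambda>p. g (fst p) (snd p)) \<in> borel_measurable borel"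
    and B: "\<And>x \<zeta>. \<bar>g x \<zeta>\<bar> \<le> B" and per: "\<And>\<zeta>. periodic (\<lambda>x. g x \<zeta>)"
  shows "pair_form \<delta> g = pair_form \<delta> (\<lambda>x \<zeta>. g (x + \<zeta>) (- \<zeta>))"
proof -
  obtain M where M: "\<And>x \<zeta>. tkr \<delta> x \<zeta> \<le> M" using tkr_bounded[OF \<delta>] by blast
  have g': "(\<lambda>p. g (fst p + snd p) (- snd p)) \<in> borel_measurable borel"
  proof -
    have "(\<lambda>q. (\<lambda>p. g (fst p) (snd p)) (fst q + snd q, - snd q)) \<in> borel_measurable borel"
      by (rule measurable_compose[OF _ g]) (intro borel_measurable_continuous_onI continuous_intros)
    then show ?thesis by simp
  qed
  define F where "F = (\<lambda>\<zeta> x. tkr \<delta> x \<zeta> * g x \<zeta>)"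
  have Fm: "(\<lambda>p. F (snd p) (fst p)) \<in> borel_measurable borel" unfolding F_def by measurable
  have Fz [measurable]: "F \<zeta> \<in> borel_measurable borel" for \<zeta>
  proof -
    have "(\<lambda>x. (\<lambda>p. F (snd p) (fst p)) (x, \<zeta>)) \<in> borel_measurable borel"
      by (rule measurable_compose[OF _ Fm]) (intro borel_measurable_continuous_onI continuous_intros)
    then show ?thesis by simp
  qed
  have Fb: "\<bar>F \<zeta> x\<bar> \<le> M * B" for \<zeta> x
    unfolding F_def abs_mult using M[of x \<zeta>] tkr_nonneg[of \<delta> x \<zeta>] B[of x \<zeta>] by (intro mult_mono) auto
  have Fp: "periodic (F \<zeta>)" for \<zeta> using per by (auto simp: F_def periodic_def tkr_lattice)
  have "pair_form \<delta> g = (\<integral>\<zeta>. (LINT x:unit_cube|lborel. F \<zeta> x) \<partial>lborel)"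
    using pair_form_iterated(2)[OF \<delta> g B] by (simp add: F_def)
  also have "\<dots> = (\<integral>\<zeta>. (LINT x:unit_cube|lborel. F (- \<zeta>) x) \<partial>lborel)"
  proof -
    have "(\<lambda>\<zeta>. LINT x:unit_cube|lborel. F \<zeta> x) \<in> borel_measurable borel"
      unfolding set_lebesgue_integral_def
    proof (rule lborel.borel_measurable_lebesgue_integral)
      have fm [measurable]: "snd \<in> measurable borel (borel :: (real^'n) measure)"
        by (intro borel_measurable_continuous_onI continuous_intros)
      have "(\<lambda>q. (\<lambda>p. F (snd p) (fst p)) (snd q, fst q)) \<in> borel_measurable borel"
        by (rule measurable_compose[OF _ Fm]) (intro borel_measurable_continuous_onI continuous_intros)
      then have [measurable]: "(\<lambda>q. F (fst q) (snd q)) \<in> borel_measurable borel" by simp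
      have "(\<lambda>q. indicat_real unit_cube (snd q) *\<^sub>R F (fst q) (snd q)) \<in> borel_measurable borel" by measurable
      then show "(\<lambda>(x, y). indicat_real unit_cube y *\<^sub>R F x y) \<in> borel_measurable (borel \<Otimes>\<^sub>M lborel)"
        by (simp add: split_def measurable_cong_sets[OF sets_borel_lborel_pair refl])
    qed
    from lborel_integral_reflect[OF this, of 0] show ?thesis by simp
  qed
  also have "\<dots> = (\<integral>\<zeta>. (LINT x:unit_cube|lborel. F (- \<zeta>) (x + \<zeta>)) \<partial>lborel)"
    using unit_cube_integral_shift[OF Fz Fp Fb] by simp
  also have "\<dots> = (\<integral>\<zeta>. (LINT x:unit_cube|lborel. tkr \<delta> x \<zeta> * g (x + \<zeta>) (- \<zeta>)) \<partial>lborel)"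
    by (simp add: F_def tkr_swap)
  also have "\<dots> = pair_form \<delta> (\<lambda>x \<zeta>. g (x + \<zeta>) (- \<zeta>))"
    using pair_form_iterated(2)[OF \<delta> g' B] by simp
  finally show ?thesis .
qed

lemma increments_bounded: "\<exists>B. \<forall>x y. \<bar>v y - v x\<bar> \<le> B \<and> \<bar>v x\<bar> \<le> B"
proof -
  obtain B where B: "B \<ge> 0" "\<And>x. \<bar>v x\<bar> \<le> B" using v_bounded by blast
  have "\<bar>v y - v x\<bar> \<le> 2 * B \<and> \<bar>v x\<bar> \<le> 2 * B" for x y using B(2)[of x] B(2)[of y] B(1) by linarith
  then show ?thesis by blast
qed

lemma v_shift_borel [measurable]: "(\<lambda>p. v (fst p + snd p)) \<in> borel_measurable borel"
  "(\<lambda>p. v (fst p)) \<in> borel_measurable (borel :: ((real^'n) \<times> (real^'n)) measure)"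
  by (rule measurable_compose[OF _ v_borel]; intro borel_measurable_continuous_onI continuous_intros)+

definition dissipation :: "real \<Rightarrow> real^'n \<Rightarrow> real" where
  "dissipation \<delta> x = (\<integral>\<zeta>. tkr \<delta> x \<zeta> * (v (x + \<zeta>) - v x)\<^sup>2 \<partial>lborel)"

lemma energy_identity:
  assumes \<delta>: "\<delta> > 0"
  shows "(LINT x:unit_cube|lborel. r x * v x * T \<delta> x) = - (1/2) * (LINT x:unit_cube|lborel. dissipation \<delta> x)"
proof -
  obtain B where B: "\<And>x y. \<bar>v y - v x\<bar> \<le> B" "\<And>x. \<bar>v x\<bar> \<le> B" using increments_bounded by blast
  define g1 where "g1 = (\<lambda>x \<zeta>. v x * (v (x + \<zeta>) - v x))"
  define g2 where "g2 = (\<lambda>x \<zeta>. v (x + \<zeta>) * (v x - v (x + \<zeta>)))"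
  define g3 where "g3 = (\<lambda>x \<zeta>. - ((v (x + \<zeta>) - v x)\<^sup>2))"
  have m: "(\<lambda>p. g1 (fst p) (snd p)) \<in> borel_measurable borel" "(\<lambda>p. g2 (fst p) (snd p)) \<in> borel_measurable borel"
    "(\<lambda>p. g3 (fst p) (snd p)) \<in> borel_measurable borel"
    unfolding g1_def g2_def g3_def by measurable
  have b1: "\<bar>g1 x \<zeta>\<bar> \<le> B * B" for x \<zeta>
    unfolding g1_def abs_mult by (intro mult_mono B) (use B(2)[of x] in auto)
  have b2: "\<bar>g2 x \<zeta>\<bar> \<le> B * B" for x \<zeta>
    unfolding g2_def abs_mult by (intro mult_mono B) (use B(2)[of x] in auto)
  have b3: "\<bar>g3 x \<zeta>\<bar> \<le> B * B" for x \<zeta>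
    unfolding g3_def abs_minus_cancel power2_eq_square abs_mult by (intro mult_mono B) (use B(2)[of x] in auto)
  have per: "periodic (\<lambda>x. g1 x \<zeta>)" for \<zeta>
    unfolding periodic_def
  proof (intro allI impI)
    fix x z :: "real^'n" assume z: "\<forall>i. z $ i \<in> \<int>"
    have "v (y + z) = v y" for y using v_per z by (auto simp: periodic_def)
    from this[of x] this[of "x + \<zeta>"] show "g1 (x + z) \<zeta> = g1 x \<zeta>" by (simp add: g1_def add_ac)
  qed
  have "pair_form \<delta> g1 = pair_form \<delta> g2"
    using pair_form_swap[OF \<delta> m(1) b1 per] by (simp add: g1_def g2_def)
  moreover have "pair_form \<delta> g1 + pair_form \<delta> g2 = pair_form \<delta> g3"
  proof -
    have "g3 = (\<lambda>x \<zeta>. g1 x \<zeta> + g2 x \<zeta>)"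
      by (simp add: g1_def g2_def g3_def fun_eq_iff power2_eq_square algebra_simps)
    then show ?thesis using pair_form_add[OF \<delta> m(1) b1 m(2) b2] by simp
  qed
  ultimately have "pair_form \<delta> g1 = (1/2) * pair_form \<delta> g3" by simp
  moreover have "pair_form \<delta> g1 = (LINT x:unit_cube|lborel. r x * v x * T \<delta> x)"
  proof -
    have "r x * v x * T \<delta> x = (\<integral>\<zeta>. tkr \<delta> x \<zeta> * g1 x \<zeta> \<partial>lborel)" for x
    proof -
      have "r x * v x * T \<delta> x = (\<integral>\<zeta>. r x * v x * (tk \<delta> x (x + \<zeta>) * (v (x + \<zeta>) - v x)) \<partial>lborel)"
        unfolding T_shift by (rule integral_mult_right_zero[symmetric])
      then show ?thesis by (simp only: tkr_def g1_def mult_ac)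
    qed
    then show ?thesis unfolding pair_form_iterated(1)[OF \<delta> m(1) b1] by (simp only:)
  qed
  moreover have "pair_form \<delta> g3 = - (LINT x:unit_cube|lborel. dissipation \<delta> x)"
    unfolding pair_form_iterated(1)[OF \<delta> m(3) b3]
    by (simp add: set_lebesgue_integral_def dissipation_def g3_def)
  ultimately show ?thesis by simp
qed

lemma dissipation_nonneg: "dissipation \<delta> x \<ge> 0"
  unfolding dissipation_def by (rule integral_nonneg_AE) (auto simp: tkr_nonneg)

lemma dissipation_periodic: "periodic (dissipation \<delta>)"
  unfolding periodic_def dissipation_def
proof (intro allI impI Bochner_Integration.integral_cong refl)
  fix x z \<zeta> :: "real^'n" assume z: "\<forall>i. z $ i \<in> \<int>"
  have "v (y + z) = v y" for y using v_per z by (auto simp: periodic_def)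
  from this[of x] this[of "x + \<zeta>"] show "tkr \<delta> (x + z) \<zeta> * (v (x + z + \<zeta>) - v (x + z))\<^sup>2 = tkr \<delta> x \<zeta> * (v (x + \<zeta>) - v x)\<^sup>2"
    by (simp add: tkr_lattice[OF z] add_ac)
qed

lemma dissipation_integrand_borel: "(\<lambda>p. tkr \<delta> (fst p) (snd p) * (v (fst p + snd p) - v (fst p))\<^sup>2) \<in> borel_measurable borel"
  by measurable

lemma dissipation_borel [measurable]: "dissipation \<delta> \<in> borel_measurable borel"
proof -
  have "(\<lambda>(x, \<zeta>). tkr \<delta> x \<zeta> * (v (x + \<zeta>) - v x)\<^sup>2) \<in> borel_measurable (borel \<Otimes>\<^sub>M lborel)"
    using dissipation_integrand_borel[of \<delta>] by (simp add: split_def measurable_cong_sets[OF sets_borel_lborel_pair refl])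
  then show ?thesis unfolding dissipation_def[abs_def]
    by (rule lborel.borel_measurable_lebesgue_integral)
qed

lemma T_borel: "T \<delta> \<in> borel_measurable borel"
proof -
  have "(\<lambda>p. tk \<delta> (fst p) (fst p + snd p) * (v (fst p + snd p) - v (fst p))) \<in> borel_measurable borel"
    by measurable
  then have "(\<lambda>(x, \<zeta>). tk \<delta> x (x + \<zeta>) * (v (x + \<zeta>) - v x)) \<in> borel_measurable (borel \<Otimes>\<^sub>M lborel)"
    by (simp add: split_def measurable_cong_sets[OF sets_borel_lborel_pair refl])
  then have "(\<lambda>x. \<integral>\<zeta>. tk \<delta> x (x + \<zeta>) * (v (x + \<zeta>) - v x) \<partial>lborel) \<in> borel_measurable borel"
    by (rule lborel.borel_measurable_lebesgue_integral)
  then show ?thesis by (simp add: T_shift[abs_def])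
qed

lemma dissipation_integrand_integrable:
  assumes "\<delta> > 0"
  shows "integrable lborel (\<lambda>y. r x * tk \<delta> x y * (v y - v x)\<^sup>2)"
proof -
  from increments_bounded obtain B where B': "\<forall>x y. \<bar>v y - v x\<bar> \<le> B \<and> \<bar>v x\<bar> \<le> B" ..
  have B: "\<bar>v y - v x\<bar> \<le> B" for x y using B'[rule_format, of y x] by (rule conjunct1)
  obtain M where M: "\<And>x y. tk \<delta> x y \<le> M" using tk_bounded[OF assms] by blast
  show ?thesis
  proof (rule integrable_bounded_support)
    show "(\<lambda>y. r x * tk \<delta> x y * (v y - v x)\<^sup>2) \<in> borel_measurable borel"
      by (intro borel_measurable_times borel_measurable_power borel_measurable_diff borel_measurable_const
        tk_borel_snd v_borel)
    show "\<bar>r x * tk \<delta> x y * (v y - v x)\<^sup>2\<bar> \<le> r x * M * (B * B)" for y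
    proof -
      have "\<bar>v y - v x\<bar> * \<bar>v y - v x\<bar> \<le> B * B"
        by (rule mult_mono'[OF B B abs_ge_zero abs_ge_zero])
      moreover have "\<bar>r x * tk \<delta> x y\<bar> \<le> r x * M"
        using M[of x y] tk_nonneg[of \<delta> x y] r_pos[of x] by (simp add: abs_mult)
      ultimately show ?thesis unfolding abs_mult[of "r x * tk \<delta> x y"] power2_eq_square abs_mult[of "v y - v x"]
        by (metis mult_mono' abs_ge_zero mult_nonneg_nonneg)
    qed
    show "r x * tk \<delta> x y * (v y - v x)\<^sup>2 = 0" if "y \<notin> cball x (2 * R\<^sub>0)" for y
      using that by (simp add: tk_zero dist_norm norm_minus_commute)
  qed
qed

lemma dissipation_eq: "dissipation \<delta> x = (\<integral>y. r x * tk \<delta> x y * (v y - v x)\<^sup>2 \<partial>lborel)"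
  unfolding dissipation_def tkr_def
  by (rule lborel_integral_translate[where f = "\<lambda>y. r x * tk \<delta> x y * (v y - v x)\<^sup>2"]) measurable

lemma dissipation_bounded:
  assumes "\<delta> > 0" shows "\<exists>B. \<forall>x. \<bar>dissipation \<delta> x\<bar> \<le> B"
proof -
  from increments_bounded obtain B where B': "\<forall>x y. \<bar>v y - v x\<bar> \<le> B \<and> \<bar>v x\<bar> \<le> B" ..
  have B: "\<bar>v y - v x\<bar> \<le> B" for x y using B'[rule_format, of y x] by (rule conjunct1)
  obtain M where M: "\<And>x \<zeta>. tkr \<delta> x \<zeta> \<le> M" using tkr_bounded[OF assms] by blast
  let ?g = "\<lambda>\<zeta>::real^'n. (M * B\<^sup>2) * indicat_real (cball 0 (2 * R\<^sub>0)) \<zeta>"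
  have fin: "emeasure lborel (cball (0::real^'n) (2 * R\<^sub>0)) < \<infinity>" by (rule emeasure_bounded_finite) simp
  have "\<bar>dissipation \<delta> x\<bar> \<le> (\<integral>\<zeta>. ?g \<zeta> \<partial>lborel)" for x
  proof -
    have "\<bar>dissipation \<delta> x\<bar> = dissipation \<delta> x" using dissipation_nonneg by simp
    also have "\<dots> \<le> (\<integral>\<zeta>. ?g \<zeta> \<partial>lborel)" unfolding dissipation_def
    proof (rule integral_mono')
      show "integrable lborel ?g" using fin by (intro integrable_mult_right integrable_real_indicator) auto
      have M0: "M \<ge> 0" using M[of 0 0] tkr_nonneg[of \<delta> 0 0] by linarith
      then show "0 \<le> ?g \<zeta>" for \<zeta> by simp
      show "tkr \<delta> x \<zeta> * (v (x + \<zeta>) - v x)\<^sup>2 \<le> ?g \<zeta>" for \<zeta>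
      proof (cases "\<zeta> \<in> cball 0 (2 * R\<^sub>0)")
        case True
        have "(v (x + \<zeta>) - v x)\<^sup>2 \<le> B\<^sup>2"
          by (rule abs_le_square_iff[THEN iffD1]) (rule order_trans[OF B abs_ge_self])
        then show ?thesis using True M[of x \<zeta>] M0 by (simp add: mult_mono)
      next
        case False
        then show ?thesis by (simp add: tkr_def tk_zero)
      qed
    qed
    finally show ?thesis .
  qed
  then show ?thesis by blast
qed

definition ball_mass :: "real \<Rightarrow> real^'n \<Rightarrow> real" where
  "ball_mass a p = (LINT y:cball p a|lborel. r y)"

definition ball_avg :: "real \<Rightarrow> real^'n \<Rightarrow> real" where
  "ball_avg a p = (LINT y:cball p a|lborel. r y * v y) / ball_mass a p"

definition lam :: real where "lam = c\<^sub>1 / R\<^sub>0 powr \<alpha>"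

lemma lam_pos: "lam > 0" using c1 R0 by (simp add: lam_def)

lemma ball_mass_pos: "a > 0 \<Longrightarrow> ball_mass a p > 0"
proof -
  assume a: "a > 0"
  have fin: "emeasure lborel (cball p a) < \<infinity>" by (rule emeasure_bounded_finite) simp
  have "0 < rmin * measure lborel (cball p a)" using rmin a by (simp add: content_cball)
  also have "\<dots> = (LINT z:cball p a|lborel. rmin)"
    using fin by (simp add: set_lebesgue_integral_def)
  also have "\<dots> \<le> ball_mass a p" unfolding ball_mass_def
    using fin by (intro set_integral_mono set_integrable_continuous_cball r_cont) (auto simp: r_ge set_integrable_def)
  finally show ?thesis .
qed

lemma wt_ge:
  assumes a: "a > 0" "2 * a \<le> R\<^sub>0" and x: "norm (x - p) \<le> a" and y: "norm (y - p) \<le> a / 5" and "x \<noteq> y"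
  shows "wt x y \<ge> lam / ball_mass a p"
proof -
  have "norm (x - y) \<le> norm (x - p) + norm (y - p)"
    using norm_triangle_ineq4[of "x - p" "y - p"] by simp
  then have N: "norm (x - y) < R\<^sub>0" using x y a by linarith
  have sub: "comm_region x y \<subseteq> cball p a" using x y by (rule comm_region_subset_cball)
  have "region_mass x y \<le> ball_mass a p"
    unfolding region_mass_def ball_mass_def set_lebesgue_integral_def
    using region_integrable[of x y] set_integrable_continuous_cball[OF r_cont, of p a] sub
    by (intro integral_mono) (auto simp: set_integrable_def less_imp_le[OF r_pos] split: split_indicator)
  moreover have "lam \<le> h (norm (x - y)) / norm (x - y) powr \<alpha>"
    unfolding lam_def using N c1 \<open>x \<noteq> y\<close> alpha by (intro frac_le h_ge powr_mono2) (auto simp: h_nonneg)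
  ultimately show ?thesis unfolding wt_def
    using region_mass_pos[OF \<open>x \<noteq> y\<close>] lam_pos by (intro frac_le) auto
qed

lemma ball_avg_affine:
  assumes "a > 0"
  shows "(LINT y:cball p a|lborel. r y * (k + m * v y)) = ball_mass a p * (k + m * ball_avg a p)"
proof -
  have i: "set_integrable lborel (cball p a) (\<lambda>y. r y * v y)"
    by (intro set_integrable_continuous_cball continuous_intros r_cont v_cont)
  have "(LINT y:cball p a|lborel. r y * (k + m * v y)) = (LINT y:cball p a|lborel. k * r y + m * (r y * v y))"
    by (intro arg_cong[where f = "set_lebesgue_integral lborel (cball p a)"] ext) (simp add: algebra_simps)
  also have "\<dots> = k * ball_mass a p + m * (LINT y:cball p a|lborel. r y * v y)"
    using set_integrable_continuous_cball[OF r_cont, of p a] i by (simp add: ball_mass_def)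
  also have "\<dots> = ball_mass a p * (k + m * ball_avg a p)"
    using ball_mass_pos[OF assms, of p] by (simp add: ball_avg_def field_simps)
  finally show ?thesis .
qed

lemma dissipation_ge:
  assumes a: "a > 0" "2 * a \<le> R\<^sub>0" and x: "norm (x - p) \<le> a / 5" and \<delta>: "0 < \<delta>" "\<delta> \<le> 2 * R\<^sub>0"
  shows "dissipation \<delta> x \<ge> rmin * lam * ((v x - ball_avg a p)\<^sup>2 - (L * \<delta>)\<^sup>2)"
proof -
  define m where "m = ball_mass a p"
  define c where "c = ball_avg a p"
  have m: "m > 0" using ball_mass_pos[OF a(1)] by (simp add: m_def)
  define k where "k = (c - v x)\<^sup>2 - (L * \<delta>)\<^sup>2 - 2 * (c - v x) * c"
  have "rmin * lam * ((v x - c)\<^sup>2 - (L * \<delta>)\<^sup>2) = (rmin * lam / m) * (m * (k + (2 * (c - v x)) * c))"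
    using m by (simp add: k_def power2_eq_square algebra_simps)
  also have "\<dots> = (rmin * lam / m) * (LINT y:cball p a|lborel. r y * (k + (2 * (c - v x)) * v y))"
    unfolding ball_avg_affine[OF a(1)] m_def c_def ..
  also have "\<dots> = (\<integral>y. (rmin * lam / m) * (indicator (cball p a) y *\<^sub>R (r y * (k + (2 * (c - v x)) * v y))) \<partial>lborel)"
    by (simp add: set_lebesgue_integral_def)
  also have "\<dots> \<le> (\<integral>y. r x * tk \<delta> x y * (v y - v x)\<^sup>2 \<partial>lborel)"
  proof (rule integral_mono)
    have "set_integrable lborel (cball p a) (\<lambda>y. r y * (k + (2 * (c - v x)) * v y))"
      by (intro set_integrable_continuous_cball continuous_intros r_cont v_cont)
    then show "integrable lborel (\<lambda>y. (rmin * lam / m) * (indicator (cball p a) y *\<^sub>R (r y * (k + (2 * (c - v x)) * v y))))"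
      unfolding set_integrable_def by (rule integrable_mult_right)
    show "integrable lborel (\<lambda>y. r x * tk \<delta> x y * (v y - v x)\<^sup>2)" by (rule dissipation_integrand_integrable[OF \<delta>(1)])
    fix y
    have lhs0: "0 \<le> r x * tk \<delta> x y * (v y - v x)\<^sup>2" by (simp add: tk_nonneg less_imp_le[OF r_pos])
    have "k + 2 * (c - v x) * v y = (v y - v x)\<^sup>2 - (v y - c)\<^sup>2 - (L * \<delta>)\<^sup>2"
      by (simp add: k_def power2_eq_square algebra_simps)
    then have kle: "k + 2 * (c - v x) * v y \<le> (v y - v x)\<^sup>2 - (L * \<delta>)\<^sup>2" by simp
    show "(rmin * lam / m) * (indicator (cball p a) y *\<^sub>R (r y * (k + (2 * (c - v x)) * v y))) \<le> r x * tk \<delta> x y * (v y - v x)\<^sup>2"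
    proof (cases "y \<in> cball p a")
      case False
      then show ?thesis using lhs0 by simp
    next
      case y: True
      have A: "0 \<le> rmin * lam / m * r y" using rmin lam_pos m r_pos[of y] by simp
      have "(rmin * lam / m) * (indicator (cball p a) y *\<^sub>R (r y * (k + (2 * (c - v x)) * v y)))
         = (rmin * lam / m * r y) * (k + 2 * (c - v x) * v y)" using y by simp
      also have "\<dots> \<le> (rmin * lam / m * r y) * ((v y - v x)\<^sup>2 - (L * \<delta>)\<^sup>2)"
        by (rule mult_left_mono[OF kle A])
      also have "\<dots> \<le> r x * tk \<delta> x y * (v y - v x)\<^sup>2"
      proof (cases "\<delta> < norm (y - x)")
        case True
        then have ne: "y \<noteq> x" using \<delta> by auto
        have "lam / m \<le> wt x y"
          using wt_ge[OF a _ x ne] y unfolding m_def wt_commute[of x y] by (simp add: dist_norm norm_minus_commute)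
        then have "rmin * (lam / m) * r y \<le> r x * wt x y * r y"
          using r_ge[of x] rmin lam_pos m by (intro mult_right_mono mult_mono) (auto simp: less_imp_le[OF r_pos])
        then have "rmin * lam / m * r y \<le> r x * tk \<delta> x y" using True by (simp add: tk_def)
        then have "(rmin * lam / m * r y) * (v y - v x)\<^sup>2 \<le> r x * tk \<delta> x y * (v y - v x)\<^sup>2"
          by (rule mult_right_mono) simp
        moreover have "(rmin * lam / m * r y) * ((v y - v x)\<^sup>2 - (L * \<delta>)\<^sup>2) \<le> (rmin * lam / m * r y) * (v y - v x)\<^sup>2"
          by (rule mult_left_mono[OF _ A]) simp
        ultimately show ?thesis by linarith
      next
        case False
        have "\<bar>v (x + (y - x)) - v x\<bar> \<le> L * norm (y - x)" using False \<delta> by (intro v_lip) simp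
        also have "\<dots> \<le> L * \<delta>" using False L_nonneg by (intro mult_left_mono) auto
        finally have "\<bar>v y - v x\<bar> \<le> \<bar>L * \<delta>\<bar>" by simp
        then have "(v y - v x)\<^sup>2 - (L * \<delta>)\<^sup>2 \<le> 0" by (simp only: abs_le_square_iff diff_le_0_iff_le)
        then have "(rmin * lam / m * r y) * ((v y - v x)\<^sup>2 - (L * \<delta>)\<^sup>2) \<le> 0" using A by (simp only: mult_nonneg_nonpos)
        then show ?thesis using lhs0 by linarith
      qed
      finally show ?thesis .
    qed
  qed
  finally show ?thesis unfolding dissipation_eq c_def .
qed

lemma dissipation_integral_ge:
  assumes a: "a > 0" "2 * a \<le> R\<^sub>0" "a \<le> 1" and \<delta>: "0 < \<delta>" "\<delta> \<le> 2 * R\<^sub>0"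
  shows "(LINT x:unit_cube|lborel. dissipation \<delta> x)
    \<ge> rmin * lam * (LINT x:cball p (a / 5)|lborel. (v x - ball_avg a p)\<^sup>2 - (L * \<delta>)\<^sup>2)"
proof -
  obtain B where B: "\<And>x. \<bar>dissipation \<delta> x\<bar> \<le> B" using dissipation_bounded[OF \<delta>(1)] by blast
  define b where "b = p - (1/2) *\<^sub>R (1 :: real^'n)"
  have cube: "x \<in> unit_cube" if "b + x \<in> cball p (a / 5)" for x
  proof -
    have "norm (x - (1/2) *\<^sub>R (1 :: real^'n)) \<le> 1/5" using that a by (simp add: b_def dist_norm algebra_simps norm_minus_commute)
    then have "\<bar>x $ i - 1/2\<bar> \<le> 1/5" for i
      using component_le_norm_cart[of "x - (1/2) *\<^sub>R (1 :: real^'n)" i] by simp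
    then have "0 \<le> x $ i" "x $ i \<le> 1" for i
    proof -
      have "\<bar>x $ i - 1/2\<bar> \<le> 1/5" by fact
      then show "0 \<le> x $ i" "x $ i \<le> 1" by linarith+
    qed
    then show ?thesis by (simp add: unit_cube_def mem_box_cart)
  qed
  have i1: "set_integrable lborel (cball p (a / 5)) (dissipation \<delta>)"
    unfolding set_integrable_def
    by (rule integrableI_bounded_set_indicator[where B = B])
       (use B emeasure_bounded_finite[of "cball p (a / 5)"] in auto)
  have "rmin * lam * (LINT x:cball p (a / 5)|lborel. (v x - ball_avg a p)\<^sup>2 - (L * \<delta>)\<^sup>2)
     = (LINT x:cball p (a / 5)|lborel. rmin * lam * ((v x - ball_avg a p)\<^sup>2 - (L * \<delta>)\<^sup>2))" by simp
  also have "\<dots> \<le> (LINT x:cball p (a / 5)|lborel. dissipation \<delta> x)"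
  proof (rule set_integral_mono[OF _ i1])
    show "set_integrable lborel (cball p (a / 5)) (\<lambda>x. rmin * lam * ((v x - ball_avg a p)\<^sup>2 - (L * \<delta>)\<^sup>2))"
      by (intro set_integrable_continuous_cball continuous_intros v_cont)
    show "rmin * lam * ((v x - ball_avg a p)\<^sup>2 - (L * \<delta>)\<^sup>2) \<le> dissipation \<delta> x" if "x \<in> cball p (a / 5)" for x
      using that by (intro dissipation_ge a \<delta>) (simp add: dist_norm norm_minus_commute)
  qed
  also have "\<dots> = (\<integral>x. indicator (cball p (a / 5)) (b + x) *\<^sub>R dissipation \<delta> (b + x) \<partial>lborel)"
    unfolding set_lebesgue_integral_def
    by (rule lborel_integral_translate[where f = "\<lambda>x. indicator (cball p (a / 5)) x *\<^sub>R dissipation \<delta> x", symmetric])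
      (intro borel_measurable_scaleR borel_measurable_indicator dissipation_borel, simp)
  also have "\<dots> \<le> (LINT x:unit_cube|lborel. dissipation \<delta> (x + b))"
    unfolding set_lebesgue_integral_def
  proof (rule integral_mono')
    have "set_integrable lborel unit_cube (\<lambda>x. dissipation \<delta> (x + b))"
      by (rule set_integrable_unit_cube_bounded[where B = B]) (use B in auto)
    then show "integrable lborel (\<lambda>x. indicator unit_cube x *\<^sub>R dissipation \<delta> (x + b))" by (simp add: set_integrable_def)
    show "indicator (cball p (a / 5)) (b + x) *\<^sub>R dissipation \<delta> (b + x) \<le> indicator unit_cube x *\<^sub>R dissipation \<delta> (x + b)" for x
      using cube[of x] by (auto simp: dissipation_nonneg add.commute split: split_indicator)
  qed (simp add: dissipation_nonneg)
  also have "\<dots> = (LINT x:unit_cube|lborel. dissipation \<delta> x)"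
    by (rule unit_cube_integral_shift[OF dissipation_borel dissipation_periodic B])
  finally show ?thesis .
qed

text \<open>The uniform bound on the truncated integrals lets the principal value pass under the integral.\<close>

lemma energy_dissipation:
  assumes a: "a > 0" "2 * a \<le> R\<^sub>0" "a \<le> 1"
    and J: "\<And>x. ((\<lambda>\<delta>. T \<delta> x) \<longlongrightarrow> J x) (at_right 0)"
  shows "(LINT x:unit_cube|lborel. r x * v x * J x)
    \<le> - (1/2) * (rmin * lam * (LINT x:cball p (a / 5)|lborel. (v x - ball_avg a p)\<^sup>2))"
proof -
  define d where "d = (\<lambda>k::nat. inverse (real (Suc k)))"
  have d0: "d k > 0" for k by (simp add: d_def)
  have dl: "d \<longlonglongrightarrow> 0" unfolding d_def by (rule LIMSEQ_inverse_real_of_nat)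
  have "filterlim d (at_right 0) sequentially"
    using dl d0 by (auto simp: filterlim_at intro!: always_eventually less_imp_neq[THEN not_sym])
  then have lim: "(\<lambda>k. T (d k) x) \<longlonglongrightarrow> J x" for x using filterlim_compose[OF J] by blast
  obtain C where C: "\<And>\<delta> x. \<delta> > 0 \<Longrightarrow> \<bar>T \<delta> x\<bar> \<le> C" using T_bounded by blast
  obtain M where M: "\<And>x. r x \<le> M" using r_bounded by blast
  obtain B where B: "B \<ge> 0" "\<And>x. \<bar>v x\<bar> \<le> B" using v_bounded by blast
  note T_borel [measurable]
  have J_borel [measurable]: "J \<in> borel_measurable borel"
    by (rule borel_measurable_LIMSEQ_real[OF lim]) (rule T_borel)
  have lim1: "(\<lambda>k. LINT x:unit_cube|lborel. r x * v x * T (d k) x) \<longlonglongrightarrow> (LINT x:unit_cube|lborel. r x * v x * J x)"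
    unfolding set_lebesgue_integral_def
  proof (rule integral_dominated_convergence[where w = "\<lambda>x. indicator unit_cube x *\<^sub>R (M * B * C)"])
    show "integrable lborel (\<lambda>x::real^'n. indicator unit_cube x *\<^sub>R (M * B * C))"
      using emeasure_unit_cube by auto
    show "AE x in lborel. (\<lambda>k. indicator unit_cube x *\<^sub>R (r x * v x * T (d k) x)) \<longlonglongrightarrow> indicator unit_cube x *\<^sub>R (r x * v x * J x)"
      by (intro AE_I2 tendsto_intros lim)
    show "AE x in lborel. norm (indicator unit_cube x *\<^sub>R (r x * v x * T (d k) x)) \<le> indicator unit_cube x *\<^sub>R (M * B * C)" for k
    proof (rule AE_I2)
      fix x
      have "\<bar>r x\<bar> * \<bar>v x\<bar> * \<bar>T (d k) x\<bar> \<le> M * B * C"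
        using M[of x] B C[OF d0[of k], of x] r_pos[of x] by (intro mult_mono) auto
      then show "norm (indicator unit_cube x *\<^sub>R (r x * v x * T (d k) x)) \<le> indicator unit_cube x *\<^sub>R (M * B * C)"
        by (auto simp: abs_mult split: split_indicator)
    qed
  qed measurable
  let ?I = "LINT x:cball p (a / 5)|lborel. (v x - ball_avg a p)\<^sup>2"
  let ?V = "measure lborel (cball p (a / 5))"
  have fin: "emeasure lborel (cball p (a / 5)) < \<infinity>" by (rule emeasure_bounded_finite) simp
  have I: "(LINT x:cball p (a / 5)|lborel. (v x - ball_avg a p)\<^sup>2 - (L * \<delta>)\<^sup>2) = ?I - (L * \<delta>)\<^sup>2 * ?V" for \<delta>
  proof -
    have "(LINT x:cball p (a / 5)|lborel. (v x - ball_avg a p)\<^sup>2 - (L * \<delta>)\<^sup>2) = ?I - (LINT x:cball p (a / 5)|lborel. (L * \<delta>)\<^sup>2)"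
      by (intro set_integral_diff(2) set_integrable_continuous_cball continuous_intros v_cont)
    then show ?thesis using fin by (simp add: set_lebesgue_integral_def)
  qed
  have lim2: "(\<lambda>k. - (1/2) * (rmin * lam * (?I - (L * d k)\<^sup>2 * ?V))) \<longlonglongrightarrow> - (1/2) * (rmin * lam * (?I - (L * 0)\<^sup>2 * ?V))"
    by (intro tendsto_intros dl)
  have "eventually (\<lambda>k. d k < 2 * R\<^sub>0) sequentially"
    using dl R0 by (intro order_tendstoD(2)[of d 0]) auto
  then have "eventually (\<lambda>k. (LINT x:unit_cube|lborel. r x * v x * T (d k) x) \<le> - (1/2) * (rmin * lam * (?I - (L * d k)\<^sup>2 * ?V))) sequentially"
  proof eventually_elim
    case (elim k)
    then show ?case unfolding energy_identity[OF d0]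
      using dissipation_integral_ge[OF a d0, of k p] by (simp add: I)
  qed
  from tendsto_le[OF sequentially_bot lim2 lim1 this] show ?thesis by simp
qed

lemma maximum_nonpos:
  assumes max: "\<And>y. v y \<le> v x" and J: "((\<lambda>\<delta>. T \<delta> x) \<longlongrightarrow> J) (at_right 0)"
  shows "J \<le> 0"
proof -
  have "T \<delta> x \<le> 0" for \<delta>
  proof -
    have "tk \<delta> x y * (v y - v x) \<le> 0" for y
      using max[of y] tk_nonneg[of \<delta> x y] by (simp add: mult_nonneg_nonpos)
    then have "0 \<le> (\<integral>y. - (tk \<delta> x y * (v y - v x)) \<partial>lborel)" by (intro integral_nonneg_AE) simp
    then show ?thesis by (simp add: T_def)
  qed
  then show ?thesis by (intro tendsto_upperbound[OF J]) auto
qed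

lemma maximum_decay:
  assumes a: "a > 0" "2 * a \<le> R\<^sub>0" and max: "\<And>y. v y \<le> v x"
    and J: "((\<lambda>\<delta>. T \<delta> x) \<longlongrightarrow> J) (at_right 0)"
  shows "J \<le> - lam * (v x - ball_avg a x)"
proof -
  define m where "m = ball_mass a x"
  define c where "c = ball_avg a x"
  have m: "m > 0" using ball_mass_pos[OF a(1)] by (simp add: m_def)
  have le: "T \<delta> x \<le> lam * (c - v x + L * \<delta>)" if \<delta>: "0 < \<delta>" "\<delta> < 2 * R\<^sub>0" for \<delta>
  proof -
    define k where "k = L * \<delta> - v x"
    have "T \<delta> x \<le> (\<integral>y. (lam / m) * (indicator (cball x a) y *\<^sub>R (r y * (k + 1 * v y))) \<partial>lborel)"
      unfolding T_def
    proof (rule integral_mono)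
      have "set_integrable lborel (cball x a) (\<lambda>y. r y * (k + 1 * v y))"
        by (intro set_integrable_continuous_cball continuous_intros r_cont v_cont)
      then show "integrable lborel (\<lambda>y. (lam / m) * (indicator (cball x a) y *\<^sub>R (r y * (k + 1 * v y))))"
        unfolding set_integrable_def by (rule integrable_mult_right)
      show "integrable lborel (\<lambda>y. tk \<delta> x y * (v y - v x))" by (rule T_integrable[OF \<delta>(1)])
      fix y
      have neg: "tk \<delta> x y * (v y - v x) \<le> 0" using max[of y] tk_nonneg[of \<delta> x y] by (simp add: mult_nonneg_nonpos)
      show "tk \<delta> x y * (v y - v x) \<le> (lam / m) * (indicator (cball x a) y *\<^sub>R (r y * (k + 1 * v y)))"
      proof (cases "y \<in> cball x a")
        case False
        then show ?thesis using neg by simp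
      next
        case y: True
        have A: "0 \<le> lam / m * r y" using lam_pos m r_pos[of y] by simp
        have "tk \<delta> x y * (v y - v x) \<le> (lam / m * r y) * (k + v y)"
        proof (cases "\<delta> < norm (y - x)")
          case True
          then have ne: "y \<noteq> x" using \<delta> by auto
          have "lam / m \<le> wt x y"
            using wt_ge[OF a, of y x x] ne a y unfolding m_def wt_commute[of x y] by (simp add: dist_norm norm_minus_commute)
          then have "lam / m * r y \<le> wt x y * r y" by (rule mult_right_mono) (rule less_imp_le[OF r_pos])
          then have "lam / m * r y \<le> tk \<delta> x y" unfolding tk_def if_P[OF True] .
          then have "tk \<delta> x y * (v y - v x) \<le> (lam / m * r y) * (v y - v x)"
            using max[of y] by (intro mult_right_mono_neg) auto
          also have "\<dots> \<le> (lam / m * r y) * (k + v y)"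
            using L_nonneg \<delta> by (intro mult_left_mono[OF _ A]) (simp add: k_def)
          finally show ?thesis .
        next
          case False
          have "\<bar>v (x + (y - x)) - v x\<bar> \<le> L * norm (y - x)" using False \<delta> by (intro v_lip) simp
          also have "\<dots> \<le> L * \<delta>" using False L_nonneg by (intro mult_left_mono) auto
          finally have "0 \<le> k + v y" by (simp add: k_def abs_le_iff)
          then have "0 \<le> (lam / m * r y) * (k + v y)" by (rule mult_nonneg_nonneg[OF A])
          then show ?thesis using neg by linarith
        qed
        then show ?thesis using y by simp
      qed
    qed
    also have "\<dots> = (lam / m) * (LINT y:cball x a|lborel. r y * (k + 1 * v y))"
      by (simp add: set_lebesgue_integral_def)
    also have "\<dots> = (lam / m) * (m * (k + 1 * c))" unfolding ball_avg_affine[OF a(1)] m_def c_def ..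
    also have "\<dots> = lam * (c - v x + L * \<delta>)" using m by (simp add: k_def)
    finally show ?thesis .
  qed
  have "eventually (\<lambda>\<delta>. \<delta> < 2 * R\<^sub>0 \<and> 0 < \<delta>) (at_right 0)"
    using eventually_at_right_real[of 0 "2 * R\<^sub>0"] R0 by (auto elim: eventually_mono)
  then have "eventually (\<lambda>\<delta>. T \<delta> x \<le> lam * (c - v x + L * \<delta>)) (at_right 0)"
    by (rule eventually_mono) (use le in auto)
  moreover have "((\<lambda>\<delta>. lam * (c - v x + L * \<delta>)) \<longlongrightarrow> lam * (c - v x + L * 0)) (at_right 0)"
    by (intro tendsto_intros)
  ultimately have "J \<le> lam * (c - v x + L * 0)"
    by (intro tendsto_le[OF trivial_limit_at_right_real _ J])
  then show ?thesis by (simp add: c_def algebra_simps)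
qed

end

section \<open>Evolution along a solution\<close>

locale topo_solution =
  fixes \<rho> :: "real \<Rightarrow> real^'n \<Rightarrow> real" and u :: "real \<Rightarrow> real^'n \<Rightarrow> real^'n"
    and h :: "real \<Rightarrow> real" and \<alpha> R\<^sub>0 c\<^sub>1 c\<^sub>2 c :: real
    and F :: "real \<times> (real^'n) \<Rightarrow> real" and G :: "real \<times> (real^'n) \<Rightarrow> real^'n"
  assumes alpha: "0 < \<alpha>" "\<alpha> < 2" and R0: "R\<^sub>0 > 0"
    and h_cont: "continuous_on UNIV h" and h_nonneg: "\<And>s. 0 \<le> h s"
    and h_le: "\<And>s. 0 \<le> s \<Longrightarrow> h s \<le> c\<^sub>2" and h_zero: "\<And>s. 2 * R\<^sub>0 \<le> s \<Longrightarrow> h s = 0"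
    and c1: "c\<^sub>1 > 0" and h_ge: "\<And>s. 0 \<le> s \<Longrightarrow> s < R\<^sub>0 \<Longrightarrow> c\<^sub>1 \<le> h s"
    and F: "Cinf F" and F_eq: "\<And>t x. t \<ge> 0 \<Longrightarrow> F (t, x) = \<rho> t x"
    and G: "Cinf G" and G_eq: "\<And>t x. t \<ge> 0 \<Longrightarrow> G (t, x) = u t x"
    and per_rho: "\<And>t. t \<ge> 0 \<Longrightarrow> periodic (\<rho> t)" and per_u: "\<And>t. t \<ge> 0 \<Longrightarrow> periodic (u t)"
    and mass_eq: "\<And>t x. t > 0 \<Longrightarrow> vector_derivative (\<lambda>s. \<rho> s x) (at t)
        + (\<Sum>i\<in>UNIV. frechet_derivative (\<lambda>y. \<rho> t y * u t y $ i) (at x) (axis i 1)) = 0"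
    and align_int: "\<And>t x \<epsilon>. t > 0 \<Longrightarrow> \<epsilon> > 0 \<Longrightarrow> align_trunc h \<alpha> \<rho> u t x \<epsilon> integrable_on UNIV"
    and mom_eq: "\<And>t x. t > 0 \<Longrightarrow> ((\<lambda>\<epsilon>. integral UNIV (align_trunc h \<alpha> \<rho> u t x \<epsilon>))
          \<longlongrightarrow> vector_derivative (\<lambda>s. u s x) (at t) + frechet_derivative (u t) (at x) (u t x)) (at_right 0)"
    and c_pos: "c > 0" and lower: "\<And>t x. t \<ge> 0 \<Longrightarrow> \<rho> t x \<ge> c / (1 + t)"
begin

abbreviation "DF p \<equiv> frechet_derivative F (at p)"
abbreviation "DG p \<equiv> frechet_derivative G (at p)"

definition J :: "real \<Rightarrow> real^'n \<Rightarrow> real^'n" where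
  "J t x = DG (t, x) (1, 0) + DG (t, x) (0, u t x)"

lemma rho_eq: "t \<ge> 0 \<Longrightarrow> \<rho> t = (\<lambda>x. F (t, x))" and u_eq: "t \<ge> 0 \<Longrightarrow> u t = (\<lambda>x. G (t, x))"
  using F_eq G_eq by auto

lemma F_linear: "linear (DF p)" and G_linear: "linear (DG p)"
  by (rule has_derivative_linear[OF Cinf_has_derivative[OF F]], rule has_derivative_linear[OF Cinf_has_derivative[OF G]])

lemma F_cont: "continuous_on S F" by (rule Cinf_continuous_on[OF F])

lemma G_cont: "continuous_on S G" by (rule Cinf_continuous_on[OF G])

lemma DF_cont: "continuous_on S (\<lambda>p. DF p w)"
  by (rule Cinf_continuous_on[OF Cinf_frechet_derivative[OF F]])

lemma DG_cont: "continuous_on S (\<lambda>p. DG p w)"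
  by (rule Cinf_continuous_on[OF Cinf_frechet_derivative[OF G]])

lemma F_space: "((\<lambda>y. F (t, y)) has_derivative (\<lambda>w. DF (t, x) (0, w))) (at x)"
  by (rule has_derivative_compose[OF has_derivative_Pair[OF has_derivative_const has_derivative_ident] Cinf_has_derivative[OF F]])

lemma G_space: "((\<lambda>y. G (t, y)) has_derivative (\<lambda>w. DG (t, x) (0, w))) (at x)"
  by (rule has_derivative_compose[OF has_derivative_Pair[OF has_derivative_const has_derivative_ident] Cinf_has_derivative[OF G]])

lemma F_time: "((\<lambda>s. F (s, x)) has_vector_derivative DF (t, x) (1, 0)) (at t)"
proof -
  have "((\<lambda>s. F (s, x)) has_derivative (\<lambda>w. DF (t, x) (w, 0))) (at t)"
    by (rule has_derivative_compose[OF has_derivative_Pair[OF has_derivative_ident has_derivative_const] Cinf_has_derivative[OF F]])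
  moreover have "(\<lambda>w. DF (t, x) (w, 0)) = (\<lambda>w. w *\<^sub>R DF (t, x) (1, 0))"
  proof
    fix w :: real
    have e: "(w, 0) = w *\<^sub>R (1, 0 :: real^'n)" by simp
    show "DF (t, x) (w, 0) = w *\<^sub>R DF (t, x) (1, 0)" by (subst e) (rule linear_scale[OF F_linear])
  qed
  ultimately show ?thesis unfolding has_vector_derivative_def by (simp only:)
qed

lemma G_time: "((\<lambda>s. G (s, x)) has_vector_derivative DG (t, x) (1, 0)) (at t)"
proof -
  have "((\<lambda>s. G (s, x)) has_derivative (\<lambda>w. DG (t, x) (w, 0))) (at t)"
    by (rule has_derivative_compose[OF has_derivative_Pair[OF has_derivative_ident has_derivative_const] Cinf_has_derivative[OF G]])
  moreover have "(\<lambda>w. DG (t, x) (w, 0)) = (\<lambda>w. w *\<^sub>R DG (t, x) (1, 0))"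
  proof
    fix w :: real
    have e: "(w, 0) = w *\<^sub>R (1, 0 :: real^'n)" by simp
    show "DG (t, x) (w, 0) = w *\<^sub>R DG (t, x) (1, 0)" by (subst e) (rule linear_scale[OF G_linear])
  qed
  ultimately show ?thesis unfolding has_vector_derivative_def by (simp only:)
qed

lemma rho_time: assumes "t > 0" shows "vector_derivative (\<lambda>s. \<rho> s x) (at t) = DF (t, x) (1, 0)"
proof -
  have "((\<lambda>s. \<rho> s x) has_vector_derivative DF (t, x) (1, 0)) (at t)"
    by (rule has_vector_derivative_transform_within_open[OF F_time, where S = "{0<..}"]) (use assms F_eq in auto)
  then show ?thesis by (rule vector_derivative_at)
qed

lemma u_time: assumes "t > 0" shows "vector_derivative (\<lambda>s. u s x) (at t) = DG (t, x) (1, 0)"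
proof -
  have "((\<lambda>s. u s x) has_vector_derivative DG (t, x) (1, 0)) (at t)"
    by (rule has_vector_derivative_transform_within_open[OF G_time, where S = "{0<..}"]) (use assms G_eq in auto)
  then show ?thesis by (rule vector_derivative_at)
qed

lemma mom_limit:
  "t > 0 \<Longrightarrow> ((\<lambda>\<epsilon>. integral UNIV (align_trunc h \<alpha> \<rho> u t x \<epsilon>)) \<longlongrightarrow> J t x) (at_right 0)"
  using mom_eq[of t x] frechet_derivative_at[OF G_space, of t x, symmetric]
  by (simp add: J_def u_time u_eq)

lemma flux_space:
  "((\<lambda>y. F (t, y) * G (t, y) $ j) has_derivative
     (\<lambda>w. F (t, x) * DG (t, x) (0, w) $ j + DF (t, x) (0, w) * G (t, x) $ j)) (at x)"
  by (intro has_derivative_mult F_space bounded_linear.has_derivative[OF bounded_linear_vec_nth] G_space)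

lemma mass_eq':
  assumes "t > 0"
  shows "DF (t, x) (1, 0) = - (\<Sum>j\<in>UNIV. F (t, x) * DG (t, x) (0, axis j 1) $ j + DF (t, x) (0, axis j 1) * G (t, x) $ j)"
proof -
  have "frechet_derivative (\<lambda>y. \<rho> t y * u t y $ j) (at x)
     = (\<lambda>w. F (t, x) * DG (t, x) (0, w) $ j + DF (t, x) (0, w) * G (t, x) $ j)" for j
    using frechet_derivative_at[OF flux_space, of t x j] assms by (simp add: rho_eq u_eq)
  then show ?thesis using mass_eq[OF assms, of x] rho_time[OF assms, of x] by (simp add: eq_neg_iff_add_eq_0)
qed

lemma local_bounds:
  "\<exists>L\<ge>0. \<forall>x \<zeta>. norm \<zeta> \<le> 2 * R\<^sub>0 \<longrightarrow> t \<ge> 0 \<longrightarrow>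
     \<bar>\<rho> t (x + \<zeta>) - \<rho> t (x - \<zeta>)\<bar> \<le> L * norm \<zeta> \<and>
     norm (u t (x + \<zeta>) - u t x) \<le> L * norm \<zeta> \<and>
     norm (u t (x + \<zeta>) + u t (x - \<zeta>) - 2 *\<^sub>R u t x) \<le> L * (norm \<zeta>)\<^sup>2"
proof (cases "t \<ge> 0")
  case t: True
  obtain R where R: "\<And>x::real^'n. x \<in> unit_cube \<Longrightarrow> norm x \<le> R" using unit_cube_bounded by blast
  define K where "K = cball (t, 0 :: real^'n) (R + 2 * R\<^sub>0)"
  have K: "bounded K" "convex K" by (auto simp: K_def)
  obtain L1 where L1: "L1 \<ge> 0" "\<forall>p\<in>K. \<forall>q\<in>K. norm (F p - F q) \<le> L1 * norm (p - q)"
    using Cinf_lipschitz_on_bounded[OF F K] by auto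
  obtain L2 where L2: "L2 \<ge> 0" "\<forall>p\<in>K. \<forall>q\<in>K. norm (G p - G q) \<le> L2 * norm (p - q)"
    using Cinf_lipschitz_on_bounded[OF G K] by auto
  obtain L3 where L3: "L3 \<ge> 0" "\<forall>p z. p + z \<in> K \<longrightarrow> p - z \<in> K \<longrightarrow> norm (G (p + z) + G (p - z) - 2 *\<^sub>R G p) \<le> L3 * (norm z)\<^sup>2"
    using Cinf_second_difference[OF G K] by auto
  define L where "L = 2 * L1 + L2 + L3"
  have cube: "\<bar>\<rho> t (x + \<zeta>) - \<rho> t (x - \<zeta>)\<bar> \<le> L * norm \<zeta> \<and>
     norm (u t (x + \<zeta>) - u t x) \<le> L * norm \<zeta> \<and>
     norm (u t (x + \<zeta>) + u t (x - \<zeta>) - 2 *\<^sub>R u t x) \<le> L * (norm \<zeta>)\<^sup>2"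
    if x: "x \<in> unit_cube" and z: "norm \<zeta> \<le> 2 * R\<^sub>0" for x \<zeta>
  proof -
    have inK: "(t, x + w) \<in> K" if "norm w \<le> 2 * R\<^sub>0" for w
    proof -
      have "norm (x + w) \<le> R + 2 * R\<^sub>0" using norm_triangle_ineq[of x w] R[OF x] that by linarith
      then show ?thesis by (simp add: K_def dist_Pair_Pair)
    qed
    have k: "(t, x + \<zeta>) \<in> K" "(t, x - \<zeta>) \<in> K" "(t, x) \<in> K" using inK[of \<zeta>] inK[of "- \<zeta>"] inK[of 0] z R0 by auto
    have nz: "norm ((t, x + \<zeta>) - (t, x - \<zeta>)) = 2 * norm \<zeta>"
    proof -
      have "(t, x + \<zeta>) - (t, x - \<zeta>) = 2 *\<^sub>R (0, \<zeta>)" by (simp add: scaleR_2)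
      then have "norm ((t, x + \<zeta>) - (t, x - \<zeta>)) = 2 * norm (0::real, \<zeta>)" by (simp only: norm_scaleR)
      moreover have "norm (0::real, \<zeta>) = norm \<zeta>" by (simp add: norm_Pair)
      ultimately show ?thesis by (simp only:)
    qed
    have "\<bar>\<rho> t (x + \<zeta>) - \<rho> t (x - \<zeta>)\<bar> \<le> L1 * (2 * norm \<zeta>)"
      using L1(2)[rule_format, OF k(1,2)] t unfolding nz by (simp add: F_eq)
    also have "\<dots> \<le> L * norm \<zeta>" using L2(1) L3(1) by (simp add: L_def algebra_simps)
    finally have 1: "\<bar>\<rho> t (x + \<zeta>) - \<rho> t (x - \<zeta>)\<bar> \<le> L * norm \<zeta>" .
    have "norm (u t (x + \<zeta>) - u t x) \<le> L2 * norm \<zeta>"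
      using L2(2)[rule_format, OF k(1,3)] t by (simp add: G_eq norm_Pair)
    also have "\<dots> \<le> L * norm \<zeta>" using L1(1) L3(1) by (simp add: L_def algebra_simps)
    finally have 2: "norm (u t (x + \<zeta>) - u t x) \<le> L * norm \<zeta>" .
    have "norm (u t (x + \<zeta>) + u t (x - \<zeta>) - 2 *\<^sub>R u t x) \<le> L3 * (norm \<zeta>)\<^sup>2"
      using L3(2)[rule_format, of "(t, x)" "(0, \<zeta>)"] k t by (simp add: G_eq norm_Pair)
    also have "\<dots> \<le> L * (norm \<zeta>)\<^sup>2" using L1(1) L2(1) by (intro mult_right_mono) (auto simp: L_def)
    finally show ?thesis using 1 2 by blast
  qed
  show ?thesis
  proof (intro exI[of _ L] conjI allI impI)
    show "0 \<le> L" using L1 L2 L3 by (simp add: L_def)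
    fix x \<zeta> :: "real^'n" assume z: "norm \<zeta> \<le> 2 * R\<^sub>0"
    define k :: "'n \<Rightarrow> int" where "k = (\<lambda>i. - \<lfloor>x $ i\<rfloor>)"
    note * = cube[OF lattice_translate_in_unit_cube[of x, folded k_def] z]
    have r: "\<rho> t (y + lattice_point k) = \<rho> t y" and uu: "u t (y + lattice_point k) = u t y" for y
      using per_rho per_u t by (auto simp: periodic_lattice_point)
    have e: "x + lattice_point k + \<zeta> = (x + \<zeta>) + lattice_point k" "x + lattice_point k - \<zeta> = (x - \<zeta>) + lattice_point k"
      by (simp_all add: algebra_simps)
    from *[unfolded e r uu]
    show "\<bar>\<rho> t (x + \<zeta>) - \<rho> t (x - \<zeta>)\<bar> \<le> L * norm \<zeta>"
     "norm (u t (x + \<zeta>) - u t x) \<le> L * norm \<zeta>"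
     "norm (u t (x + \<zeta>) + u t (x - \<zeta>) - 2 *\<^sub>R u t x) \<le> L * (norm \<zeta>)\<^sup>2" by blast+
  qed
qed (auto intro: exI[of _ 0])

abbreviation lam :: real where "lam \<equiv> c\<^sub>1 / R\<^sub>0 powr \<alpha>"

definition avg :: "real \<Rightarrow> 'n \<Rightarrow> real \<Rightarrow> real^'n \<Rightarrow> real" where
  "avg a i t p = (LINT y:cball p a|lborel. \<rho> t y * u t y $ i) / (LINT y:cball p a|lborel. \<rho> t y)"

lemma static_facts:
  fixes i :: 'n and m k :: real
  assumes t: "t > 0" and a: "a > 0" "2 * a \<le> R\<^sub>0" "a \<le> 1" and m: "\<bar>m\<bar> = 1"
  shows "(LINT x:unit_cube|lborel. \<rho> t x * (m * u t x $ i + k) * (m * J t x $ i))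
    \<le> - (1/2) * (c / (1 + t) * lam * (LINT x:cball p (a / 5)|lborel. (u t x $ i - avg a i t p)\<^sup>2))"
    and "(\<And>y. m * u t y $ i \<le> m * u t x $ i) \<Longrightarrow> m * J t x $ i \<le> - lam * (m * u t x $ i - m * avg a i t x)"
    and "(\<And>y. m * u t y $ i \<le> m * u t x $ i) \<Longrightarrow> m * J t x $ i \<le> 0"
proof -
  have t0: "t \<ge> 0" using t by simp
  obtain L where L: "L \<ge> 0" "\<And>x \<zeta>. norm \<zeta> \<le> 2 * R\<^sub>0 \<Longrightarrow> \<bar>\<rho> t (x + \<zeta>) - \<rho> t (x - \<zeta>)\<bar> \<le> L * norm \<zeta>"
     "\<And>x \<zeta>. norm \<zeta> \<le> 2 * R\<^sub>0 \<Longrightarrow> norm (u t (x + \<zeta>) - u t x) \<le> L * norm \<zeta>"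
     "\<And>x \<zeta>. norm \<zeta> \<le> 2 * R\<^sub>0 \<Longrightarrow> norm (u t (x + \<zeta>) + u t (x - \<zeta>) - 2 *\<^sub>R u t x) \<le> L * (norm \<zeta>)\<^sup>2"
    using local_bounds[of t] t0 by metis
  have rc: "continuous_on UNIV (\<rho> t)" unfolding rho_eq[OF t0]
    by (intro continuous_on_compose2[OF F_cont] continuous_intros) auto
  have uc: "continuous_on UNIV (\<lambda>x. u t x $ i)" unfolding u_eq[OF t0]
    by (intro continuous_intros continuous_on_compose2[OF G_cont]) auto
  define v where "v = (\<lambda>x. m * u t x $ i + k)"
  have mabs: "\<bar>m * w\<bar> = \<bar>w\<bar>" for w using m by (simp add: abs_mult)
  interpret W: topo_alignment h \<alpha> R\<^sub>0 c\<^sub>1 c\<^sub>2 "\<rho> t" "c / (1 + t)" v L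
  proof
    show "periodic (\<rho> t)" using per_rho t0 .
    show "periodic v" using per_u[OF t0] by (auto simp: v_def periodic_def)
    show "continuous_on UNIV v" unfolding v_def by (intro continuous_intros uc)
    show "0 < c / (1 + t)" using c_pos t by simp
    show "\<bar>v (x + \<zeta>) - v x\<bar> \<le> L * norm \<zeta>" if "norm \<zeta> \<le> 2 * R\<^sub>0" for x \<zeta>
    proof -
      have "\<bar>v (x + \<zeta>) - v x\<bar> = \<bar>m * ((u t (x + \<zeta>) - u t x) $ i)\<bar>" by (simp add: v_def algebra_simps)
      also have "\<dots> \<le> norm (u t (x + \<zeta>) - u t x)" unfolding mabs by (rule component_le_norm_cart)
      finally show ?thesis using L(3)[OF that, of x] by simp
    qed
    show "\<bar>v (x + \<zeta>) + v (x - \<zeta>) - 2 * v x\<bar> \<le> L * (norm \<zeta>)\<^sup>2" if "norm \<zeta> \<le> 2 * R\<^sub>0" for x \<zeta>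
    proof -
      have "\<bar>v (x + \<zeta>) + v (x - \<zeta>) - 2 * v x\<bar> = \<bar>m * ((u t (x + \<zeta>) + u t (x - \<zeta>) - 2 *\<^sub>R u t x) $ i)\<bar>"
        by (simp add: v_def algebra_simps)
      also have "\<dots> \<le> norm (u t (x + \<zeta>) + u t (x - \<zeta>) - 2 *\<^sub>R u t x)" unfolding mabs by (rule component_le_norm_cart)
      finally show ?thesis using L(4)[OF that, of x] by simp
    qed
  qed (use alpha R0 h_cont h_nonneg h_le h_zero c1 h_ge L rc lower[OF t0] in auto)
  have T: "W.T \<delta> x = m * integral UNIV (align_trunc h \<alpha> \<rho> u t x \<delta>) $ i" if "\<delta> > 0" for \<delta> x
  proof -
    have at: "align_trunc h \<alpha> \<rho> u t x \<delta> y $ i = W.tk \<delta> x y * (u t y $ i - u t x $ i)" for y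
      unfolding align_trunc_def W.tk_def using W.comm_weight_eq[of \<rho> t, OF refl, of x y] by simp
    have "W.T \<delta> x = integral UNIV (\<lambda>y. W.tk \<delta> x y * (v y - v x))"
      unfolding W.T_def by (rule integral_lborel[symmetric]) (rule W.T_integrable[OF that])
    also have "\<dots> = integral UNIV (\<lambda>y. m * (align_trunc h \<alpha> \<rho> u t x \<delta> y $ i))"
      by (rule integral_cong) (simp add: at v_def algebra_simps)
    also have "\<dots> = m * integral UNIV (align_trunc h \<alpha> \<rho> u t x \<delta>) $ i"
      using integral_component_eq_cart[OF align_int[OF t that, of x], of i] by simp
    finally show ?thesis .
  qed
  have Jl: "((\<lambda>\<delta>. W.T \<delta> x) \<longlongrightarrow> m * J t x $ i) (at_right 0)" for x
  proof (rule Lim_transform_eventually)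
    show "((\<lambda>\<delta>. m * integral UNIV (align_trunc h \<alpha> \<rho> u t x \<delta>) $ i) \<longlongrightarrow> m * J t x $ i) (at_right 0)"
      by (intro tendsto_intros mom_limit t)
    show "\<forall>\<^sub>F \<delta> in at_right 0. m * integral UNIV (align_trunc h \<alpha> \<rho> u t x \<delta>) $ i = W.T \<delta> x"
      using T by (auto simp: eventually_at_filter)
  qed
  have av: "W.ball_avg a p = m * avg a i t p + k" for p
  proof -
    have M: "(LINT y:cball p a|lborel. \<rho> t y) > 0" using W.ball_mass_pos[OF a(1), of p] by (simp add: W.ball_mass_def)
    have "(LINT y:cball p a|lborel. \<rho> t y * v y) = (LINT y:cball p a|lborel. m * (\<rho> t y * u t y $ i) + k * \<rho> t y)"
      by (intro arg_cong[where f = "set_lebesgue_integral lborel (cball p a)"] ext) (simp add: v_def algebra_simps)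
    also have "\<dots> = (LINT y:cball p a|lborel. m * (\<rho> t y * u t y $ i)) + (LINT y:cball p a|lborel. k * \<rho> t y)"
      by (intro set_integral_add(2) set_integrable_continuous_cball continuous_intros rc uc)
    also have "\<dots> = m * (LINT y:cball p a|lborel. \<rho> t y * u t y $ i) + k * (LINT y:cball p a|lborel. \<rho> t y)" by simp
    finally show ?thesis using M by (simp add: W.ball_avg_def W.ball_mass_def avg_def field_simps)
  qed
  have sq: "(v x - W.ball_avg a p)\<^sup>2 = (u t x $ i - avg a i t p)\<^sup>2" for x p
  proof -
    have "v x - W.ball_avg a p = m * (u t x $ i - avg a i t p)" unfolding av by (simp add: v_def algebra_simps)
    then show ?thesis using m by (metis abs_square_eq_1 mabs power2_abs)
  qed
  show "(LINT x:unit_cube|lborel. \<rho> t x * (m * u t x $ i + k) * (m * J t x $ i))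
    \<le> - (1/2) * (c / (1 + t) * lam * (LINT x:cball p (a / 5)|lborel. (u t x $ i - avg a i t p)\<^sup>2))"
    using W.energy_dissipation[OF a Jl, of p] unfolding sq W.lam_def by (simp add: v_def)
  assume mx: "\<And>y. m * u t y $ i \<le> m * u t x $ i"
  then have mx': "v y \<le> v x" for y by (simp add: v_def)
  show "m * J t x $ i \<le> - lam * (m * u t x $ i - m * avg a i t x)"
    using W.maximum_decay[OF a(1,2) mx' Jl] unfolding av W.lam_def by (simp add: v_def)
  show "m * J t x $ i \<le> 0" by (rule W.maximum_nonpos[OF mx' Jl])
qed

end

lemma chain_bound:
  fixes f :: "'a::real_normed_vector \<Rightarrow> real"
  assumes step: "\<And>p q. norm (p - q) \<le> s \<Longrightarrow> \<bar>f p - f q\<bar> \<le> B" and pq: "norm (p - q) \<le> real N * s"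
  shows "\<bar>f p - f q\<bar> \<le> real N * B"
proof (cases "N = 0")
  case True
  then show ?thesis using pq by simp
next
  case False
  define z where "z = (\<lambda>j::nat. p + (real j / real N) *\<^sub>R (q - p))"
  have st: "\<bar>f (z (Suc j)) - f (z j)\<bar> \<le> B" for j
  proof (rule step)
    have "z (Suc j) - z j = (1 / real N) *\<^sub>R (q - p)"
      by (simp add: z_def add_divide_distrib scaleR_add_left)
    then have "norm (z (Suc j) - z j) = norm (p - q) / real N" by (simp add: norm_minus_commute)
    also have "\<dots> \<le> s" using pq False by (simp add: divide_simps mult.commute)
    finally show "norm (z (Suc j) - z j) \<le> s" .
  qed
  have "\<bar>f (z j) - f p\<bar> \<le> real j * B" for j
  proof (induction j)
    case 0
    then show ?case by (simp add: z_def)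
  next
    case (Suc j)
    then show ?case using st[of j] by (simp add: algebra_simps)
  qed
  from this[of N] show ?thesis using False by (simp add: z_def abs_minus_commute)
qed

context topo_solution
begin

lemma F_slice_cont [continuous_intros]: "continuous_on S (\<lambda>x. F (t, x))"
  by (rule continuous_on_compose2[OF F_cont[of UNIV]]) (auto intro!: continuous_intros)

lemma G_slice_cont [continuous_intros]: "continuous_on S (\<lambda>x. G (t, x))"
  by (rule continuous_on_compose2[OF G_cont[of UNIV]]) (auto intro!: continuous_intros)

lemma DF_slice_cont [continuous_intros]: "continuous_on S (\<lambda>x. DF (t, x) w)"
  by (rule continuous_on_compose2[OF DF_cont[of UNIV]]) (auto intro!: continuous_intros)

lemma DG_slice_cont [continuous_intros]: "continuous_on S (\<lambda>x. DG (t, x) w)"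
  by (rule continuous_on_compose2[OF DG_cont[of UNIV]]) (auto intro!: continuous_intros)

lemma transport_expand: "DG (t, x) (0, w) $ i = (\<Sum>j\<in>UNIV. w $ j * DG (t, x) (0, axis j 1) $ i)"
  by (rule linear_componentwise[OF linear_matrix_vector_mul_eq[THEN iffD2, OF has_derivative_linear[OF G_space]]])

lemma J_cont: "t \<ge> 0 \<Longrightarrow> continuous_on S (\<lambda>x. J t x $ i)"
  unfolding J_def vector_add_component transport_expand[of t _ "u t _"]
  by (simp add: u_eq) (intro continuous_intros)

lemma F_per: "t \<ge> 0 \<Longrightarrow> \<forall>i. z $ i \<in> \<int> \<Longrightarrow> F (t, x + z) = F (t, x)"
  and G_per: "t \<ge> 0 \<Longrightarrow> \<forall>i. z $ i \<in> \<int> \<Longrightarrow> G (t, x + z) = G (t, x)"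
  using per_rho per_u by (simp_all add: F_eq G_eq periodic_def)

definition energy :: "'n \<Rightarrow> real \<Rightarrow> real \<Rightarrow> real" where
  "energy i k t = integral unit_cube (\<lambda>x. F (t, x) * (G (t, x) $ i + k)\<^sup>2 / 2)"

definition energy_rate :: "'n \<Rightarrow> real \<Rightarrow> real \<Rightarrow> real" where
  "energy_rate i k t = integral unit_cube (\<lambda>x. DF (t, x) (1, 0) * (G (t, x) $ i + k)\<^sup>2 / 2
      + F (t, x) * (G (t, x) $ i + k) * DG (t, x) (1, 0) $ i)"

lemma energy_deriv: "(energy i k has_real_derivative energy_rate i k t) (at t)"
proof -
  have "((\<lambda>s. integral (cbox 0 1) (\<lambda>x. F (s, x) * (G (s, x) $ i + k)\<^sup>2 / 2)) has_field_derivative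
      integral (cbox 0 1) (\<lambda>x. DF (t, x) (1, 0) * (G (t, x) $ i + k)\<^sup>2 / 2
      + F (t, x) * (G (t, x) $ i + k) * DG (t, x) (1, 0) $ i)) (at t within UNIV)"
  proof (rule leibniz_rule_field_derivative)
    fix s x
    have 1: "((\<lambda>s. F (s, x)) has_real_derivative DF (s, x) (1, 0)) (at s)"
      using F_time by (simp add: has_real_derivative_iff_has_vector_derivative)
    have 2: "((\<lambda>s. G (s, x) $ i) has_real_derivative DG (s, x) (1, 0) $ i) (at s)"
      using bounded_linear.has_vector_derivative[OF bounded_linear_vec_nth G_time]
      by (simp add: has_real_derivative_iff_has_vector_derivative)
    show "((\<lambda>s. F (s, x) * (G (s, x) $ i + k)\<^sup>2 / 2) has_field_derivative
      DF (s, x) (1, 0) * (G (s, x) $ i + k)\<^sup>2 / 2 + F (s, x) * (G (s, x) $ i + k) * DG (s, x) (1, 0) $ i) (at s within UNIV)"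
    proof -
      have 3: "((\<lambda>s. G (s, x) $ i + k) has_real_derivative DG (s, x) (1, 0) $ i) (at s)"
        using DERIV_add[OF 2 DERIV_const[of k]] by simp
      show ?thesis
        by (rule DERIV_cong[OF DERIV_cdivide[OF DERIV_mult[OF 1 DERIV_power[OF 3, of 2]], of 2]])
           (simp add: algebra_simps add_divide_distrib)
    qed
  next
    show "(\<lambda>x. F (s, x) * (G (s, x) $ i + k)\<^sup>2 / 2) integrable_on cbox 0 1" for s
      by (intro integrable_continuous continuous_intros) auto
    show "continuous_on (UNIV \<times> cbox 0 1) (\<lambda>(s, x). DF (s, x) (1, 0) * (G (s, x) $ i + k)\<^sup>2 / 2
        + F (s, x) * (G (s, x) $ i + k) * DG (s, x) (1, 0) $ i)"
      unfolding split_def prod.collapse by (intro continuous_intros F_cont G_cont DF_cont DG_cont) auto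
  qed auto
  then show ?thesis by (simp add: energy_def[abs_def] energy_rate_def unit_cube_def)
qed

lemma work_cont: "t \<ge> 0 \<Longrightarrow> continuous_on S (\<lambda>x. \<rho> t x * (u t x $ i + k) * J t x $ i)"
  unfolding rho_eq u_eq by (intro continuous_intros J_cont)

lemma energy_rate_eq:
  assumes "t > 0"
  shows "energy_rate i k t = integral unit_cube (\<lambda>x. \<rho> t x * (u t x $ i + k) * J t x $ i)"
proof -
  have t: "t \<ge> 0" using assms by simp
  define g' where "g' = (\<lambda>j x w. F (t, x) * G (t, x) $ j * ((G (t, x) $ i + k) * DG (t, x) (0, w) $ i)
      + (F (t, x) * DG (t, x) (0, w) $ j + DF (t, x) (0, w) * G (t, x) $ j) * ((G (t, x) $ i + k)\<^sup>2 / 2))"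
  have g: "((\<lambda>y. F (t, y) * G (t, y) $ j * ((G (t, y) $ i + k)\<^sup>2 / 2)) has_derivative g' j x) (at x)" for j x
  proof -
    have 1: "((\<lambda>y. G (t, y) $ i + k) has_derivative (\<lambda>w. DG (t, x) (0, w) $ i)) (at x)"
      using has_derivative_add[OF bounded_linear.has_derivative[OF bounded_linear_vec_nth G_space, of t i x] has_derivative_const[of k]]
      by simp
    have 2: "((\<lambda>y. (G (t, y) $ i + k)\<^sup>2 / 2) has_derivative (\<lambda>w. (G (t, x) $ i + k) * DG (t, x) (0, w) $ i)) (at x)"
      unfolding power2_eq_square by (rule derivative_eq_intros 1 refl)+ (auto simp: field_simps)
    show ?thesis unfolding g'_def by (rule has_derivative_mult[OF flux_space 2])
  qed
  have g'_cont: "continuous_on UNIV (\<lambda>x. g' j x w)" for j w unfolding g'_def by (intro continuous_intros) auto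
  have g_int: "integral unit_cube (\<lambda>x. g' j x (axis j 1)) = 0" for j
    by (rule integral_partial_derivative_periodic[OF g _ g'_cont]) (simp add: periodic_def F_per[OF t] G_per[OF t])
  have point: "DF (t, x) (1, 0) * (G (t, x) $ i + k)\<^sup>2 / 2 + F (t, x) * (G (t, x) $ i + k) * DG (t, x) (1, 0) $ i
      = \<rho> t x * (u t x $ i + k) * J t x $ i - (\<Sum>j\<in>UNIV. g' j x (axis j 1))" for x
  proof -
    have "(\<Sum>j\<in>UNIV. g' j x (axis j 1)) = (\<Sum>j\<in>UNIV. F (t, x) * (G (t, x) $ i + k) * (G (t, x) $ j * DG (t, x) (0, axis j 1) $ i))
       + (\<Sum>j\<in>UNIV. (F (t, x) * DG (t, x) (0, axis j 1) $ j + DF (t, x) (0, axis j 1) * G (t, x) $ j) * ((G (t, x) $ i + k)\<^sup>2 / 2))"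
      unfolding sum.distrib[symmetric] g'_def by (intro sum.cong refl) (simp add: algebra_simps)
    also have "\<dots> = F (t, x) * (G (t, x) $ i + k) * DG (t, x) (0, G (t, x)) $ i
       - DF (t, x) (1, 0) * ((G (t, x) $ i + k)\<^sup>2 / 2)"
      unfolding mass_eq'[OF assms] sum_distrib_left[symmetric] sum_distrib_right[symmetric]
        transport_expand[of t x "G (t, x)"] by simp
    finally show ?thesis using t by (simp add: J_def F_eq G_eq algebra_simps)
  qed
  have "energy_rate i k t = integral unit_cube (\<lambda>x. \<rho> t x * (u t x $ i + k) * J t x $ i) - integral unit_cube (\<lambda>x. \<Sum>j\<in>UNIV. g' j x (axis j 1))"
    unfolding energy_rate_def point unit_cube_def
    by (intro Henstock_Kurzweil_Integration.integral_diff integrable_continuous continuous_on_sum work_cont t continuous_on_subset[OF g'_cont]) auto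
  also have "integral unit_cube (\<lambda>x. \<Sum>j\<in>UNIV. g' j x (axis j 1)) = (\<Sum>j\<in>UNIV. integral unit_cube (\<lambda>x. g' j x (axis j 1)))"
    unfolding unit_cube_def
    by (intro integral_sum integrable_continuous continuous_on_subset[OF g'_cont]) auto
  finally show ?thesis by (simp add: g_int)
qed

lemma energy_rate_le:
  assumes t: "t > 0" and a: "a > 0" "2 * a \<le> R\<^sub>0" "a \<le> 1"
  shows "energy_rate i k t \<le> - (1/2) * (c / (1 + t) * lam * (LINT x:cball p (a / 5)|lborel. (u t x $ i - avg a i t p)\<^sup>2))"
proof -
  have t0: "t \<ge> 0" using t by simp
  have "energy_rate i k t = (LINT x:unit_cube|lborel. \<rho> t x * (u t x $ i + k) * J t x $ i)"
    unfolding energy_rate_eq[OF t] by (rule unit_cube_lebesgue_integral_eq[OF work_cont[OF t0], symmetric])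
  then show ?thesis using static_facts(1)[OF t a, of 1 i k p] by simp
qed

lemma energy_rate_nonpos:
  assumes "t > 0" shows "energy_rate i k t \<le> 0"
proof -
  define a where "a = min 1 (R\<^sub>0 / 2)"
  have a: "a > 0" "2 * a \<le> R\<^sub>0" "a \<le> 1" using R0 by (auto simp: a_def)
  have "0 \<le> (LINT x:cball 0 (a / 5)|lborel. (u t x $ i - avg a i t 0)\<^sup>2)"
    unfolding set_lebesgue_integral_def by (rule integral_nonneg_AE) simp
  then have "0 \<le> c / (1 + t) * lam * (LINT x:cball 0 (a / 5)|lborel. (u t x $ i - avg a i t 0)\<^sup>2)"
    using assms c_pos c1 by (intro mult_nonneg_nonneg) auto
  then show ?thesis using energy_rate_le[OF assms a, of i k 0] by linarith
qed

lemma energy_cont: "continuous_on S (energy i k)"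
  by (meson energy_deriv DERIV_isCont continuous_at_imp_continuous_on)

lemma energy_nonincreasing: "0 \<le> t \<Longrightarrow> energy i k t \<le> energy i k 0"
  by (rule nonincreasing_by_lower_tangents[OF _ energy_cont]) (auto intro!: energy_deriv energy_rate_nonpos exI)

lemma energy_nonneg: "0 \<le> t \<Longrightarrow> energy i k t \<ge> 0"
proof -
  assume t: "0 \<le> t"
  have "0 \<le> F (t, x)" for x using lower[OF t, of x] c_pos t by (simp add: F_eq) (smt (verit) divide_pos_pos)
  then show ?thesis unfolding energy_def unit_cube_def
    by (intro Henstock_Kurzweil_Integration.integral_nonneg integrable_continuous continuous_intros) auto
qed

definition mass :: "real \<Rightarrow> real" where "mass t = integral unit_cube (\<lambda>x. F (t, x))"

definition momentum :: "'n \<Rightarrow> real \<Rightarrow> real" where "momentum i t = integral unit_cube (\<lambda>x. F (t, x) * G (t, x) $ i)"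

lemma energy_expand: "energy i k t = energy i 0 t + k * momentum i t + k\<^sup>2 / 2 * mass t"
proof -
  have "energy i k t = integral unit_cube (\<lambda>x. F (t, x) * (G (t, x) $ i + 0)\<^sup>2 / 2 + (k * (F (t, x) * G (t, x) $ i) + k\<^sup>2 / 2 * F (t, x)))"
    unfolding energy_def by (intro integral_cong) (simp add: power2_eq_square field_simps)
  also have "\<dots> = energy i 0 t + (integral unit_cube (\<lambda>x. k * (F (t, x) * G (t, x) $ i)) + integral unit_cube (\<lambda>x. k\<^sup>2 / 2 * F (t, x)))"
    unfolding energy_def unit_cube_def
    by (subst Henstock_Kurzweil_Integration.integral_add; (subst Henstock_Kurzweil_Integration.integral_add)?;
        (intro refl integrable_continuous continuous_intros)?) auto
  finally show ?thesis by (simp add: momentum_def mass_def)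
qed

lemma mass_conserved: assumes "t \<ge> 0" shows "mass t = mass 0"
proof -
  have d: "(mass has_real_derivative integral unit_cube (\<lambda>x. DF (s, x) (1, 0))) (at s)" for s
  proof -
    have "((\<lambda>s. integral (cbox 0 1) (\<lambda>x. F (s, x))) has_field_derivative
        integral (cbox 0 1) (\<lambda>x. DF (s, x) (1, 0))) (at s within UNIV)"
    proof (rule leibniz_rule_field_derivative)
      show "((\<lambda>s. F (s, x)) has_field_derivative DF (s, x) (1, 0)) (at s within UNIV)" for s x
        using F_time by (simp add: has_real_derivative_iff_has_vector_derivative)
      show "(\<lambda>x. F (s, x)) integrable_on cbox 0 1" for s by (intro integrable_continuous continuous_intros)
      show "continuous_on (UNIV \<times> cbox 0 1) (\<lambda>(s, x). DF (s, x) (1, 0))"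
        unfolding split_def prod.collapse by (rule DF_cont)
    qed auto
    then show ?thesis by (simp add: mass_def[abs_def] unit_cube_def)
  qed
  have z: "integral unit_cube (\<lambda>x. DF (s, x) (1, 0)) = 0" if s: "s > 0" for s
  proof -
    have s0: "s \<ge> 0" using s by simp
    let ?g = "\<lambda>j x w. F (s, x) * DG (s, x) (0, w) $ j + DF (s, x) (0, w) * G (s, x) $ j"
    have gc: "continuous_on UNIV (\<lambda>x. ?g j x w)" for j w by (intro continuous_intros)
    have "integral unit_cube (\<lambda>x. ?g j x (axis j 1)) = 0" for j
      by (rule integral_partial_derivative_periodic[OF flux_space _ gc]) (simp add: periodic_def F_per[OF s0] G_per[OF s0])
    moreover have "integral unit_cube (\<lambda>x. DF (s, x) (1, 0)) = - (\<Sum>j\<in>UNIV. integral unit_cube (\<lambda>x. ?g j x (axis j 1)))"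
      unfolding mass_eq'[OF s] integral_neg unit_cube_def
      by (subst integral_sum[symmetric]) (auto intro!: integrable_continuous continuous_on_subset[OF gc])
    ultimately show ?thesis by simp
  qed
  show ?thesis
  proof (cases "t = 0")
    case False
    then have "t > 0" using assms by simp
    then show ?thesis
    proof (rule DERIV_isconst_end[of 0 t mass])
      show "continuous_on {0..t} mass" by (meson d DERIV_isCont continuous_at_imp_continuous_on)
      show "(mass has_real_derivative 0) (at s)" if "0 < s" "s < t" for s using d[of s] z[OF that(1)] by simp
    qed
  qed simp
qed

text \<open>The energies of all Galilean shifts decay, so their linear coefficient is constant.\<close>

lemma momentum_conserved: assumes "t \<ge> 0" shows "momentum i t = momentum i 0"
proof (rule ccontr)
  assume ne: "momentum i t \<noteq> momentum i 0"
  define d where "d = momentum i t - momentum i 0"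
  have d: "d \<noteq> 0" using ne by (simp add: d_def)
  have le: "energy i 0 t + k * d \<le> energy i 0 0" for k
    using energy_nonincreasing[OF assms, of i k] unfolding energy_expand[of i k] mass_conserved[OF assms]
    by (simp add: d_def algebra_simps)
  have "energy i 0 t + (energy i 0 0 + 1) \<le> energy i 0 0" using le[of "(energy i 0 0 + 1) / d"] d by simp
  then show False using energy_nonneg[OF assms, of i 0] by linarith
qed

end

section \<open>Decay of the amplitude\<close>

context topo_solution
begin

definition sup_comp :: "real \<Rightarrow> 'n \<Rightarrow> real \<Rightarrow> real" where
  "sup_comp m i t = (SUP x\<in>unit_cube. m * G (t, x) $ i)"

lemma sup_comp_attained:
  assumes t: "t \<ge> 0"
  shows "\<exists>x\<in>unit_cube. m * u t x $ i = sup_comp m i t \<and> (\<forall>y. m * u t y $ i \<le> m * u t x $ i)"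
proof -
  have "(0::real^'n) \<in> unit_cube" by (simp add: unit_cube_def mem_box_cart)
  then obtain x where x: "x \<in> unit_cube" "\<And>y. y \<in> unit_cube \<Longrightarrow> m * G (t, y) $ i \<le> m * G (t, x) $ i"
    using continuous_attains_sup[of unit_cube "\<lambda>x. m * G (t, x) $ i"]
    by (force simp: unit_cube_def intro!: continuous_intros)
  have "sup_comp m i t = m * G (t, x) $ i"
    unfolding sup_comp_def using x by (intro cSup_eq_maximum) auto
  moreover have "m * u t y $ i \<le> m * u t x $ i" for y
  proof -
    from x(2)[OF lattice_translate_in_unit_cube[of y]] show ?thesis
      using t by (simp add: G_eq periodic_lattice_point[OF per_u[OF t]])
  qed
  ultimately show ?thesis using x t by (auto simp: G_eq)
qed

lemma sup_comp_ge: "t \<ge> 0 \<Longrightarrow> m * u t x $ i \<le> sup_comp m i t"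
  using sup_comp_attained[of t m i] by auto

lemma sup_comp_cont: "continuous_on {a..b} (sup_comp m i)"
  unfolding sup_comp_def[abs_def]
proof (rule continuous_on_Sup_slice)
  show "continuous_on ({a..b} \<times> unit_cube) (\<lambda>(t, x). m * G (t, x) $ i)"
    unfolding split_def prod.collapse by (intro continuous_intros G_cont)
  have "(0::real^'n) \<in> unit_cube" by (simp add: unit_cube_def mem_box_cart)
  then show "unit_cube \<noteq> ({} :: (real^'n) set)" by blast
qed (auto simp: unit_cube_def)

lemma max_time_derivative:
  assumes t: "t > 0" and mx: "\<And>y. m * u t y $ i \<le> m * u t x $ i"
  shows "((\<lambda>s. m * G (s, x) $ i) has_real_derivative m * J t x $ i) (at t)"
proof -
  have t0: "t \<ge> 0" using t by simp
  have sd: "((\<lambda>y. m * G (t, y) $ i) has_derivative (\<lambda>w. m * DG (t, x) (0, w) $ i)) (at x)"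
    by (intro has_derivative_mult_right bounded_linear.has_derivative[OF bounded_linear_vec_nth] G_space)
  have "(\<lambda>w. m * DG (t, x) (0, w) $ i) = (\<lambda>w. 0)"
    by (rule differential_zero_maxmin[OF _ open_UNIV sd]) (use mx t0 in \<open>auto simp: G_eq\<close>)
  then have "m * DG (t, x) (0, u t x) $ i = 0" by metis
  then have "m * J t x $ i = m * DG (t, x) (1, 0) $ i" by (simp add: J_def algebra_simps)
  moreover have "((\<lambda>s. G (s, x) $ i) has_real_derivative DG (t, x) (1, 0) $ i) (at t)"
    using bounded_linear.has_vector_derivative[OF bounded_linear_vec_nth G_time]
    by (simp add: has_real_derivative_iff_has_vector_derivative)
  ultimately show ?thesis using DERIV_cmult[of "\<lambda>s. G (s, x) $ i"] by metis
qed

lemma sup_comp_nonincreasing: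
  assumes m: "\<bar>m\<bar> = 1" and "0 \<le> s" "s \<le> t"
  shows "sup_comp m i t \<le> sup_comp m i s"
proof (rule nonincreasing_by_lower_tangents[OF \<open>s \<le> t\<close> sup_comp_cont])
  fix r assume r: "s < r" "r \<le> t"
  then have r0: "r > 0" "r \<ge> 0" using \<open>0 \<le> s\<close> by auto
  obtain x where x: "m * u r x $ i = sup_comp m i r" "\<And>y. m * u r y $ i \<le> m * u r x $ i"
    using sup_comp_attained[OF r0(2), of m i] by auto
  define a where "a = min 1 (R\<^sub>0 / 2)"
  have a: "a > 0" "2 * a \<le> R\<^sub>0" "a \<le> 1" using R0 by (auto simp: a_def)
  show "\<exists>\<psi> D. (\<psi> has_real_derivative D) (at r) \<and> D \<le> 0 \<and> \<psi> r = sup_comp m i r \<and> (\<forall>q\<in>{s..r}. \<psi> q \<le> sup_comp m i q)"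
  proof (intro exI conjI ballI)
    show "((\<lambda>q. m * G (q, x) $ i) has_real_derivative m * J r x $ i) (at r)"
      by (rule max_time_derivative[OF r0(1) x(2)])
    show "m * J r x $ i \<le> 0" by (rule static_facts(3)[OF r0(1) a m x(2)])
    show "m * G (r, x) $ i = sup_comp m i r" using x(1) r0 by (simp add: G_eq)
    show "m * G (q, x) $ i \<le> sup_comp m i q" if "q \<in> {s..r}" for q
      using sup_comp_ge[of q m x i] that \<open>0 \<le> s\<close> by (simp add: G_eq)
  qed
qed

definition amplitude :: "'n \<Rightarrow> real \<Rightarrow> real" where
  "amplitude i t = sup_comp 1 i t + sup_comp (-1) i t"

lemma amplitude_ge: "t \<ge> 0 \<Longrightarrow> u t x $ i - u t y $ i \<le> amplitude i t"
  using sup_comp_ge[of t 1 x i] sup_comp_ge[of t "-1" y i] by (simp add: amplitude_def)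

lemma amplitude_nonneg: "t \<ge> 0 \<Longrightarrow> amplitude i t \<ge> 0"
  using amplitude_ge[of t 0 i 0] by simp

lemma amplitude_nonincreasing: "0 \<le> s \<Longrightarrow> s \<le> t \<Longrightarrow> amplitude i t \<le> amplitude i s"
  using sup_comp_nonincreasing[of 1 s t i] sup_comp_nonincreasing[of "-1" s t i] by (simp add: amplitude_def)

lemma avg_step:
  assumes t: "t > 0" and a: "a > 0" "2 * a \<le> R\<^sub>0" "a \<le> 1" and pq: "norm (p - q) \<le> a / 5"
  defines "V \<equiv> unit_ball_vol (real CARD('n)) * (a / 10) ^ CARD('n)"
  shows "(avg a i t p - avg a i t q)\<^sup>2 * (c * lam * V) \<le> 8 * (1 + t) * - energy_rate i 0 t"
proof -
  have t0: "t \<ge> 0" using t by simp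
  define z where "z = (1/2) *\<^sub>R (p + q)"
  let ?B = "cball z (a / 10)"
  let ?f = "\<lambda>p x. (u t x $ i - avg a i t p)\<^sup>2"
  have fc: "continuous_on UNIV (?f p)" for p unfolding u_eq[OF t0] by (intro continuous_intros)
  have sub: "?B \<subseteq> cball p (a / 5)" "?B \<subseteq> cball q (a / 5)"
  proof -
    have zp: "p - z = (1/2) *\<^sub>R (p - q)" "q - z = - ((1/2) *\<^sub>R (p - q))"
      by (simp_all add: z_def vec_eq_iff field_simps)
    have "dist p z \<le> a / 10" "dist q z \<le> a / 10" unfolding dist_norm zp using pq by simp_all
    then show "?B \<subseteq> cball p (a / 5)" "?B \<subseteq> cball q (a / 5)" using dist_triangle_le by (auto simp: subset_iff) (smt (verit) dist_triangle)+
  qed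
  have fin: "emeasure lborel ?B < \<infinity>" by (rule emeasure_bounded_finite) simp
  have mono: "(LINT x:?B|lborel. ?f p x) \<le> (LINT x:cball p (a / 5)|lborel. ?f p x)" if "?B \<subseteq> cball p (a / 5)" for p
    unfolding set_lebesgue_integral_def
    using set_integrable_continuous_cball[OF fc, of z "a / 10" p] set_integrable_continuous_cball[OF fc, of p "a / 5" p] that
    by (intro integral_mono) (auto simp: set_integrable_def split: split_indicator)
  have bd: "(LINT x:cball p (a / 5)|lborel. ?f p x) * (c * lam) \<le> 2 * (1 + t) * - energy_rate i 0 t" for p
  proof -
    have "I * (c * l) \<le> 2 * (1 + t) * - e" if "e \<le> - (1/2) * (c / (1 + t) * l * I)" for e I l :: real
      using that t by (simp add: field_simps)
    from this[OF energy_rate_le[OF t a, of i 0 p]] show ?thesis .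
  qed
  have cl: "0 \<le> c * lam" using c_pos c1 by simp
  have "measure lborel ?B = V" using a by (simp add: content_cball V_def)
  then have "(avg a i t p - avg a i t q)\<^sup>2 * V = (LINT x:?B|lborel. (avg a i t p - avg a i t q)\<^sup>2)"
    using fin by (simp add: set_lebesgue_integral_def mult.commute)
  also have "\<dots> \<le> (LINT x:?B|lborel. 2 * ?f p x + 2 * ?f q x)"
  proof (rule set_integral_mono)
    show "set_integrable lborel ?B (\<lambda>x. 2 * ?f p x + 2 * ?f q x)"
      by (intro set_integrable_continuous_cball continuous_intros fc)
    show "(avg a i t p - avg a i t q)\<^sup>2 \<le> 2 * ?f p x + 2 * ?f q x" for x
    proof -
      have "2 * ?f p x + 2 * ?f q x - (avg a i t p - avg a i t q)\<^sup>2 = (2 * u t x $ i - avg a i t p - avg a i t q)\<^sup>2"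
        by (simp add: power2_eq_square algebra_simps)
      then show ?thesis using zero_le_power2[of "2 * u t x $ i - avg a i t p - avg a i t q"] by linarith
    qed
  qed (use fin in \<open>auto simp: set_integrable_def\<close>)
  also have "\<dots> = 2 * (LINT x:?B|lborel. ?f p x) + 2 * (LINT x:?B|lborel. ?f q x)"
    using set_integrable_continuous_cball[OF fc, of z "a / 10" p] set_integrable_continuous_cball[OF fc, of z "a / 10" q]
    by simp
  also have "\<dots> \<le> 2 * (LINT x:cball p (a / 5)|lborel. ?f p x) + 2 * (LINT x:cball q (a / 5)|lborel. ?f q x)"
    using mono[OF sub(1)] mono[OF sub(2)] by simp
  finally have "(avg a i t p - avg a i t q)\<^sup>2 * V * (c * lam)
      \<le> (2 * (LINT x:cball p (a / 5)|lborel. ?f p x) + 2 * (LINT x:cball q (a / 5)|lborel. ?f q x)) * (c * lam)"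
    by (rule mult_right_mono[OF _ cl])
  also have "\<dots> = 2 * ((LINT x:cball p (a / 5)|lborel. ?f p x) * (c * lam)) + 2 * ((LINT x:cball q (a / 5)|lborel. ?f q x) * (c * lam))"
    by (simp add: algebra_simps)
  also have "\<dots> \<le> 8 * (1 + t) * - energy_rate i 0 t" using bd[of p] bd[of q] by linarith
  finally show ?thesis by (simp add: mult_ac)
qed

text \<open>The three terms on the right are the decay rates of the maximum, of minus the minimum, and of the energy.\<close>

lemma amplitude_control:
  "\<exists>K>0. \<forall>t>0. \<forall>x y. x \<in> unit_cube \<longrightarrow> y \<in> unit_cube \<longrightarrow>
     (\<forall>z. u t z $ i \<le> u t x $ i) \<longrightarrow> (\<forall>z. u t y $ i \<le> u t z $ i) \<longrightarrow>
     (u t x $ i - u t y $ i)\<^sup>2 \<le> K * (1 + t) * (- J t x $ i + J t y $ i - energy_rate i 0 t)"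
proof -
  define a where "a = min 1 (R\<^sub>0 / 2)"
  have a: "a > 0" "2 * a \<le> R\<^sub>0" "a \<le> 1" using R0 by (auto simp: a_def)
  define V where "V = unit_ball_vol (real CARD('n)) * (a / 10) ^ CARD('n)"
  have V: "V > 0" using a by (simp add: V_def)
  have lam: "lam > 0" using c1 R0 by simp
  have clV: "c * lam * V > 0" using c_pos lam V by (metis mult_pos_pos)
  obtain R where R: "\<And>x::real^'n. x \<in> unit_cube \<Longrightarrow> norm x \<le> R" using unit_cube_bounded by blast
  obtain N :: nat where N: "real N > 2 * R / (a / 5)" using reals_Archimedean2 by blast
  define A0 where "A0 = amplitude i 0"
  have A0: "A0 \<ge> 0" by (simp add: A0_def amplitude_nonneg)
  define K where "K = 2 * A0 / lam + (real N)\<^sup>2 * 8 / (c * lam * V) + 1"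
  have K1: "2 * A0 / lam \<ge> 0" "(real N)\<^sup>2 * 8 / (c * lam * V) \<ge> 0"
    by (rule divide_nonneg_pos[OF _ lam], use A0 in simp) (rule divide_nonneg_pos[OF _ clV], simp)
  have K: "K > 0" using K1 by (simp add: K_def)
  show ?thesis
  proof (intro exI[of _ K] conjI K allI impI)
    fix t x y assume t: "t > 0" and xy: "x \<in> unit_cube" "y \<in> unit_cube"
      and mx: "\<forall>z. u t z $ i \<le> u t x $ i" and mn: "\<forall>z. u t y $ i \<le> u t z $ i"
    have t0: "t \<ge> 0" using t by simp
    define D where "D = - energy_rate i 0 t"
    have D: "D \<ge> 0" using energy_rate_nonpos[OF t, of i 0] by (simp add: D_def)
    define Dp where "Dp = - J t x $ i"
    define Dm where "Dm = J t y $ i"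
    have p1: "Dp \<ge> lam * (u t x $ i - avg a i t x)" and p2: "Dp \<ge> 0"
      using static_facts(2,3)[OF t a, of 1 i x] mx by (auto simp: Dp_def)
    have m1: "Dm \<ge> lam * (avg a i t y - u t y $ i)" and m2: "Dm \<ge> 0"
      using static_facts(2,3)[OF t a, of "-1" i y] mn by (auto simp: Dm_def algebra_simps)
    define Y where "Y = sqrt (8 * (1 + t) * D / (c * lam * V))"
    have "\<bar>avg a i t x - avg a i t y\<bar> \<le> real N * Y"
    proof (rule chain_bound[where s = "a / 5" and f = "avg a i t"])
      show "\<bar>avg a i t p - avg a i t q\<bar> \<le> Y" if "norm (p - q) \<le> a / 5" for p q
      proof -
        have "(avg a i t p - avg a i t q)\<^sup>2 \<le> 8 * (1 + t) * D / (c * lam * V)"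
          using avg_step[OF t a that, of i] clV unfolding V_def[symmetric] D_def[symmetric]
          by (simp only: pos_le_divide_eq)
        then show ?thesis unfolding Y_def by (rule real_le_rsqrt[where x = "\<bar>avg a i t p - avg a i t q\<bar>", unfolded power2_abs])
      qed
      have "norm (x - y) \<le> 2 * R" using norm_triangle_ineq4[of x y] R[OF xy(1)] R[OF xy(2)] by linarith
      also have "\<dots> \<le> real N * (a / 5)" using N a(1) by (simp add: field_simps)
      finally show "norm (x - y) \<le> real N * (a / 5)" .
    qed
    define A where "A = u t x $ i - u t y $ i"
    define X where "X = (Dp + Dm) / lam"
    have X: "X \<ge> 0" using p2 m2 lam by (simp only: X_def divide_nonneg_pos add_nonneg_nonneg)
    have AX: "A \<le> X + real N * Y"
    proof -
      have "lam * ((u t x $ i - avg a i t x) + (avg a i t y - u t y $ i)) \<le> Dp + Dm"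
        using add_mono[OF p1 m1] by (simp only: distrib_left)
      then have "(u t x $ i - avg a i t x) + (avg a i t y - u t y $ i) \<le> X"
        unfolding X_def pos_le_divide_eq[OF lam] by (simp only: mult.commute)
      then show ?thesis using \<open>\<bar>avg a i t x - avg a i t y\<bar> \<le> real N * Y\<close> unfolding A_def by linarith
    qed
    have A: "0 \<le> A" using mn by (simp add: A_def)
    have AA0: "A \<le> A0" using amplitude_ge[OF t0, of x i y] amplitude_nonincreasing[of 0 t i] t0
      by (simp add: A_def A0_def)
    have "A\<^sup>2 \<le> 2 * A0 * X + (real N * Y)\<^sup>2"
    proof -
      have "A * A \<le> A * (X + real N * Y)" by (rule mult_left_mono[OF AX A])
      moreover have "A * X \<le> A0 * X" by (rule mult_right_mono[OF AA0 X])
      moreover have "0 \<le> (A - real N * Y)\<^sup>2" by simp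
      ultimately show ?thesis by (simp add: power2_eq_square algebra_simps)
    qed
    also have "(real N * Y)\<^sup>2 = (real N)\<^sup>2 * 8 / (c * lam * V) * ((1 + t) * D)"
    proof -
      have "Y\<^sup>2 = 8 * (1 + t) * D / (c * lam * V)" unfolding Y_def using D t clV by (intro real_sqrt_pow2 divide_nonneg_pos) auto
      then show ?thesis by (simp add: power_mult_distrib)
    qed
    also have "2 * A0 * X = 2 * A0 / lam * (Dp + Dm)" by (simp add: X_def)
    also have "2 * A0 / lam * (Dp + Dm) + (real N)\<^sup>2 * 8 / (c * lam * V) * ((1 + t) * D) \<le> K * (1 + t) * (Dp + Dm + D)"
    proof -
      have "2 * A0 / lam * (Dp + Dm) \<le> K * ((1 + t) * (Dp + Dm))"
        using K1 p2 m2 t by (intro mult_mono) (auto simp: K_def mult_le_cancel_right1)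
      moreover have "(real N)\<^sup>2 * 8 / (c * lam * V) * ((1 + t) * D) \<le> K * ((1 + t) * D)"
        using K1 D t by (intro mult_right_mono) (auto simp: K_def)
      ultimately show ?thesis by (simp add: algebra_simps)
    qed
    finally show "(u t x $ i - u t y $ i)\<^sup>2 \<le> K * (1 + t) * (- J t x $ i + J t y $ i - energy_rate i 0 t)"
      by (simp add: A_def Dp_def Dm_def D_def)
  qed
qed

lemma amplitude_decay: "\<exists>B\<ge>0. \<forall>t>0. (amplitude i t)\<^sup>2 * ln (1 + t) \<le> B"
proof -
  obtain K where K: "K > 0" and ctl: "\<And>t x y. t > 0 \<Longrightarrow> x \<in> unit_cube \<Longrightarrow> y \<in> unit_cube \<Longrightarrow>
     (\<forall>z. u t z $ i \<le> u t x $ i) \<Longrightarrow> (\<forall>z. u t y $ i \<le> u t z $ i) \<Longrightarrow>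
     (u t x $ i - u t y $ i)\<^sup>2 \<le> K * (1 + t) * (- J t x $ i + J t y $ i - energy_rate i 0 t)"
    using amplitude_control[of i] by (elim exE conjE) simp
  define B where "B = K * (amplitude i 0 + energy i 0 0)"
  have "(amplitude i t)\<^sup>2 * ln (1 + t) \<le> B" if t: "t > 0" for t
  proof -
    define k where "k = (amplitude i t)\<^sup>2 / K"
    define W where "W = (\<lambda>s. amplitude i s + energy i 0 s + k * ln (1 + s))"
    have "W t \<le> W 0"
    proof (rule nonincreasing_by_lower_tangents[where W = W])
      show "0 \<le> t" using t by simp
      show "continuous_on {0..t} W" unfolding W_def amplitude_def
        by (intro continuous_intros sup_comp_cont energy_cont) auto
      fix s assume s: "0 < s" "s \<le> t"
      then have s0: "s \<ge> 0" by simp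
      from sup_comp_attained[OF s0, of 1 i] obtain x where x: "x \<in> unit_cube" "1 * u s x $ i = sup_comp 1 i s"
        "\<forall>y. 1 * u s y $ i \<le> 1 * u s x $ i" by (elim bexE conjE)
      from sup_comp_attained[OF s0, of "-1" i] obtain y where y: "y \<in> unit_cube" "-1 * u s y $ i = sup_comp (-1) i s"
        "\<forall>z. -1 * u s z $ i \<le> -1 * u s y $ i" by (elim bexE conjE)
      let ?D = "1 * J s x $ i + -1 * J s y $ i + energy_rate i 0 s + k * (1 / (1 + s))"
      have d: "((\<lambda>q. 1 * G (q, x) $ i + -1 * G (q, y) $ i + energy i 0 q + k * ln (1 + q)) has_real_derivative ?D) (at s)"
      proof -
        have 1: "((\<lambda>q. 1 * G (q, x) $ i) has_real_derivative 1 * J s x $ i) (at s)"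
          by (rule max_time_derivative[OF s(1) x(3)[rule_format]])
        have 2: "((\<lambda>q. - 1 * G (q, y) $ i) has_real_derivative - 1 * J s y $ i) (at s)"
          by (rule max_time_derivative[OF s(1) y(3)[rule_format]])
        have "((\<lambda>q. ln (1 + q)) has_real_derivative 1 / (1 + s)) (at s)"
          using s by (auto intro!: derivative_eq_intros)
        from DERIV_add[OF DERIV_add[OF DERIV_add[OF 1 2] energy_deriv] DERIV_cmult[OF this]] show ?thesis .
      qed
      have amp: "amplitude i s = u s x $ i - u s y $ i" using x(2) y(2) by (simp add: amplitude_def)
      have "k * (1 / (1 + s)) \<le> - J s x $ i + J s y $ i - energy_rate i 0 s"
      proof -
        have "(amplitude i t)\<^sup>2 \<le> (amplitude i s)\<^sup>2"
          using amplitude_nonincreasing[OF s0 s(2), of i] amplitude_nonneg[of t i] t by (intro power_mono) auto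
        also have "\<dots> \<le> K * (1 + s) * (- J s x $ i + J s y $ i - energy_rate i 0 s)"
          unfolding amp
        proof (rule ctl[OF s(1) x(1) y(1)])
          show "\<forall>z. u s z $ i \<le> u s x $ i" using x(3) by simp
          show "\<forall>z. u s y $ i \<le> u s z $ i"
          proof
            fix z
            have "-1 * u s z $ i \<le> -1 * u s y $ i" using y(3) by (rule spec)
            then show "u s y $ i \<le> u s z $ i" by linarith
          qed
        qed
        finally have "(amplitude i t)\<^sup>2 / (K * (1 + s)) \<le> - J s x $ i + J s y $ i - energy_rate i 0 s"
          using K s by (simp only: pos_divide_le_eq mult_pos_pos add_pos_pos zero_less_one mult.commute)
        then show ?thesis by (simp add: k_def)
      qed
      then have D: "?D \<le> 0" by simp
      show "\<exists>\<psi> D. (\<psi> has_real_derivative D) (at s) \<and> D \<le> 0 \<and> \<psi> s = W s \<and> (\<forall>q\<in>{0..s}. \<psi> q \<le> W q)"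
      proof (intro exI conjI ballI)
        show "((\<lambda>q. 1 * G (q, x) $ i + -1 * G (q, y) $ i + energy i 0 q + k * ln (1 + q)) has_real_derivative ?D) (at s)" by (rule d)
        show "?D \<le> 0" by (rule D)
        show "1 * G (s, x) $ i + -1 * G (s, y) $ i + energy i 0 s + k * ln (1 + s) = W s"
          using s0 by (simp add: W_def amp G_eq)
        show "1 * G (q, x) $ i + -1 * G (q, y) $ i + energy i 0 q + k * ln (1 + q) \<le> W q" if "q \<in> {0..s}" for q
          using amplitude_ge[of q x i y] that by (simp add: W_def G_eq)
      qed
    qed
    then have "k * ln (1 + t) \<le> amplitude i 0 + energy i 0 0"
      using amplitude_nonneg[of t i] energy_nonneg[of t i 0] t by (simp add: W_def)
    then have "K * (k * ln (1 + t)) \<le> B" unfolding B_def using K by (intro mult_left_mono) auto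
    then show ?thesis using K by (simp add: k_def)
  qed
  moreover have "B \<ge> 0" unfolding B_def using K amplitude_nonneg[of 0 i] energy_nonneg[of 0 i 0] by simp
  ultimately show ?thesis by blast
qed

lemma mass_pos: "mass 0 > 0"
proof -
  have "c = integral unit_cube (\<lambda>x::real^'n. c)"
  proof -
    have "cbox 0 (1::real^'n) \<noteq> {}" by (auto simp: interval_ne_empty_cart)
    then have "measure lborel (cbox 0 (1::real^'n)) = 1" by (simp add: content_cbox_cart)
    then show ?thesis by (simp add: unit_cube_def)
  qed
  also have "\<dots> \<le> mass 0" unfolding mass_def unit_cube_def
    by (intro integral_le integrable_continuous continuous_intros) (use lower[of 0] in \<open>auto simp: F_eq\<close>)
  finally show ?thesis using c_pos by simp
qed

lemma mean_between:
  assumes t: "t \<ge> 0"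
  shows "\<bar>u t x $ i - momentum i 0 / mass 0\<bar> \<le> amplitude i t"
proof -
  have F0: "0 \<le> F (t, y)" for y
  proof -
    have "0 < c / (1 + t)" using c_pos t by simp
    then show ?thesis using lower[OF t, of y] t by (simp add: F_eq)
  qed
  have lo: "(u t x $ i - amplitude i t) * mass t \<le> momentum i t"
    unfolding mass_def momentum_def unit_cube_def integral_mult_right[symmetric]
  proof (rule integral_le)
    fix y
    have "u t x $ i - amplitude i t \<le> G (t, y) $ i" using amplitude_ge[OF t, of x i y] t by (simp add: G_eq)
    from mult_right_mono[OF this F0[of y]]
    show "(u t x $ i - amplitude i t) * F (t, y) \<le> F (t, y) * G (t, y) $ i" by (simp only: mult.commute)
  qed (intro integrable_continuous continuous_intros)+
  have hi: "momentum i t \<le> (u t x $ i + amplitude i t) * mass t"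
    unfolding mass_def momentum_def unit_cube_def integral_mult_right[symmetric]
  proof (rule integral_le)
    fix y
    have "G (t, y) $ i \<le> u t x $ i + amplitude i t" using amplitude_ge[OF t, of y i x] t by (simp add: G_eq)
    from mult_right_mono[OF this F0[of y]]
    show "F (t, y) * G (t, y) $ i \<le> (u t x $ i + amplitude i t) * F (t, y)" by (simp only: mult.commute)
  qed (intro integrable_continuous continuous_intros)+
  from lo hi show ?thesis
    unfolding momentum_conserved[OF t] mass_conserved[OF t]
    using mass_pos by (simp add: abs_le_iff field_simps)
qed

lemma component_decay: "\<exists>C\<ge>0. \<forall>t\<ge>3. \<forall>x. \<bar>u t x $ i - momentum i 0 / mass 0\<bar> \<le> C / sqrt (ln t)"
proof -
  obtain B where B: "B \<ge> 0" "\<And>t. t > 0 \<Longrightarrow> (amplitude i t)\<^sup>2 * ln (1 + t) \<le> B" using amplitude_decay by blast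
  have "\<bar>u t x $ i - momentum i 0 / mass 0\<bar> \<le> sqrt B / sqrt (ln t)" if t: "t \<ge> 3" for t x
  proof -
    have ln: "ln t > 0" "ln t \<le> ln (1 + t)" using t by auto
    have "(amplitude i t)\<^sup>2 * ln t \<le> (amplitude i t)\<^sup>2 * ln (1 + t)" by (rule mult_left_mono[OF ln(2)]) simp
    also have "\<dots> \<le> B" using B(2) t by simp
    finally have "(amplitude i t)\<^sup>2 \<le> B / ln t" using ln by (simp add: field_simps)
    then have "amplitude i t \<le> sqrt (B / ln t)" by (rule real_le_rsqrt)
    then show ?thesis using mean_between[of t x i] t by (simp add: real_sqrt_divide)
  qed
  then show ?thesis using B(1) by (intro exI[of _ "sqrt B"]) auto
qed

lemma velocity_decay:
  "\<exists>C>0. \<forall>t\<ge>3. \<forall>x. norm (u t x - (1 / integral unit_cube (\<rho> 0)) *\<^sub>R integral unit_cube (\<lambda>y. \<rho> 0 y *\<^sub>R u 0 y)) \<le> C / sqrt (ln t)"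
proof -
  let ?w = "(1 / integral unit_cube (\<rho> 0)) *\<^sub>R integral unit_cube (\<lambda>y. \<rho> 0 y *\<^sub>R u 0 y)"
  have w: "?w $ i = momentum i 0 / mass 0" for i
  proof -
    have "(\<lambda>y. \<rho> 0 y *\<^sub>R u 0 y) integrable_on unit_cube"
    proof -
      have "(\<lambda>y. F (0, y) *\<^sub>R G (0, y)) integrable_on unit_cube"
        unfolding unit_cube_def by (intro integrable_continuous continuous_intros)
      then show ?thesis by (simp add: F_eq G_eq)
    qed
    from integral_component_eq_cart[OF this, of i] show ?thesis
      by (simp add: momentum_def mass_def F_eq G_eq)
  qed
  have "\<forall>i. \<exists>C\<ge>0. \<forall>t\<ge>3. \<forall>x. \<bar>u t x $ i - momentum i 0 / mass 0\<bar> \<le> C / sqrt (ln t)"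
    using component_decay by blast
  then obtain C where C: "\<And>i. C i \<ge> 0" "\<And>i t x. t \<ge> 3 \<Longrightarrow> \<bar>u t x $ i - momentum i 0 / mass 0\<bar> \<le> C i / sqrt (ln t)"
    by metis
  have le: "norm (u t x - ?w) \<le> ((\<Sum>i\<in>UNIV. C i) + 1) / sqrt (ln t)" if t: "t \<ge> 3" for t x
  proof -
    have ln: "ln t > 0" using t by simp
    have "norm (u t x - ?w) \<le> (\<Sum>i\<in>UNIV. \<bar>(u t x - ?w) $ i\<bar>)" by (rule norm_le_l1_cart)
    also have "\<dots> \<le> (\<Sum>i\<in>UNIV. C i / sqrt (ln t))"
      by (intro sum_mono) (use C(2)[OF t] w in simp)
    also have "\<dots> \<le> ((\<Sum>i\<in>UNIV. C i) + 1) / sqrt (ln t)"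
      using ln by (simp add: sum_divide_distrib[symmetric] divide_right_mono)
    finally show ?thesis .
  qed
  have "(\<Sum>i\<in>UNIV. C i) + 1 > 0" using sum_nonneg[of UNIV C] C(1) by (simp add: add_nonneg_pos)
  with le show ?thesis by blast
qed

end

theorem theorem1p2:
  fixes \<rho> :: "real \<Rightarrow> real^'n \<Rightarrow> real"
    and u :: "real \<Rightarrow> real^'n \<Rightarrow> real^'n"
    and h :: "real \<Rightarrow> real"
    and \<alpha> R\<^sub>0 c :: real
  assumes alpha: "0 < \<alpha>" "\<alpha> < 2"
    and R0: "R\<^sub>0 > 0"
    and h_smooth: "Cinf h"
    and h_nonneg: "\<forall>r. 0 \<le> h r"
    and h_lower: "\<exists>c1>0. \<forall>r. 0 \<le> r \<and> r < R\<^sub>0 \<longrightarrow> c1 \<le> h r"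
    and h_upper: "\<exists>c2. \<forall>r. 0 \<le> r \<longrightarrow> h r \<le> c2 * (if r < 2 * R\<^sub>0 then 1 else 0)"
    and smooth_rho: "smooth_halfspace \<rho>"
    and smooth_u: "smooth_halfspace u"
    and per_rho: "\<forall>t\<ge>0. periodic (\<rho> t)"
    and per_u: "\<forall>t\<ge>0. periodic (u t)"
    and pos: "\<forall>t\<ge>0. \<forall>x. \<rho> t x > 0"
    and mass_eq: "\<forall>t>0. \<forall>x.
        vector_derivative (\<lambda>s. \<rho> s x) (at t)
        + (\<Sum>i\<in>UNIV. frechet_derivative (\<lambda>y. \<rho> t y * u t y $ i) (at x) (axis i 1)) = 0"
    and align_int: "\<forall>t>0. \<forall>x. \<forall>\<epsilon>>0. align_trunc h \<alpha> \<rho> u t x \<epsilon> integrable_on UNIV"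
    and mom_eq: "\<forall>t>0. \<forall>x.
        ((\<lambda>\<epsilon>. integral UNIV (align_trunc h \<alpha> \<rho> u t x \<epsilon>))
          \<longlongrightarrow> vector_derivative (\<lambda>s. u s x) (at t) + frechet_derivative (u t) (at x) (u t x))
        (at_right 0)"
    and c_pos: "c > 0"
    and lower: "\<forall>t\<ge>0. \<forall>x. \<rho> t x \<ge> c / (1 + t)"
  shows "\<exists>C>0. \<forall>t\<ge>3. \<forall>x.
     norm (u t x - (1 / integral unit_cube (\<rho> 0)) *\<^sub>R integral unit_cube (\<lambda>y. \<rho> 0 y *\<^sub>R u 0 y))
       \<le> C / sqrt (ln t)"
proof -
  obtain c1 where c1: "c1 > 0" "\<And>r. 0 \<le> r \<Longrightarrow> r < R\<^sub>0 \<Longrightarrow> c1 \<le> h r" using h_lower by auto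
  obtain c2 where c2: "\<And>r. 0 \<le> r \<Longrightarrow> h r \<le> c2 * (if r < 2 * R\<^sub>0 then 1 else 0)" using h_upper by auto
  obtain F where F: "Cinf F" "\<And>t x. t \<ge> 0 \<Longrightarrow> F (t, x) = \<rho> t x"
    using smooth_rho unfolding smooth_halfspace_def by auto
  obtain G where G: "Cinf G" "\<And>t x. t \<ge> 0 \<Longrightarrow> G (t, x) = u t x"
    using smooth_u unfolding smooth_halfspace_def by auto
  have h2: "h s \<le> c2" if "0 \<le> s" for s
  proof -
    have "0 \<le> c2" using c2[of 0] h_nonneg[rule_format, of 0] R0 by simp
    then show ?thesis using c2[OF that] by (auto split: if_splits intro: order_trans)
  qed
  have h0: "h s = 0" if "2 * R\<^sub>0 \<le> s" for s
    using c2[of s] that R0 h_nonneg[rule_format, of s] by simp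
  interpret topo_solution \<rho> u h \<alpha> R\<^sub>0 c1 c2 c F G
    by (rule topo_solution.intro)
      (fact alpha R0 Cinf_continuous_on[OF h_smooth] h_nonneg[rule_format] h2 h0 c1 F G per_rho[rule_format]
        per_u[rule_format] mass_eq[rule_format] align_int[rule_format] mom_eq[rule_format] c_pos lower[rule_format])+
  show ?thesis by (rule velocity_decay)
qed

end
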